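(* Let $\gamma_1,\dots,\gamma_{15}$ be a fixed choice of representatives of the cosets of $\Gamma_{2,0}(2)$ in $\Gamma_2$ and let $\varphi=\prod_{i=1}^{15}\varphi_{\gamma_i}$, where $\varphi_\gamma(\tau)=\chi_P(\gamma)^{-1}\det(c\tau+d)^{-2}F_{M_0}(\gamma\tau)$ for $\gamma=\begin{pmatrix} a&b\\c&d\end{pmatrix}\in\Gamma_2$. Then there exists $\lambda\in\mathbb{C}^*$ such that $\varphi=\lambda\,(azy)_5$ as functions on $\mathfrak{S}_2$.
   Context: Let $\mathfrak{S}_2$ be the Siegel upper half-plane of complex symmetric $2\times 2$ matrices with positive definite imaginary part. The group $\Gamma_2=Sp(4,\mathbb{Z})$ acts on it by $\gamma\tau=(a\tau+b)(c\tau+d)^{-1}$ for $\gamma=\begin{pmatrix} a&b\\c&d\end{pmatrix}$ in $2\times2$ blocks. Let $\Gamma_2(2)=\{\gamma\in\Gamma_2: \gamma\equiv 1_4 \bmod 2\}$ and $\Gamma_{2,0}(2)=\{\gamma\in\Gamma_2: c\equiv 0 \bmod 2\}$, which has index $15$ in $\Gamma_2$. "Representatives of the cosets of $\Gamma_{2,0}(2)$ in $\Gamma_2$" means representatives of the right cosets $\Gamma_{2,0}(2)\gamma$. Characteristics and $\chi_P$: a $2$-characteristic is a column $m=\begin{bmatrix} m'\\ m''\end{bmatrix}$ with $m',m''\in\mathbb{Z}_2^2$ (entries represented by $0,1$). Its parity is $e(m)=(-1)^{{}^tm'm''}$; $m$ is even if $e(m)=1$ and odd if $e(m)=-1$. There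 are ten even and six odd $2$-characteristics. Sums of characteristics are taken mod $2$. $\Gamma_2$ acts on $2$-characteristics by $$\gamma\begin{bmatrix} m'\\ m''\end{bmatrix}=\left[\begin{pmatrix} d&-c\\-b&a\end{pmatrix}\begin{pmatrix} m'\\ m''\end{pmatrix}+\begin{pmatrix}\mathrm{diag}(c\,{}^td)\\ \mathrm{diag}(a\,{}^tb)\end{pmatrix}\right]\bmod 2,$$ preserving parity, with $\Gamma_2(2)$ acting trivially. The action on the six odd characteristics gives an isomorphism $\psi_P:\Gamma_2/\Gamma_2(2)\to S_6$. Define $\chi_P(\gamma)=1$ if $\psi_P([\gamma])$ is an even permutation and $\chi_P(\gamma)=-1$ if it is odd, and put $\Gamma_2^+=\ker\chi_P$. Theta constants: for a $2$-characteristic $m$, $$\theta_m(\tau)=\sum_{n\in\mathbb{Z}^2}\exp\left(\pi i\left[{}^t\left(n+\tfrac{m'}{2}\right)\tau\left(n+\tfrac{m'}{2}\right)+{}^t\left(n+\tfrac{m'}{2}\right)m''\right]\right).$$ For $m'\in\mathbb{Z}_2^2$ the second order Theta constant is $\Theta_{m'}(\tau)=\theta_{\left[\begin{smallmatrix} m'\\0\end{smallmatrix}\right]}(2\tau)$. Put $F_{M_0}(\tau)=\prod_{m'\in\mathbb{Z}_2^2}\Theta_{m'}(\tau)$. The form $(azy)_5$: let $C_3^-$ be the set of unordered triples $\{m_1,m_2,m_3\}$ of distinct even $2$-characteristics with $e(m_1+m_2+m_3)=-1$ (there are $60$ of them). Then $$(azy)_5=\frac18\sum_{\{m_i,m_j,m_k\}\in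 C_3^-}\pm(\theta_{m_i}\theta_{m_j}\theta_{m_k})^{20},$$ where the signs are chosen so that $(azy)_5$ is the correct symmetrization, i.e. a non-zero modular form of weight $30$ transforming with the character $\chi_P$ under $\Gamma_2$: $(azy)_5(\gamma\tau)=\chi_P(\gamma)\det(c\tau+d)^{30}(azy)_5(\tau)$ for all $\gamma\in\Gamma_2$. This determines the signs up to a global sign. *)

theory Defs
  imports
    "HOL-Analysis.Analysis"
    "HOL-Algebra.Coset"
    "HOL-Combinatorics.Permutations"
    "HOL-Library.Z2"
begin

subsection \<open>The Siegel upper half-plane and the symplectic group\<close>

definition siegel_H2 :: "(complex^2^2) set" where
  "siegel_H2 = {\<tau>. transpose \<tau> = \<tau> \<and> (\<forall>x. x \<noteq> 0 \<longrightarrow> x \<bullet> (map_matrix Im \<tau> *v x) > 0)}"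

text \<open>A \<open>4 \<times> 4\<close> matrix has rows and columns indexed by the sum type \<^typ>\<open>2 + 2\<close>,
  so that its \<open>2 \<times> 2\<close> blocks are obtained by restriction to the two summands.\<close>

type_synonym mat4 = "int^(2 + 2)^(2 + 2)"

definition block_a :: "mat4 \<Rightarrow> int^2^2" where "block_a \<gamma> = (\<chi> i j. \<gamma> $ Inl i $ Inl j)"
definition block_b :: "mat4 \<Rightarrow> int^2^2" where "block_b \<gamma> = (\<chi> i j. \<gamma> $ Inl i $ Inr j)"
definition block_c :: "mat4 \<Rightarrow> int^2^2" where "block_c \<gamma> = (\<chi> i j. \<gamma> $ Inr i $ Inl j)"
definition block_d :: "mat4 \<Rightarrow> int^2^2" where "block_d \<gamma> = (\<chi> i j. \<gamma> $ Inr i $ Inr j)"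

definition symplectic_J :: mat4 where
  "symplectic_J = (\<chi> i j. case (i, j) of
      (Inl k, Inr l) \<Rightarrow> of_bool (k = l)
    | (Inr k, Inl l) \<Rightarrow> - of_bool (k = l)
    | _ \<Rightarrow> 0)"

definition Gamma2 :: "mat4 monoid" where
  "Gamma2 = \<lparr>carrier = {\<gamma>. transpose \<gamma> ** symplectic_J ** \<gamma> = symplectic_J},
             mult = (**), one = mat 1\<rparr>"

definition Gamma20_2 :: "mat4 set" where
  "Gamma20_2 = {\<gamma> \<in> carrier Gamma2. \<forall>i j. even (block_c \<gamma> $ i $ j)}"

definition cfactor :: "mat4 \<Rightarrow> complex^2^2 \<Rightarrow> complex^2^2" where
  "cfactor \<gamma> \<tau> = map_matrix of_int (block_c \<gamma>) ** \<tau> + map_matrix of_int (block_d \<gamma>)"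

definition siegel_act :: "mat4 \<Rightarrow> complex^2^2 \<Rightarrow> complex^2^2" where
  "siegel_act \<gamma> \<tau> =
     (map_matrix of_int (block_a \<gamma>) ** \<tau> + map_matrix of_int (block_b \<gamma>))
       ** matrix_inv (cfactor \<gamma> \<tau>)"


subsection \<open>Characteristics and the character \<open>\<chi>\<^sub>P\<close>\<close>

instance bit :: finite
proof
  have "finite {0, 1 :: bit}"
    by simp
  moreover have "(UNIV :: bit set) \<subseteq> {0, 1}"
    by (auto intro: bit.exhaust)
  ultimately show "finite (UNIV :: bit set)"
    by (rule rev_finite_subset)
qed

type_synonym characteristic = "(bit^2) \<times> (bit^2)"

definition parity :: "characteristic \<Rightarrow> int" where
  "parity m = (-1) ^ (\<Sum>i\<in>UNIV. of_bit (fst m $ i) * of_bit (snd m $ i))"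

definition even_chars :: "characteristic set" where
  "even_chars = {m. parity m = 1}"

definition odd_chars :: "characteristic set" where
  "odd_chars = {m. parity m = -1}"

definition char_act :: "mat4 \<Rightarrow> characteristic \<Rightarrow> characteristic" where
  "char_act \<gamma> m =
     (let a = block_a \<gamma>; b = block_b \<gamma>; c = block_c \<gamma>; d = block_d \<gamma>
      in (map_matrix of_int d *v fst m - map_matrix of_int c *v snd m
            + (\<chi> i. of_int ((c ** transpose d) $ i $ i)),
          - (map_matrix of_int b *v fst m) + map_matrix of_int a *v snd m
            + (\<chi> i. of_int ((a ** transpose b) $ i $ i))))"

text \<open>The permutation of the six odd characteristics induced by \<open>\<gamma>\<close>, extended by the
  identity to the even ones because \<^const>\<open>sign\<close> expects a function on the whole type.\<close>

definition psi_P :: "mat4 \<Rightarrow> characteristic \<Rightarrow> characteristic" where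
  "psi_P \<gamma> = (\<lambda>m. if m \<in> odd_chars then char_act \<gamma> m else m)"

definition chi_P :: "mat4 \<Rightarrow> int" where
  "chi_P \<gamma> = sign (psi_P \<gamma>)"


subsection \<open>Theta constants\<close>

definition theta_const :: "characteristic \<Rightarrow> complex^2^2 \<Rightarrow> complex" where
  "theta_const m \<tau> =
     (\<Sum>\<^sub>\<infinity>n\<in>(UNIV :: (int^2) set).
        let v = (\<chi> i. of_int (n $ i) + of_bit (fst m $ i) / 2)
        in exp (of_real pi * \<i> *
             (scalar_product v (\<tau> *v v) + scalar_product v (\<chi> i. of_bit (snd m $ i)))))"

definition second_order_theta :: "bit^2 \<Rightarrow> complex^2^2 \<Rightarrow> complex" where
  "second_order_theta m' \<tau> = theta_const (m', 0) (2 *\<^sub>R \<tau>)"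

definition F_M0 :: "complex^2^2 \<Rightarrow> complex" where
  "F_M0 \<tau> = (\<Prod>m'\<in>UNIV. second_order_theta m' \<tau>)"

definition phi_gamma :: "mat4 \<Rightarrow> complex^2^2 \<Rightarrow> complex" where
  "phi_gamma \<gamma> \<tau> =
     inverse (of_int (chi_P \<gamma>)) * det (cfactor \<gamma> \<tau>) powi (-2) * F_M0 (siegel_act \<gamma> \<tau>)"


subsection \<open>Modular forms and the form \<open>(azy)\<^sub>5\<close>\<close>

text \<open>Holomorphy on \<^const>\<open>siegel_H2\<close> is complex differentiability relative to the
  three-dimensional space of symmetric matrices, in which \<^const>\<open>siegel_H2\<close> is open.
  No condition at the cusps is needed in degree 2 (Koecher principle).\<close>

definition holomorphic_on_H2 :: "(complex^2^2 \<Rightarrow> complex) \<Rightarrow> bool" where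
  "holomorphic_on_H2 f \<longleftrightarrow>
     (\<forall>\<tau>\<in>siegel_H2. \<exists>D. (f has_derivative D) (at \<tau> within siegel_H2) \<and>
        (\<forall>z X. D (\<chi> i j. z * X $ i $ j) = z * D X))"

definition modular_form :: "nat \<Rightarrow> (mat4 \<Rightarrow> int) \<Rightarrow> (complex^2^2 \<Rightarrow> complex) \<Rightarrow> bool" where
  "modular_form k v f \<longleftrightarrow> holomorphic_on_H2 f \<and>
     (\<forall>\<gamma>\<in>carrier Gamma2. \<forall>\<tau>\<in>siegel_H2.
        f (siegel_act \<gamma> \<tau>) = of_int (v \<gamma>) * det (cfactor \<gamma> \<tau>) ^ k * f \<tau>)"

definition C3_minus :: "characteristic set set" where
  "C3_minus = {T. T \<subseteq> even_chars \<and> card T = 3 \<and> parity (\<Sum>m\<in>T. m) = -1}"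

definition azy5 :: "(characteristic set \<Rightarrow> int) \<Rightarrow> complex^2^2 \<Rightarrow> complex" where
  "azy5 s \<tau> = 1 / 8 * (\<Sum>T\<in>C3_minus. of_int (s T) * (\<Prod>m\<in>T. theta_const m \<tau>) ^ 20)"

definition azy5_signs :: "(characteristic set \<Rightarrow> int) \<Rightarrow> bool" where
  "azy5_signs s \<longleftrightarrow>
     (\<forall>T\<in>C3_minus. s T \<in> {1, -1}) \<and>
     modular_form 30 chi_P (azy5 s) \<and>
     (\<exists>\<tau>\<in>siegel_H2. azy5 s \<tau> \<noteq> 0)"

end

theory Submission
  imports Defs "HOL-Complex_Analysis.Conformal_Mappings" "HOL-Real_Asymp.Real_Asymp"
begin

text \<open>Let \<open>X = Theta \<tau>\<close> be the vector of the four second order theta constants. Both sides of the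
identity are homogeneous polynomials of degree 60 in \<open>X\<close>, and the theorem holds because both are, up
to a constant, the product of sixty linear forms, those that define the mirrors of a finite reflection
group.

For \<open>(azy)\<^sub>5\<close>, the square of each theta constant is a quadratic form in \<open>X\<close> (\<open>theta_const_square\<close>), so
the sum of twentieth powers is a polynomial \<open>azy5_poly\<close> of degree 60. For \<open>\<phi>\<close>, every symplectic
matrix \<open>\<gamma>\<close> acts on theta constants by \<open>Theta (\<gamma>\<tau>) = \<kappa> \<rho> (Theta \<tau>)\<close>, where \<open>\<rho>\<close> is an invertible
constant matrix and \<open>\<kappa>\<^sup>4\<close> is a constant multiple of \<open>det (c\<tau> + d)\<^sup>2\<close> (\<open>theta_rep_exists\<close>). Hence
\<open>\<phi>\<^sub>\<gamma>\<close> is a constant times the product of the four coordinates of \<open>\<rho> X\<close>, and the fifteen cosets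
give sixty linear forms.

It remains to see that the product of the sixty forms divides \<open>azy5_poly\<close>; the quotient then has
degree zero, and it is not zero because \<open>(azy)\<^sub>5\<close> is not. Two facts are needed.

First, \<open>azy5_poly\<close> vanishes on each of the sixty hyperplanes. The involution \<open>\<tau>\<^sub>2 \<mapsto> 1 - \<tau>\<^sub>2\<close> is an odd
permutation of the odd characteristics, so the transformation law with \<open>\<chi>\<^sub>P\<close> makes \<open>(azy)\<^sub>5\<close> vanish
on its fixed divisor \<open>\<tau>\<^sub>2 = 1/2\<close> (\<open>azy5_zero_on_mirror\<close>). On that divisor one theta constant is zero,
and the other three satisfy no homogeneous algebraic relation, as their decay at a cusp shows
(\<open>homogeneous_zero_if_zero_on_mirror\<close>). So the polynomial vanishes on a coordinate hyperplane, and
modularity carries this over to the other hyperplanes (\<open>azy5_poly_zero_on_mirror\<close>).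

Secondly, the sixty forms are pairwise not proportional. For forms of the same coset this is the
invertibility of \<open>\<rho>\<close>. For different cosets, the matrix \<open>\<rho>\<close> normalises the Heisenberg
group generated by sign changes and shifts of the coordinates, and acts on it through \<open>\<gamma>\<close> mod 2. If forms of
two cosets \<open>a\<close> and \<open>b\<close> were proportional, \<open>ab\<^sup>-\<^sup>1\<close> would map sign changes to sign changes, and so belong to
\<open>\<Gamma>\<^sub>2\<^sub>,\<^sub>0(2)\<close> (\<open>Gamma20_2_if_common_mirror\<close>).

The transformation law itself is checked on generators of \<open>Sp(4, \<int>)\<close>. All but one of them permute or
rescale the terms of the theta series. The remaining one inverts a single variable and reduces to the
Poisson summation formula for a Gaussian (\<open>theta_inversion\<close>).\<close>


section \<open>Infinite sums depending on a parameter\<close>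

text \<open>Dominated convergence for sums over an arbitrary index set: the bound makes the finite partial sums
converge uniformly, so the two limits may be exchanged.\<close>

lemma tendsto_infsum_dominated:
  fixes f :: "'a \<Rightarrow> 'b \<Rightarrow> 'c :: banach"
  assumes lim: "\<And>x. x \<in> X \<Longrightarrow> (f x \<longlongrightarrow> g x) F"
    and bound: "\<forall>\<^sub>F y in F. \<forall>x\<in>X. norm (f x y) \<le> M x"
    and M: "M summable_on X" and F: "F \<noteq> bot"
  shows "((\<lambda>y. \<Sum>\<^sub>\<infinity>x\<in>X. f x y) \<longlongrightarrow> (\<Sum>\<^sub>\<infinity>x\<in>X. g x)) F"
proof (rule swap_uniform_limit')
  let ?Y = "{y. \<forall>x\<in>X. norm (f x y) \<le> M x}"
  show "uniform_limit ?Y (\<lambda>X y. \<Sum>x\<in>X. f x y) (\<lambda>y. \<Sum>\<^sub>\<infinity>x\<in>X. f x y) (finite_subsets_at_top X)"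
    by (rule Weierstrass_m_test_general[OF _ M]) auto
  show "\<forall>\<^sub>F y in F. y \<in> ?Y" using bound by simp
  have gM: "norm (g x) \<le> M x" if "x \<in> X" for x
    by (rule tendsto_upperbound[OF tendsto_norm[OF lim[OF that]] _ F])
       (use bound that in \<open>auto elim!: eventually_mono\<close>)
  have "g summable_on X"
    by (rule abs_summable_summable[OF Infinite_Sum.abs_summable_on_comparison_test'[OF M gM]])
  then show "((\<lambda>S. \<Sum>x\<in>S. g x) \<longlongrightarrow> (\<Sum>\<^sub>\<infinity>x\<in>X. g x)) (finite_subsets_at_top X)"
    using has_sum_infsum has_sum_def by blast
  show "\<forall>\<^sub>F S in finite_subsets_at_top X. ((\<lambda>y. \<Sum>x\<in>S. f x y) \<longlongrightarrow> (\<Sum>x\<in>S. g x)) F"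
    by (rule eventually_finite_subsets_at_top_weakI) (auto intro!: tendsto_sum lim)
qed simp

lemma holomorphic_on_infsum:
  fixes f :: "'a \<Rightarrow> complex \<Rightarrow> complex"
  assumes S: "open S" and hol: "\<And>x. x \<in> X \<Longrightarrow> f x holomorphic_on S"
    and bound: "\<And>z. z \<in> S \<Longrightarrow> \<exists>r>0. \<exists>M. cball z r \<subseteq> S \<and> M summable_on X \<and>
        (\<forall>x\<in>X. \<forall>y\<in>cball z r. norm (f x y) \<le> M x)"
  shows "(\<lambda>z. \<Sum>\<^sub>\<infinity>x\<in>X. f x z) holomorphic_on S"
proof -
  have "(\<lambda>z. \<Sum>\<^sub>\<infinity>x\<in>X. f x z) field_differentiable at z" if z: "z \<in> S" for z
  proof -
    obtain r M where r: "r > 0" "cball z r \<subseteq> S" and M: "M summable_on X"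
      and le: "\<And>x y. x \<in> X \<Longrightarrow> y \<in> cball z r \<Longrightarrow> norm (f x y) \<le> M x"
      using bound[OF z] by blast
    have ul: "uniform_limit (cball z r) (\<lambda>X y. \<Sum>x\<in>X. f x y) (\<lambda>y. \<Sum>\<^sub>\<infinity>x\<in>X. f x y)
          (finite_subsets_at_top X)"
      by (rule Weierstrass_m_test_general[OF le M])
    have ev: "\<forall>\<^sub>F A in finite_subsets_at_top X.
        continuous_on (cball z r) (\<lambda>y. \<Sum>x\<in>A. f x y) \<and> (\<lambda>y. \<Sum>x\<in>A. f x y) holomorphic_on ball z r"
    proof (rule eventually_finite_subsets_at_top_weakI)
      fix A assume A: "finite A" "A \<subseteq> X"
      have "(\<lambda>y. \<Sum>x\<in>A. f x y) holomorphic_on S"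
        using A by (intro holomorphic_on_sum hol) auto
      then show "continuous_on (cball z r) (\<lambda>y. \<Sum>x\<in>A. f x y) \<and> (\<lambda>y. \<Sum>x\<in>A. f x y) holomorphic_on ball z r"
        using r(2) ball_subset_cball
        by (meson continuous_on_subset holomorphic_on_imp_continuous_on holomorphic_on_subset order_trans)
    qed
    obtain "(\<lambda>y. \<Sum>\<^sub>\<infinity>x\<in>X. f x y) holomorphic_on ball z r"
      using holomorphic_uniform_limit[OF ev ul] by auto
    then show ?thesis
      using r(1) by (meson centre_in_ball holomorphic_on_imp_differentiable_at open_ball)
  qed
  then show ?thesis
    using S by (simp add: holomorphic_on_def field_differentiable_at_within)
qed

lemma summable_on_int_gaussian:
  fixes c w :: real
  assumes c: "c > 0"
  shows "(\<lambda>j::int. exp (- c * (of_int j + w)\<^sup>2)) summable_on UNIV"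
proof -
  have nat: "(\<lambda>n::nat. exp (- c/2 * real n)) summable_on UNIV"
  proof (rule norm_summable_imp_summable_on)
    have "summable (\<lambda>n. exp (- c/2) ^ n)" using c by (intro summable_geometric) auto
    then show "summable (\<lambda>n. norm (exp (- c/2 * real n)))"
      by (simp add: exp_of_nat_mult[symmetric] mult.commute)
  qed
  have "(\<lambda>j::int. exp (- c/2 * \<bar>of_int j\<bar>)) summable_on (range int \<union> range (\<lambda>n. - int n))"
    by (intro summable_on_union; subst summable_on_reindex)
       (use nat in \<open>auto simp: inj_on_def o_def\<close>)
  moreover have "range int \<union> range (\<lambda>n. - int n) = UNIV"
    by (auto, metis int_cases2 range_eqI)
  ultimately have s: "(\<lambda>j::int. exp (c * w\<^sup>2) * exp (- c/2 * \<bar>of_int j\<bar>)) summable_on UNIV"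
    by (intro summable_on_cmult_right) simp
  show ?thesis
  proof (rule summable_on_comparison_test[OF s])
    fix j :: int
    have "(of_int j)\<^sup>2 \<ge> \<bar>of_int j :: real\<bar>"
    proof -
      have "\<bar>j\<bar> \<le> \<bar>j\<bar> * \<bar>j\<bar>" by (cases "j = 0") (auto simp: mult_le_cancel_left1 simp del: abs_mult_self_eq)
      then have "\<bar>of_int j :: real\<bar> \<le> \<bar>of_int j\<bar> * \<bar>of_int j\<bar>"
        by (metis of_int_abs of_int_le_iff of_int_mult)
      then show ?thesis by (simp add: power2_eq_square)
    qed
    moreover have "(of_int j)\<^sup>2 / 2 - w\<^sup>2 \<le> (of_int j + w)\<^sup>2"
    proof -
      have "0 \<le> (of_int j + 2 * w)\<^sup>2 / 2" by simp
      then show ?thesis by (simp add: power2_eq_square algebra_simps)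
    qed
    ultimately have "\<bar>of_int j :: real\<bar> / 2 - w\<^sup>2 \<le> (of_int j + w)\<^sup>2" by linarith
    from mult_left_mono[OF this, of c] c
    have "- c * (of_int j + w)\<^sup>2 \<le> c * w\<^sup>2 + - c/2 * \<bar>of_int j\<bar>" by (simp add: algebra_simps)
    then show "exp (- c * (of_int j + w)\<^sup>2) \<le> exp (c * w\<^sup>2) * exp (- c/2 * \<bar>of_int j\<bar>)"
      by (simp flip: exp_add)
  qed simp
qed


section \<open>The inversion formula for theta series in one variable\<close>

text \<open>The central binomial coefficient is up to sign and a power of four the generalised coefficient
\<open>-1/2\<close> over \<open>m\<close>, whose asymptotics are governed by \<open>\<Gamma>(1/2) = \<surd>\<pi>\<close>.\<close>

lemma central_binomial_asymptotic:
  "(\<lambda>m. real (2 * m choose m) * sqrt m / 4 ^ m) \<longlonglongrightarrow> 1 / sqrt pi"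
proof -
  have "(\<lambda>n. ((-1/2) gchoose n) / ((-1)^n / exp ((-1/2 + 1) * of_real (ln (real n))))) \<longlonglongrightarrow>
      inverse (Gamma (- (-1/2 :: real)))"
    by (rule gbinomial_asymptotic)
  moreover have "\<forall>\<^sub>F n in sequentially.
      ((-1/2) gchoose n) / ((-1)^n / exp ((-1/2 + 1) * of_real (ln (real n)))) =
      real (2 * n choose n) * sqrt n / 4 ^ n"
    using eventually_gt_at_top[of 0]
  proof eventually_elim
    case (elim n)
    have "((-1/2 :: real) gchoose n) = (-1)^n * real (2 * n choose n) / 4 ^ n"
    proof -
      have "((-1/2 :: real) gchoose n) = (-1)^n * pochhammer (1/2) n / fact n"
        by (simp add: gbinomial_pochhammer)
      also have "pochhammer (1/2 :: real) n = fact (2*n) / (4 ^ n * fact n)"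
        using fact_double[of n, where ?'a = real] power_mult[of "2::real" 2 n] power_mult[of "2::real" n 2] by (simp add: field_simps power_mult)
      also have "(-1)^n * (fact (2*n) / (4 ^ n * fact n)) / fact n = (-1)^n * real (2 * n choose n) / (4::real) ^ n"
        by (simp add: binomial_fact field_simps)
      finally show ?thesis .
    qed
    moreover have "exp ((-1/2 + 1) * ln (real n)) = sqrt n"
      using elim by (simp add: powr_half_sqrt[symmetric] powr_def)
    ultimately show ?case using elim by (simp add: field_simps)
  qed
  ultimately show ?thesis
    using Gamma_one_half_real by (simp add: tendsto_cong inverse_eq_divide)
qed

text \<open>The binomial coefficients of order \<open>2m\<close> indexed by the distance from the centre. They are zero
outside the triangle, so that sums over all integers make sense.\<close>

definition centred_binomial :: "nat \<Rightarrow> int \<Rightarrow> real" where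
  "centred_binomial m r = (if \<bar>r\<bar> \<le> int m then real (2 * m choose nat (int m + r)) else 0)"

lemma centred_binomial_neg: "centred_binomial m (- r) = centred_binomial m r"
proof (cases "\<bar>r\<bar> \<le> int m")
  case True
  then have "(2 * m choose nat (int m + r)) = (2 * m choose (2 * m - nat (int m + r)))"
    by (intro binomial_symmetric) linarith
  moreover have "2 * m - nat (int m + r) = nat (int m - r)" using True by linarith
  ultimately show ?thesis using True by (simp add: centred_binomial_def)
qed (simp add: centred_binomial_def)

lemma centred_binomial_abs: "centred_binomial m r = centred_binomial m \<bar>r\<bar>"
  by (cases "r \<ge> 0") (use centred_binomial_neg[of m r] in auto)

lemma centred_binomial_Suc:
  assumes "i < m"
  shows "centred_binomial m (int (Suc i)) = centred_binomial m (int i) * ((real m - i) / (real m + i + 1))"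
proof -
  have 1: "nat (int m + int (Suc i)) = Suc (m + i)" "nat (int m + int i) = m + i" by linarith+
  have "Suc (m + i) * (2 * m choose Suc (m + i)) = (2 * m - (m + i)) * (2 * m choose (m + i))"
    by (rule trans[OF binomial_absorption binomial_absorb_comp[symmetric]])
  then have "real (Suc (m + i)) * real (2 * m choose Suc (m + i)) = real (m - i) * real (2 * m choose (m + i))"
    by (metis (no_types, lifting) of_nat_mult mult_2 diff_diff_left diff_add_inverse)
  then show ?thesis using assms unfolding centred_binomial_def 1
    by (simp add: field_simps of_nat_diff)
qed

text \<open>Together with the next lemma this is the local central limit theorem with explicit bounds. Each factor
\<open>(m - i)/(m + i + 1)\<close> of the ratio to the central coefficient is compared with an exponential, and
\<open>1 + 3 + \<dots> + (2i - 1) = i\<^sup>2\<close>. The parameter \<open>D\<close> fixes the denominator.\<close>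

lemma centred_binomial_upper:
  assumes "i \<le> m" "m > 0" "i \<le> D"
  shows "centred_binomial m (int i) \<le> real (2 * m choose m) * exp (- (real i)\<^sup>2 / (real m + D))"
  using assms
proof (induction i)
  case 0 then show ?case by (simp add: centred_binomial_def)
next
  case (Suc i)
  have "(real m - i) / (real m + i + 1) = 1 + (- (2 * real i + 1) / (real m + i + 1))"
    using Suc.prems by (simp add: field_simps)
  also have "\<dots> \<le> exp (- (2 * real i + 1) / (real m + i + 1))" by (rule exp_ge_add_one_self)
  also have "\<dots> \<le> exp (- (2 * real i + 1) / (real m + D))"
    using Suc.prems divide_left_mono[of "real m + i + 1" "real m + D" "2 * real i + 1"]
    by (simp add: minus_divide_left[symmetric] del: minus_add_distrib)
  finally have "centred_binomial m (int (Suc i)) \<le>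
      (real (2 * m choose m) * exp (- (real i)\<^sup>2 / (real m + D))) * exp (- (2 * real i + 1) / (real m + D))"
    using Suc by (subst centred_binomial_Suc, simp, intro mult_mono) auto
  also have "\<dots> = real (2 * m choose m) * exp (- (real (Suc i))\<^sup>2 / (real m + D))"
    unfolding mult.assoc exp_add[symmetric] add_divide_distrib[symmetric]
    by (simp add: power2_eq_square algebra_simps)
  finally show ?case .
qed

lemma centred_binomial_lower:
  assumes "i \<le> D" "D < m"
  shows "centred_binomial m (int i) \<ge> real (2 * m choose m) * exp (- (real i)\<^sup>2 / (real m - D))"
  using assms
proof (induction i)
  case 0 then show ?case by (simp add: centred_binomial_def)
next
  case (Suc i)
  have pos: "real m - i > 0" "real m - D > 0" using Suc.prems by auto
  have "exp (- (2 * real i + 1) / (real m - D)) \<le> exp (- ((2 * real i + 1) / (real m - i)))"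
    using Suc.prems pos divide_left_mono[of "real m - D" "real m - i" "2 * real i + 1"]
    by (simp add: minus_divide_left[symmetric] del: minus_add_distrib)
  also have "\<dots> \<le> inverse (1 + (2 * real i + 1) / (real m - i))"
    using exp_ge_add_one_self[of "(2 * real i + 1) / (real m - i)"] pos
    by (subst exp_minus, intro le_imp_inverse_le) (auto intro!: add_pos_nonneg)
  also have "\<dots> = (real m - i) / (real m + i + 1)"
    using pos by (simp add: field_simps)
  finally have "centred_binomial m (int (Suc i)) \<ge>
      (real (2 * m choose m) * exp (- (real i)\<^sup>2 / (real m - D))) * exp (- (2 * real i + 1) / (real m - D))"
    using Suc by (subst centred_binomial_Suc, simp, intro mult_mono) (auto simp: centred_binomial_def)
  also have "(real (2 * m choose m) * exp (- (real i)\<^sup>2 / (real m - D))) * exp (- (2 * real i + 1) / (real m - D))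
     = real (2 * m choose m) * exp (- (real (Suc i))\<^sup>2 / (real m - D))"
    unfolding mult.assoc exp_add[symmetric] add_divide_distrib[symmetric]
    by (simp add: power2_eq_square algebra_simps)
  finally show ?case .
qed

lemma cos_even_power_expansion:
  "of_real (cos x ^ (2 * m)) = (\<Sum>r = - int m..int m. of_real (centred_binomial m r) * exp (2 * \<i> * of_int r * of_real x)) / (4 :: complex) ^ m"
proof -
  have "2 * cos (of_real x :: complex) = exp (\<i> * of_real x) + exp (- (\<i> * of_real x))"
    by (simp add: cos_exp_eq)
  then have "(2 * cos (of_real x :: complex)) ^ (2 * m) = (exp (\<i> * of_real x) + exp (- (\<i> * of_real x))) ^ (2 * m)"
    by simp
  also have "\<dots> = (\<Sum>i\<le>2 * m. of_nat (2 * m choose i) * exp (\<i> * of_real x) ^ i * exp (- (\<i> * of_real x)) ^ (2 * m - i))"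
    by (rule binomial_ring)
  also have "\<dots> = (\<Sum>r = - int m..int m. of_real (centred_binomial m r) * exp (2 * \<i> * of_int r * of_real x))"
  proof (rule sum.reindex_bij_witness[of _ "\<lambda>r. nat (r + int m)" "\<lambda>i. int i - int m"])
    fix i assume i: "i \<in> {..2 * m}"
    then have n: "nat (int i - int m + int m) = i" "nat (int m + (int i - int m)) = i" "\<bar>int i - int m\<bar> \<le> int m" by auto
    show "nat (int i - int m + int m) = i" by fact
    show "int i - int m \<in> {- int m..int m}" using i by auto
    have "exp (\<i> * of_real x) ^ i * exp (- (\<i> * of_real x)) ^ (2 * m - i) = exp (2 * \<i> * of_int (int i - int m) * of_real x)"
      using i by (simp add: exp_of_nat_mult[symmetric] exp_add[symmetric] of_nat_diff algebra_simps)
    then show "of_real (centred_binomial m (int i - int m)) * exp (2 * \<i> * of_int (int i - int m) * of_real x) =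
        of_nat (2 * m choose i) * exp (\<i> * of_real x) ^ i * exp (- (\<i> * of_real x)) ^ (2 * m - i)"
      using n by (simp add: centred_binomial_def mult.assoc)
  qed auto
  finally have eq: "(2 * cos (of_real x :: complex)) ^ (2 * m) = (\<Sum>r = - int m..int m. of_real (centred_binomial m r) * exp (2 * \<i> * of_int r * of_real x))" .
  have "(2 * cos (of_real x :: complex)) ^ (2 * m) = 4 ^ m * of_real (cos x ^ (2 * m))"
    by (simp add: power_mult_distrib power_mult cos_of_real)
  with eq show ?thesis by (simp add: field_simps)
qed

lemma sum_roots_of_unity_block:
  fixes l :: nat and a r :: int
  assumes l: "l > 0"
  shows "(\<Sum>k\<in>{a..<a + int l}. exp (2 * pi * \<i> * of_int r * of_int k / of_nat l)) =
     (if int l dvd r then of_nat l else 0 :: complex)"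
proof -
  define z :: complex where "z = exp (2 * pi * \<i> * of_int r / of_nat l)"
  have zl: "z ^ l = 1"
  proof -
    have "z ^ l = exp (of_nat l * (2 * pi * \<i> * of_int r / of_nat l))"
      unfolding z_def by (simp only: exp_of_nat_mult)
    also have "of_nat l * (2 * pi * \<i> * of_int r / of_nat l) = 2 * of_int r * pi * \<i>" using l by simp
    also have "exp \<dots> = 1" using exp_two_pi_i exp_integer_2pi[of "of_int r"] by (simp add: mult_ac)
    finally show ?thesis .
  qed
  have "(\<Sum>k\<in>{a..<a + int l}. exp (2 * pi * \<i> * of_int r * of_int k / of_nat l)) =
      (\<Sum>n<l. exp (2 * pi * \<i> * of_int r * of_int a / of_nat l) * z ^ n)"
    by (rule sum.reindex_bij_witness[of _ "\<lambda>n. a + int n" "\<lambda>k. nat (k - a)"])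
       (auto simp: z_def exp_of_nat_mult[symmetric] exp_add[symmetric] add_divide_distrib[symmetric] algebra_simps)
  also have "\<dots> = exp (2 * pi * \<i> * of_int r * of_int a / of_nat l) * (\<Sum>n<l. z ^ n)"
    by (simp add: sum_distrib_left)
  also have "\<dots> = (if int l dvd r then of_nat l else 0)"
  proof (cases "int l dvd r")
    case True
    then obtain q where q: "r = int l * q" by auto
    have "exp (2 * pi * \<i> * of_int r * of_int b / of_nat l) = 1" for b :: int
      using exp_integer_2pi[of "of_int (q * b)"] l by (simp add: q mult_ac)
    from this[of 1] this[of a] True show ?thesis by (simp add: z_def)
  next
    case False
    have "z \<noteq> 1"
    proof
      assume "z = 1"
      then obtain n :: int where "2 * pi * of_int r / of_nat l = of_int (2 * n) * pi"
        unfolding z_def exp_eq_1 by auto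
      then have "of_int r = (of_int (int l * n) :: real)" using l by (simp add: field_simps)
      then have "r = int l * n" by linarith
      with False show False by simp
    qed
    then show ?thesis using False zl geometric_sum[of z l] by simp
  qed
  finally show ?thesis .
qed

text \<open>Polya's finite form of the Poisson formula. Expand the power of the cosine and sum over a complete
residue system modulo \<open>l\<close>: orthogonality of the roots of unity keeps exactly the frequencies that are
divisible by \<open>l\<close>. As \<open>l\<close> and \<open>m\<close> tend to infinity with \<open>m/l\<^sup>2\<close> convergent, both sides turn into theta
series.\<close>

lemma cos_even_power_block_sum:
  fixes l :: nat and a :: int and w :: real
  assumes l: "l > 0"
  shows "(\<Sum>k\<in>{a..<a + int l}. of_real (cos (pi * (of_int k + w) / l) ^ (2 * m))) =
    (\<Sum>\<^sub>\<infinity>j\<in>(UNIV::int set). of_real (l / 4 ^ m * centred_binomial m (int l * j)) * exp (2 * pi * \<i> * of_int j * of_real w) :: complex)"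
proof -
  let ?e = "\<lambda>r::int. exp (2 * pi * \<i> * of_int r * of_real w / of_nat l) :: complex"
  have "(\<Sum>k\<in>{a..<a + int l}. of_real (cos (pi * (of_int k + w) / l) ^ (2 * m))) =
      (\<Sum>k\<in>{a..<a + int l}. \<Sum>r = - int m..int m. of_real (centred_binomial m r) * ?e r / 4 ^ m *
         exp (2 * pi * \<i> * of_int r * of_int k / of_nat l))"
    unfolding cos_even_power_expansion sum_divide_distrib
    by (intro sum.cong refl) (simp add: exp_add[symmetric] add_divide_distrib[symmetric] algebra_simps)
  also have "\<dots> = (\<Sum>r = - int m..int m. of_real (centred_binomial m r) * ?e r / 4 ^ m *
         (\<Sum>k\<in>{a..<a + int l}. exp (2 * pi * \<i> * of_int r * of_int k / of_nat l)))"
    by (subst sum.swap) (simp add: sum_distrib_left)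
  also have "\<dots> = (\<Sum>r\<in>{r. r \<in> {- int m..int m} \<and> int l dvd r}. of_real (l / 4 ^ m * centred_binomial m r) * ?e r)"
    unfolding sum_roots_of_unity_block[OF l] by (subst sum.inter_filter) (auto intro!: sum.cong)
  also have "\<dots> = (\<Sum>j\<in>{j. \<bar>int l * j\<bar> \<le> int m}. of_real (l / 4 ^ m * centred_binomial m (int l * j)) * exp (2 * pi * \<i> * of_int j * of_real w))"
    using l by (intro sum.reindex_bij_witness[of _ "\<lambda>j. int l * j" "\<lambda>r. r div int l"]) (auto elim!: dvdE simp: mult_ac)
  also have "\<dots> = (\<Sum>\<^sub>\<infinity>j\<in>{j. \<bar>int l * j\<bar> \<le> int m}. of_real (l / 4 ^ m * centred_binomial m (int l * j)) * exp (2 * pi * \<i> * of_int j * of_real w))"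
  proof (rule infsum_finite[symmetric])
    have "j \<in> {- int m..int m}" if "j \<in> {j. \<bar>int l * j\<bar> \<le> int m}" for j
    proof -
      have "\<bar>j\<bar> \<le> int l * \<bar>j\<bar>" using l by (cases "j = 0") (auto simp: mult_le_cancel_right1)
      moreover have "int l * \<bar>j\<bar> \<le> int m" using that by (simp add: abs_mult)
      ultimately show ?thesis by auto
    qed
    then have "{j. \<bar>int l * j\<bar> \<le> int m} \<subseteq> {- int m..int m}" by (rule subsetI)
    then show "finite {j. \<bar>int l * j\<bar> \<le> int m}" by (rule finite_subset) simp
  qed
  also have "\<dots> = (\<Sum>\<^sub>\<infinity>j\<in>UNIV. of_real (l / 4 ^ m * centred_binomial m (int l * j)) * exp (2 * pi * \<i> * of_int j * of_real w))"
    by (rule infsum_cong_neutral) (auto simp: centred_binomial_def)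
  finally show ?thesis .
qed

text \<open>The function \<open>cos y * exp (y\<^sup>2/2)\<close> decreases on \<open>[0, \<pi>/2]\<close> because \<open>y cos y \<le> sin y\<close> there. This bound
dominates the cosine sum.\<close>

lemma cos_le_exp_square:
  fixes x :: real
  assumes "\<bar>x\<bar> \<le> pi / 2"
  shows "cos x \<le> exp (- x\<^sup>2 / 2)"
proof -
  have *: "cos y * exp (y\<^sup>2 / 2) \<le> 1" if y: "0 \<le> y" "y \<le> pi / 2" for y :: real
  proof -
    have "cos y * exp (y\<^sup>2 / 2) \<le> cos 0 * exp (0\<^sup>2 / 2)"
    proof (rule DERIV_nonpos_imp_nonincreasing[OF y(1)])
      fix x :: real assume x: "0 \<le> x" "x \<le> y"
      have "x * cos x \<le> sin x"
      proof -
        have "sin 0 - 0 * cos 0 \<le> sin x - x * cos (x::real)"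
          by (rule DERIV_nonneg_imp_nondecreasing[OF x(1)])
             (use x y in \<open>auto intro!: exI derivative_eq_intros mult_nonneg_nonneg sin_ge_zero\<close>)
        then show ?thesis by simp
      qed
      moreover have "((\<lambda>y. cos y * exp (y\<^sup>2 / 2)) has_real_derivative (x * cos x - sin x) * exp (x\<^sup>2 / 2)) (at x)"
        by (auto intro!: derivative_eq_intros simp: algebra_simps)
      ultimately show "\<exists>z. ((\<lambda>y. cos y * exp (y\<^sup>2 / 2)) has_real_derivative z) (at x) \<and> z \<le> 0"
        by (intro exI conjI) (auto simp: mult_nonpos_nonneg)
    qed
    then show ?thesis by simp
  qed
  have "cos \<bar>x\<bar> * exp (\<bar>x\<bar>\<^sup>2 / 2) \<le> 1" using assms by (intro *) auto
  then show ?thesis by (simp add: exp_minus field_simps)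
qed

lemma cos_power_limit:
  fixes c s :: real and m :: "nat \<Rightarrow> nat"
  assumes m: "(\<lambda>h. real (m h) / (real h)\<^sup>2) \<longlonglongrightarrow> 4 * s"
  shows "(\<lambda>h. cos (c / h) ^ (2 * m h)) \<longlonglongrightarrow> exp (- 4 * s * c\<^sup>2)"
proof -
  have "(\<lambda>h::nat. (real h)\<^sup>2 * ln (cos (c / real h))) \<longlonglongrightarrow> - (c * c / 2)"
    by real_asymp
  then have "(\<lambda>h::nat. (real h)\<^sup>2 * ln (cos (c / real h))) \<longlonglongrightarrow> - c\<^sup>2 / 2"
    by (simp add: power2_eq_square)
  from tendsto_mult[OF m tendsto_mult[OF tendsto_const[of 2] this]]
  have "(\<lambda>h. exp (real (m h) / (real h)\<^sup>2 * (2 * ((real h)\<^sup>2 * ln (cos (c / real h)))))) \<longlonglongrightarrow> exp (- 4 * s * c\<^sup>2)"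
    by (intro tendsto_exp) simp
  moreover have "(\<lambda>h::nat. cos (c / real h)) \<longlonglongrightarrow> 1" by real_asymp
  then have "\<forall>\<^sub>F h in sequentially. cos (c / real h) > 0"
    by (rule order_tendstoD) simp
  then have "\<forall>\<^sub>F h in sequentially. exp (real (m h) / (real h)\<^sup>2 * (2 * ((real h)\<^sup>2 * ln (cos (c / real h))))) = cos (c / h) ^ (2 * m h)"
    using eventually_gt_at_top[of 0]
  proof eventually_elim
    case (elim h)
    then have "cos (c / h) ^ (2 * m h) = exp (real (2 * m h) * ln (cos (c / h)))"
      by (simp only: exp_of_nat_mult) simp
    then show ?case using elim by (simp add: field_simps)
  qed
  ultimately show ?thesis by (rule Lim_transform_eventually)
qed

lemma centred_binomial_nonneg: "centred_binomial m r \<ge> 0"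
  by (simp add: centred_binomial_def)

lemma centred_binomial_le_gaussian:
  assumes "m > 0"
  shows "centred_binomial m r \<le> real (2 * m choose m) * exp (- (of_int r)\<^sup>2 / (2 * real m))"
proof (cases "\<bar>r\<bar> \<le> int m")
  case True
  then have "centred_binomial m (int (nat \<bar>r\<bar>)) \<le> real (2 * m choose m) * exp (- (real (nat \<bar>r\<bar>))\<^sup>2 / (real m + real m))"
    by (intro centred_binomial_upper) (use assms in auto)
  then show ?thesis using centred_binomial_abs[of m r] by simp
qed (simp add: centred_binomial_def)

lemma centred_binomial_limit:
  fixes s :: real and m :: "nat \<Rightarrow> nat"
  assumes s: "s > 0" and m: "(\<lambda>h. real (m h) / (real h)\<^sup>2) \<longlonglongrightarrow> 4 * s"
  shows "(\<lambda>h. real (2 * h) * real (2 * m h choose m h) / 4 ^ m h) \<longlonglongrightarrow> 1 / sqrt (pi * s)" (is "?C \<longlonglongrightarrow> _")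
    and "(\<lambda>h. real (2 * h) / 4 ^ m h * centred_binomial (m h) (int (2 * h) * j)) \<longlonglongrightarrow>
       1 / sqrt (pi * s) * exp (- (of_int j)\<^sup>2 / s)"
proof -
  have "filterlim (\<lambda>h. real (m h) / (real h)\<^sup>2 * (real h)\<^sup>2) at_top sequentially"
    by (rule filterlim_tendsto_pos_mult_at_top[OF m]) (use s in \<open>auto\<close>, real_asymp)
  moreover have "\<forall>\<^sub>F h in sequentially. real (m h) / (real h)\<^sup>2 * (real h)\<^sup>2 = real (m h)"
    using eventually_gt_at_top[of 0] by eventually_elim simp
  ultimately have "filterlim (\<lambda>h. real (m h)) at_top sequentially"
    using filterlim_cong by fastforce
  then have mtop: "filterlim m at_top sequentially"
    by (simp add: filterlim_sequentially_iff_filterlim_real)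
  have mpos: "\<forall>\<^sub>F h in sequentially. m h > 0"
    by (rule eventually_compose_filterlim[OF eventually_gt_at_top[of 0] mtop])
  have "(\<lambda>h. real (2 * m h choose m h) * sqrt (m h) / 4 ^ m h) \<longlonglongrightarrow> 1 / sqrt pi"
    by (rule filterlim_compose[OF central_binomial_asymptotic mtop])
  moreover have "(\<lambda>h. 2 / sqrt (real (m h) / (real h)\<^sup>2)) \<longlonglongrightarrow> 2 / sqrt (4 * s)"
    using s by (intro tendsto_intros m) auto
  ultimately have "(\<lambda>h. real (2 * m h choose m h) * sqrt (m h) / 4 ^ m h * (2 / sqrt (real (m h) / (real h)\<^sup>2))) \<longlonglongrightarrow> 1 / sqrt pi * (2 / sqrt (4 * s))"
    by (intro tendsto_mult)
  then have "?C \<longlonglongrightarrow> 1 / sqrt pi * (2 / sqrt (4 * s))"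
  proof (rule Lim_transform_eventually)
    show "\<forall>\<^sub>F h in sequentially. real (2 * m h choose m h) * sqrt (m h) / 4 ^ m h * (2 / sqrt (real (m h) / (real h)\<^sup>2)) = ?C h"
      using mpos by eventually_elim (simp add: real_sqrt_divide field_simps)
  qed
  then show C: "?C \<longlonglongrightarrow> 1 / sqrt (pi * s)" by (simp add: real_sqrt_mult)
  define q where "q = \<bar>real_of_int j\<bar>"
  have q2: "(real_of_int j)\<^sup>2 = q\<^sup>2" by (simp add: q_def)
  have D: "\<forall>\<^sub>F h in sequentially. 2 * h * nat \<bar>j\<bar> < m h"
  proof -
    have "(\<lambda>h. real (m h) / (real h)\<^sup>2 - 2 * q / h) \<longlonglongrightarrow> 4 * s - 0"
      by (intro tendsto_diff m) real_asymp
    then have "\<forall>\<^sub>F h in sequentially. real (m h) / (real h)\<^sup>2 - 2 * q / h > 0"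
      using s by (intro order_tendstoD(1)[where y = "4 * s - 0"]) simp_all
    then show ?thesis using eventually_gt_at_top[of 0]
    proof eventually_elim
      case (elim h)
      then have "2 * h * q < m h" by (simp add: field_simps power2_eq_square)
      then have "real (2 * h * nat \<bar>j\<bar>) < real (m h)" by (simp add: q_def)
      then show ?case by linarith
    qed
  qed
  let ?E = "\<lambda>\<sigma> h. exp (- (real (2 * h * nat \<bar>j\<bar>))\<^sup>2 / (real (m h) + \<sigma> * real (2 * h * nat \<bar>j\<bar>)))"
  have E: "?E \<sigma> \<longlonglongrightarrow> exp (- (of_int j)\<^sup>2 / s)" for \<sigma> :: real
  proof -
    have "(\<lambda>h. real (m h) / (real h)\<^sup>2 + \<sigma> * (2 * q / h)) \<longlonglongrightarrow> 4 * s + \<sigma> * 0"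
      by (intro tendsto_add tendsto_mult m tendsto_const) real_asymp
    then have "(\<lambda>h. exp (- (4 * q\<^sup>2) / (real (m h) / (real h)\<^sup>2 + \<sigma> * (2 * q / h)))) \<longlonglongrightarrow> exp (- (4 * q\<^sup>2) / (4 * s + \<sigma> * 0))"
      using s by (intro tendsto_exp tendsto_divide tendsto_const) (assumption | simp)+
    moreover have "\<forall>\<^sub>F h in sequentially. exp (- (4 * q\<^sup>2) / (real (m h) / (real h)\<^sup>2 + \<sigma> * (2 * q / h))) = ?E \<sigma> h"
      using eventually_gt_at_top[of 0]
    proof eventually_elim
      case (elim h)
      have "(real (m h) + \<sigma> * (2 * h * q)) = (real h)\<^sup>2 * (real (m h) / (real h)\<^sup>2 + \<sigma> * (2 * q / h))"
        using elim by (simp add: field_simps power2_eq_square)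
      then have "- (2 * h * q)\<^sup>2 / (real (m h) + \<sigma> * (2 * h * q)) = - (4 * q\<^sup>2) / (real (m h) / (real h)\<^sup>2 + \<sigma> * (2 * q / h))"
        using elim by (simp add: power_mult_distrib)
      then show ?case by (simp add: q_def)
    qed
    ultimately show ?thesis using s by (simp add: q2 Lim_transform_eventually)
  qed
  have cb: "centred_binomial (m h) (int (2 * h) * j) = centred_binomial (m h) (int (2 * h * nat \<bar>j\<bar>))" for h
    using centred_binomial_abs[of "m h" "int (2 * h) * j"] by (simp add: abs_mult)
  show "(\<lambda>h. real (2 * h) / 4 ^ m h * centred_binomial (m h) (int (2 * h) * j)) \<longlonglongrightarrow>
       1 / sqrt (pi * s) * exp (- (of_int j)\<^sup>2 / s)"
  proof (rule tendsto_sandwich)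
    show "(\<lambda>h. ?C h * ?E (-1) h) \<longlonglongrightarrow> 1 / sqrt (pi * s) * exp (- (of_int j)\<^sup>2 / s)"
      by (rule tendsto_mult[OF C E])
    show "(\<lambda>h. ?C h * ?E 1 h) \<longlonglongrightarrow> 1 / sqrt (pi * s) * exp (- (of_int j)\<^sup>2 / s)"
      by (rule tendsto_mult[OF C E])
    show "\<forall>\<^sub>F h in sequentially. ?C h * ?E (-1) h \<le> real (2 * h) / 4 ^ m h * centred_binomial (m h) (int (2 * h) * j)"
      using D
    proof eventually_elim
      case (elim h)
      have "real (2 * h) / 4 ^ m h * (real (2 * m h choose m h) * ?E (-1) h) \<le> real (2 * h) / 4 ^ m h * centred_binomial (m h) (int (2 * h) * j)"
        using centred_binomial_lower[OF order_refl elim] unfolding cb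
        by (intro mult_left_mono) (simp_all del: of_nat_mult)
      then show ?case by simp
    qed
    show "\<forall>\<^sub>F h in sequentially. real (2 * h) / 4 ^ m h * centred_binomial (m h) (int (2 * h) * j) \<le> ?C h * ?E 1 h"
      using D
    proof eventually_elim
      case (elim h)
      have "real (2 * h) / 4 ^ m h * centred_binomial (m h) (int (2 * h) * j) \<le> real (2 * h) / 4 ^ m h * (real (2 * m h choose m h) * ?E 1 h)"
        using centred_binomial_upper[of "2 * h * nat \<bar>j\<bar>" "m h", OF _ _ order_refl] elim unfolding cb
        by (intro mult_left_mono) (simp_all del: of_nat_mult)
      then show ?case by simp
    qed
  qed
qed

text \<open>Pass to the limit in \<open>cos_even_power_block_sum\<close> with \<open>l = 2h\<close> and \<open>m\<close> the upper integer part of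
\<open>4h\<^sup>2s\<close>, so that \<open>m/l\<^sup>2 \<rightarrow> s\<close>. The block of residues is placed symmetrically around \<open>-w\<close>, which keeps the
argument of the cosine in \<open>[-\<pi>/2, \<pi>/2]\<close>.\<close>

lemma theta_inversion_real:
  fixes s w :: real
  assumes s: "s > 0"
  shows "(\<Sum>\<^sub>\<infinity>k\<in>(UNIV::int set). of_real (exp (- pi\<^sup>2 * s * (of_int k + w)\<^sup>2)) :: complex) =
    (\<Sum>\<^sub>\<infinity>j\<in>(UNIV::int set). of_real (1 / sqrt (pi * s) * exp (- (of_int j)\<^sup>2 / s)) * exp (2 * pi * \<i> * of_int j * of_real w))"
proof -
  define m where "m = (\<lambda>h::nat. nat \<lceil>4 * (real h)\<^sup>2 * s\<rceil>)"
  have m_ge: "real (m h) \<ge> 4 * (real h)\<^sup>2 * s" for h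
    unfolding m_def by (rule real_nat_ceiling_ge)
  have m_le: "real (m h) \<le> 4 * (real h)\<^sup>2 * s + 1" for h
    unfolding m_def using s by (simp add: of_nat_nat)
  have mlim: "(\<lambda>h. real (m h) / (real h)\<^sup>2) \<longlonglongrightarrow> 4 * s"
  proof (rule tendsto_sandwich)
    show "\<forall>\<^sub>F h in sequentially. 4 * s \<le> real (m h) / (real h)\<^sup>2"
      using eventually_gt_at_top[of 0] by eventually_elim (use m_ge in \<open>simp add: field_simps\<close>)
    show "\<forall>\<^sub>F h in sequentially. real (m h) / (real h)\<^sup>2 \<le> 4 * s + 1 / (real h)\<^sup>2"
      using eventually_gt_at_top[of 0] by eventually_elim (use m_le in \<open>simp add: field_simps\<close>)
    show "(\<lambda>h. 4 * s + 1 / (real h)\<^sup>2) \<longlonglongrightarrow> 4 * s" by real_asymp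
  qed simp
  define fl where "fl = \<lfloor>w\<rfloor>"
  \<comment> \<open>These residues satisfy \<open>- h \<le> k + w < h\<close>, since \<open>fl \<le> w < fl + 1\<close>.\<close>
  let ?blk = "\<lambda>h::nat. {- int h - fl..< - int h - fl + int (2 * h)}"
  let ?L = "\<lambda>(k::int) (h::nat). if k \<in> ?blk h then of_real (cos (pi * (of_int k + w) / real (2 * h)) ^ (2 * m h)) else (0::complex)"
  let ?R = "\<lambda>(j::int) (h::nat). of_real (real (2 * h) / 4 ^ m h * centred_binomial (m h) (int (2 * h) * j)) * exp (2 * pi * \<i> * of_int j * of_real w) :: complex"
  have eq: "(\<Sum>\<^sub>\<infinity>k. ?L k h) = (\<Sum>\<^sub>\<infinity>j. ?R j h)" if "h > 0" for h
  proof -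
    have "(\<Sum>\<^sub>\<infinity>k. ?L k h) = (\<Sum>\<^sub>\<infinity>k\<in>?blk h. ?L k h)"
      by (rule infsum_cong_neutral) auto
    also have "\<dots> = (\<Sum>k\<in>?blk h. of_real (cos (pi * (of_int k + w) / real (2 * h)) ^ (2 * m h)))"
      by (subst infsum_finite) (auto intro!: sum.cong)
    also have "\<dots> = (\<Sum>\<^sub>\<infinity>j. ?R j h)"
      by (rule cos_even_power_block_sum) (use that in simp)
    finally show ?thesis .
  qed
  have L: "(\<lambda>h. \<Sum>\<^sub>\<infinity>k. ?L k h) \<longlonglongrightarrow> (\<Sum>\<^sub>\<infinity>k. of_real (exp (- pi\<^sup>2 * s * (of_int k + w)\<^sup>2)))"
  proof (rule tendsto_infsum_dominated)
    fix k :: int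
    have "(\<lambda>h. cos ((pi * (of_int k + w) / 2) / h) ^ (2 * m h)) \<longlonglongrightarrow> exp (- 4 * s * (pi * (of_int k + w) / 2)\<^sup>2)"
      by (rule cos_power_limit[OF mlim])
    then have "(\<lambda>h. of_real (cos ((pi * (of_int k + w) / 2) / h) ^ (2 * m h)) :: complex) \<longlonglongrightarrow> of_real (exp (- 4 * s * (pi * (of_int k + w) / 2)\<^sup>2))"
      by (rule tendsto_of_real)
    then have "(\<lambda>h. ?L k h) \<longlonglongrightarrow> of_real (exp (- 4 * s * (pi * (of_int k + w) / 2)\<^sup>2))"
    proof (rule Lim_transform_eventually)
      show "\<forall>\<^sub>F h in sequentially. of_real (cos ((pi * (of_int k + w) / 2) / h) ^ (2 * m h)) = ?L k h"
        using eventually_gt_at_top[of "nat (\<bar>k\<bar> + \<bar>fl\<bar>)"]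
      proof eventually_elim
        case (elim h)
        then have "k \<in> ?blk h" by auto
        then show ?case by simp
      qed
    qed
    also have "- 4 * s * (pi * (of_int k + w) / 2)\<^sup>2 = - pi\<^sup>2 * s * (of_int k + w)\<^sup>2"
      by (simp add: power2_eq_square)
    finally show "(\<lambda>h. ?L k h) \<longlonglongrightarrow> of_real (exp (- pi\<^sup>2 * s * (of_int k + w)\<^sup>2))" .
  next
    show "\<forall>\<^sub>F h in sequentially. \<forall>k\<in>UNIV. norm (?L k h) \<le> exp (- (pi\<^sup>2 * s) * (of_int k + w)\<^sup>2)"
      using eventually_gt_at_top[of 0]
    proof (eventually_elim, intro ballI)
      fix h k assume h: "(h::nat) > 0"
      show "norm (?L k h) \<le> exp (- (pi\<^sup>2 * s) * (of_int k + w)\<^sup>2)"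
      proof (cases "k \<in> ?blk h")
        case True
        define b where "b = pi * (of_int k + w) / real (2 * h)"
        have "- int h \<le> k + fl" "k + fl + 1 \<le> int h" using True by auto
        then have "- real h \<le> of_int k + of_int fl" "of_int k + of_int fl + 1 \<le> real h" by linarith+
        then have "\<bar>of_int k + w\<bar> \<le> h" unfolding fl_def by linarith
        then have "pi * \<bar>of_int k + w\<bar> \<le> pi * h" by (intro mult_left_mono) auto
        then have "\<bar>b\<bar> \<le> pi * h / real (2 * h)"
          unfolding b_def abs_divide abs_mult using h by (intro frac_le) auto
        then have b: "\<bar>b\<bar> \<le> pi / 2" using h by simp
        then have cb: "0 \<le> cos b" by (intro cos_ge_zero) auto
        have "?L k h = of_real (cos b ^ (2 * m h))" using True by (simp only: b_def if_True)
        then have "norm (?L k h) = cos b ^ (2 * m h)" using cb by (simp only: norm_of_real) simp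
        also have "\<dots> \<le> exp (- b\<^sup>2 / 2) ^ (2 * m h)"
          using cos_le_exp_square[OF b] cb by (rule power_mono)
        also have "\<dots> = exp (- b\<^sup>2 * m h)" by (simp add: exp_of_nat_mult[symmetric])
        also have "\<dots> \<le> exp (- b\<^sup>2 * (4 * (real h)\<^sup>2 * s))"
          using mult_left_mono[OF m_ge[of h], of "b\<^sup>2"] by simp
        also have "- b\<^sup>2 * (4 * (real h)\<^sup>2 * s) = - (pi\<^sup>2 * s) * (of_int k + w)\<^sup>2"
          using h by (simp add: b_def power2_eq_square)
        finally show ?thesis .
      next
        case False
        then have "?L k h = 0" by (simp only: if_False)
        then show ?thesis by (simp only: norm_zero exp_ge_zero)
      qed
    qed
    show "(\<lambda>k::int. exp (- (pi\<^sup>2 * s) * (of_int k + w)\<^sup>2)) summable_on UNIV"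
      by (rule summable_on_int_gaussian) (use s in simp)
  qed simp
  define K where "K = 1 / sqrt (pi * s) + 1"
  have R: "(\<lambda>h. \<Sum>\<^sub>\<infinity>j. ?R j h) \<longlonglongrightarrow> (\<Sum>\<^sub>\<infinity>j. of_real (1 / sqrt (pi * s) * exp (- (of_int j)\<^sup>2 / s)) * exp (2 * pi * \<i> * of_int j * of_real w))"
  proof (rule tendsto_infsum_dominated)
    fix j :: int
    show "(\<lambda>h. ?R j h) \<longlonglongrightarrow> of_real (1 / sqrt (pi * s) * exp (- (of_int j)\<^sup>2 / s)) * exp (2 * pi * \<i> * of_int j * of_real w)"
      by (intro tendsto_mult tendsto_const tendsto_of_real centred_binomial_limit(2) s mlim)
  next
    have "\<forall>\<^sub>F h in sequentially. real (m h) / (real h)\<^sup>2 < 8 * s"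
      using s by (intro order_tendstoD(2)[OF mlim]) auto
    moreover have "\<forall>\<^sub>F h in sequentially. real (2 * h) * real (2 * m h choose m h) / 4 ^ m h < K"
      by (rule order_tendstoD(2)[OF centred_binomial_limit(1)[OF s mlim]]) (simp add: K_def)
    ultimately show "\<forall>\<^sub>F h in sequentially. \<forall>j\<in>UNIV. norm (?R j h) \<le> K * exp (- (1 / (4 * s)) * (of_int j + 0)\<^sup>2)"
      using eventually_gt_at_top[of 0]
    proof (eventually_elim, intro ballI)
      fix h j assume h: "real (m h) / (real h)\<^sup>2 < 8 * s" "real (2 * h) * real (2 * m h choose m h) / 4 ^ m h < K" "(h::nat) > 0"
      have mp: "m h > 0" 
      proof -
        have "0 < 4 * (real h)\<^sup>2 * s" using h(3) s by simp
        then have "0 < real (m h)" using m_ge[of h] by linarith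
        then show ?thesis by simp
      qed
      have "norm (?R j h) = real (2 * h) / 4 ^ m h * centred_binomial (m h) (int (2 * h) * j)"
        by (simp add: norm_mult norm_divide norm_power centred_binomial_nonneg)
      also have "\<dots> \<le> real (2 * h) / 4 ^ m h * (real (2 * m h choose m h) * exp (- (of_int (int (2 * h) * j))\<^sup>2 / (2 * real (m h))))"
        by (intro mult_left_mono centred_binomial_le_gaussian mp) simp
      also have "\<dots> = real (2 * h) * real (2 * m h choose m h) / 4 ^ m h * exp (- (of_int (int (2 * h) * j))\<^sup>2 / (2 * real (m h)))"
        by simp
      also have "\<dots> \<le> K * exp (- (1 / (4 * s)) * (of_int j + 0)\<^sup>2)"
      proof (intro mult_mono)
        have "(1 / (4 * s)) * (real_of_int j)\<^sup>2 \<le> (of_int (int (2 * h) * j))\<^sup>2 / (2 * real (m h))"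
        proof -
          have "real (m h) \<le> 8 * s * (real h)\<^sup>2" using h by (simp add: field_simps)
          then have "real (m h) * (real_of_int j)\<^sup>2 \<le> 8 * s * (real h)\<^sup>2 * (real_of_int j)\<^sup>2"
            by (intro mult_right_mono) auto
          then show ?thesis using mp s by (simp add: field_simps power_mult_distrib)
        qed
        then show "exp (- (of_int (int (2 * h) * j))\<^sup>2 / (2 * real (m h))) \<le> exp (- (1 / (4 * s)) * (of_int j + 0)\<^sup>2)"
          by simp
      qed (use h s in \<open>auto simp: K_def\<close>)
      finally show "norm (?R j h) \<le> K * exp (- (1 / (4 * s)) * (of_int j + 0)\<^sup>2)" .
    qed
    show "(\<lambda>j::int. K * exp (- (1 / (4 * s)) * (of_int j + 0)\<^sup>2)) summable_on UNIV"
      by (intro summable_on_cmult_right summable_on_int_gaussian) (use s in simp)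
  qed simp
  have "(\<lambda>h. \<Sum>\<^sub>\<infinity>k. ?L k h) \<longlonglongrightarrow> (\<Sum>\<^sub>\<infinity>j. of_real (1 / sqrt (pi * s) * exp (- (of_int j)\<^sup>2 / s)) * exp (2 * pi * \<i> * of_int j * of_real w))"
  proof (rule Lim_transform_eventually[OF R])
    show "\<forall>\<^sub>F h in sequentially. (\<Sum>\<^sub>\<infinity>j. ?R j h) = (\<Sum>\<^sub>\<infinity>k. ?L k h)"
      using eventually_gt_at_top[of 0] by eventually_elim (rule eq[symmetric])
  qed
  then show ?thesis using L LIMSEQ_unique by blast
qed

text \<open>The linear term is absorbed into half of the quadratic one by completing the square.\<close>

lemma norm_exp_quadratic_le:
  fixes n :: int and K \<epsilon> :: real
  assumes "\<epsilon> > 0" "Re \<alpha> \<le> - \<epsilon>" "norm \<beta> \<le> K" "norm \<gamma> \<le> K"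
  shows "norm (exp (\<alpha> * (of_int n)\<^sup>2 + \<beta> * of_int n + \<gamma>)) \<le> exp (K + K\<^sup>2 / (2 * \<epsilon>)) * exp (- (\<epsilon> / 2) * (of_int n + 0)\<^sup>2)"
proof -
  let ?n = "real_of_int n"
  have 1: "Re \<alpha> * ?n\<^sup>2 \<le> - \<epsilon> * ?n\<^sup>2" using assms by (intro mult_right_mono) auto
  have 2: "Re \<beta> * ?n \<le> K * \<bar>?n\<bar>"
  proof -
    have "Re \<beta> * ?n \<le> \<bar>Re \<beta>\<bar> * \<bar>?n\<bar>" by (metis abs_ge_self abs_mult)
    also have "\<dots> \<le> K * \<bar>?n\<bar>"
      using assms(3) abs_Re_le_cmod[of \<beta>] by (intro mult_right_mono) auto
    finally show ?thesis .
  qed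
  have 3: "Re \<gamma> \<le> K" using assms(4) complex_Re_le_cmod[of \<gamma>] by linarith
  have 4: "K * \<bar>?n\<bar> \<le> \<epsilon> / 2 * ?n\<^sup>2 + K\<^sup>2 / (2 * \<epsilon>)"
  proof -
    have "0 \<le> (\<epsilon> * \<bar>?n\<bar> - K)\<^sup>2 / (2 * \<epsilon>)" using assms(1) by simp
    also have "\<dots> = \<epsilon> / 2 * ?n\<^sup>2 + K\<^sup>2 / (2 * \<epsilon>) - K * \<bar>?n\<bar>"
      using assms(1) by (simp add: power2_eq_square field_simps)
    finally show ?thesis by simp
  qed
  have "Re (\<alpha> * (of_int n)\<^sup>2 + \<beta> * of_int n + \<gamma>) = Re \<alpha> * ?n\<^sup>2 + Re \<beta> * ?n + Re \<gamma>"
    by (simp add: power2_eq_square)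
  with 1 2 3 4 have "Re (\<alpha> * (of_int n)\<^sup>2 + \<beta> * of_int n + \<gamma>) \<le> (K + K\<^sup>2 / (2 * \<epsilon>)) + - (\<epsilon> / 2) * (?n + 0)\<^sup>2"
    by simp
  then show ?thesis by (simp only: norm_exp_eq_Re exp_add[symmetric] exp_le_cancel_iff)
qed

lemma holomorphic_on_infsum_exp_quadratic:
  assumes S: "open S" and hol: "\<alpha> holomorphic_on S" "\<beta> holomorphic_on S" "\<gamma> holomorphic_on S"
    and neg: "\<And>z. z \<in> S \<Longrightarrow> Re (\<alpha> z) < 0"
  shows "(\<lambda>z. \<Sum>\<^sub>\<infinity>n\<in>(UNIV::int set). exp (\<alpha> z * (of_int n)\<^sup>2 + \<beta> z * of_int n + \<gamma> z)) holomorphic_on S"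
proof (rule holomorphic_on_infsum[OF S])
  fix n :: int
  show "(\<lambda>z. exp (\<alpha> z * (of_int n)\<^sup>2 + \<beta> z * of_int n + \<gamma> z)) holomorphic_on S"
    by (intro holomorphic_intros hol)
next
  fix z assume "z \<in> S"
  then obtain r where r: "r > 0" "cball z r \<subseteq> S" using S open_contains_cball by blast
  have cont: "continuous_on (cball z r) \<alpha>" "continuous_on (cball z r) \<beta>" "continuous_on (cball z r) \<gamma>"
    using hol r(2) by (meson continuous_on_subset holomorphic_on_imp_continuous_on)+
  have ne: "cball z r \<noteq> {}" using r by auto
  obtain z1 where z1: "z1 \<in> cball z r" "\<forall>y\<in>cball z r. Re (\<alpha> y) \<le> Re (\<alpha> z1)"
    using continuous_attains_sup[OF compact_cball ne continuous_on_Re[OF cont(1)]] by auto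
  obtain K2 where K2: "\<forall>y\<in>cball z r. norm (\<beta> y) \<le> K2"
    using continuous_attains_sup[OF compact_cball ne continuous_on_norm[OF cont(2)]] by auto
  obtain K3 where K3: "\<forall>y\<in>cball z r. norm (\<gamma> y) \<le> K3"
    using continuous_attains_sup[OF compact_cball ne continuous_on_norm[OF cont(3)]] by auto
  let ?e = "- Re (\<alpha> z1)" and ?K = "max K2 K3"
  have e: "?e > 0" using neg z1 r(2) by auto
  let ?M = "\<lambda>n::int. exp (?K + ?K\<^sup>2 / (2 * ?e)) * exp (- (?e / 2) * (of_int n + 0)\<^sup>2)"
  have "?M summable_on UNIV"
    by (intro summable_on_cmult_right summable_on_int_gaussian) (use e in simp)
  moreover have "\<forall>n\<in>UNIV. \<forall>y\<in>cball z r. norm (exp (\<alpha> y * (of_int n)\<^sup>2 + \<beta> y * of_int n + \<gamma> y)) \<le> ?M n"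
    by (intro ballI norm_exp_quadratic_le e) (use z1 K2 K3 in \<open>auto simp: le_max_iff_disj\<close>)
  ultimately show "\<exists>r>0. \<exists>M. cball z r \<subseteq> S \<and> M summable_on UNIV \<and>
      (\<forall>n\<in>UNIV. \<forall>y\<in>cball z r. norm (exp (\<alpha> y * (of_int n)\<^sup>2 + \<beta> y * of_int n + \<gamma> y)) \<le> M n)"
    using r by blast
qed

text \<open>Both parameters are joined to real ones by one complex line: at a real point \<open>z\<close> the numbers
\<open>Re A + z Im A\<close> and \<open>Re w + z Im w\<close> are real, and at \<open>z = \<i>\<close> they are \<open>A\<close> and \<open>w\<close>. Both sides are
holomorphic in \<open>z\<close> on a half-plane and agree at its real points, so they agree at \<open>\<i>\<close>.\<close>

theorem theta_inversion:
  fixes A w :: complex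
  assumes A: "Re A > 0"
  shows "(\<Sum>\<^sub>\<infinity>n\<in>(UNIV::int set). exp (- pi * (of_int n + w)\<^sup>2 / A)) =
    csqrt A * (\<Sum>\<^sub>\<infinity>n\<in>(UNIV::int set). exp (- pi * A * (of_int n)\<^sup>2 + 2 * pi * \<i> * w * of_int n))"
proof -
  define a b :: "complex \<Rightarrow> complex" where "a = (\<lambda>z. of_real (Re A) + z * of_real (Im A))"
    and "b = (\<lambda>z. of_real (Re w) + z * of_real (Im w))"
  define S where "S = {z. Re (a z) > 0}"
  define F where "F = (\<lambda>z. \<Sum>\<^sub>\<infinity>n\<in>(UNIV::int set). exp ((- of_real pi / a z) * (of_int n)\<^sup>2 + (- 2 * of_real pi * b z / a z) * of_int n + (- of_real pi * (b z)\<^sup>2 / a z)))"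
  define G where "G = (\<lambda>z. csqrt (a z) * (\<Sum>\<^sub>\<infinity>n\<in>(UNIV::int set). exp ((- of_real pi * a z) * (of_int n)\<^sup>2 + (2 * of_real pi * \<i> * b z) * of_int n + 0)))"
  have S_eq: "S = {z. inner (of_real (Im A)) z > - Re A}"
    by (auto simp: S_def a_def inner_complex_def mult.commute)
  have S: "open S" "connected S"
    unfolding S_eq by (auto intro: open_halfspace_gt convex_connected convex_halfspace_gt)
  have hab: "a holomorphic_on S" "b holomorphic_on S"
    unfolding a_def b_def by (intro holomorphic_intros)+
  have a0: "a z \<noteq> 0" "Re (a z) > 0" if "z \<in> S" for z using that by (auto simp: S_def)
  have inv: "Re (- of_real pi / a z) < 0" if "z \<in> S" for z
  proof -
    have "(Re (a z))\<^sup>2 + (Im (a z))\<^sup>2 > 0" using a0(2)[OF that] by (intro add_pos_nonneg) auto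
    then show ?thesis using a0(2)[OF that] by (simp add: Re_divide divide_neg_pos mult_neg_pos)
  qed
  have "F holomorphic_on S"
    unfolding F_def using inv a0(1)
    by (intro holomorphic_on_infsum_exp_quadratic S holomorphic_intros hab) auto
  moreover have "G holomorphic_on S"
    unfolding G_def using a0
    by (intro holomorphic_on_mult holomorphic_on_infsum_exp_quadratic S holomorphic_intros hab holomorphic_on_csqrt')
       (auto simp: complex_nonpos_Reals_iff dest!: a0(2))
  ultimately have hol: "(\<lambda>z. F z - G z) holomorphic_on S" by (intro holomorphic_intros)
  define U where "U = S \<inter> range complex_of_real"
  have zero: "F z - G z = 0" if "z \<in> U" for z
  proof -
    obtain t where z: "z = of_real t" and zS: "z \<in> S" using \<open>z \<in> U\<close> by (auto simp: U_def)
    define a' b' where "a' = Re A + t * Im A" and "b' = Re w + t * Im w"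
    have ab: "a z = of_real a'" "b z = of_real b'" by (auto simp: a_def b_def z a'_def b'_def)
    have a': "a' > 0" using a0(2)[OF zS] ab by simp
    have "F z = (\<Sum>\<^sub>\<infinity>k\<in>(UNIV::int set). of_real (exp (- pi\<^sup>2 * (1 / (pi * a')) * (of_int k + b')\<^sup>2)))"
      unfolding F_def ab
    proof (rule infsum_cong)
      fix k :: int
      have "- pi\<^sup>2 * (1 / (pi * a')) * (of_int k + b')\<^sup>2 = - (pi / a') * (of_int k + b')\<^sup>2"
        by (simp add: power2_eq_square)
      then have "of_real (exp (- pi\<^sup>2 * (1 / (pi * a')) * (of_int k + b')\<^sup>2)) = exp (- (of_real pi / of_real a') * (of_int k + of_real b')\<^sup>2 :: complex)"
        by (simp flip: exp_of_real)
      also have "- (of_real pi / of_real a') * (of_int k + of_real b')\<^sup>2 =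
          (- of_real pi / of_real a') * (of_int k)\<^sup>2 + (- 2 * of_real pi * of_real b' / of_real a') * of_int k + (- of_real pi * (of_real b')\<^sup>2 / of_real a' :: complex)"
        by (simp add: power2_eq_square algebra_simps add_divide_distrib)
      finally show "exp ((- of_real pi / of_real a') * (of_int k)\<^sup>2 + (- 2 * of_real pi * of_real b' / of_real a') * of_int k + (- of_real pi * (of_real b')\<^sup>2 / of_real a' :: complex))
         = of_real (exp (- pi\<^sup>2 * (1 / (pi * a')) * (of_int k + b')\<^sup>2))" by simp
    qed
    also have "\<dots> = (\<Sum>\<^sub>\<infinity>j\<in>(UNIV::int set). of_real (1 / sqrt (pi * (1 / (pi * a'))) * exp (- (of_int j)\<^sup>2 / (1 / (pi * a')))) * exp (2 * pi * \<i> * of_int j * of_real b'))"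
      by (rule theta_inversion_real) (use a' in simp)
    also have "\<dots> = (\<Sum>\<^sub>\<infinity>j\<in>(UNIV::int set). of_real (sqrt a') * exp ((- of_real pi * of_real a') * (of_int j)\<^sup>2 + (2 * of_real pi * \<i> * of_real b') * of_int j + 0))"
    proof -
      have r: "1 / sqrt (pi * (1 / (pi * a'))) = sqrt a'" using a' by (simp add: real_sqrt_divide)
      show ?thesis unfolding r
      by (intro infsum_cong) (simp add: exp_add exp_diff exp_minus divide_inverse mult_ac flip: exp_of_real)
    qed
    also have "\<dots> = G z"
      unfolding G_def ab using a' by (subst infsum_cmult_right') (simp add: csqrt_of_real)
    finally show ?thesis by simp
  qed
  have lim: "0 islimpt U"
    unfolding islimpt_approachable
  proof (intro allI impI)
    fix e :: real assume e: "e > 0"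
    define t where "t = min (e / 2) (Re A / (2 * (1 + \<bar>Im A\<bar>)))"
    have t: "t > 0" "t < e" using e A by (auto simp: t_def)
    have "t * \<bar>Im A\<bar> \<le> Re A / (2 * (1 + \<bar>Im A\<bar>)) * \<bar>Im A\<bar>" unfolding t_def by (intro mult_right_mono) auto
    also have "\<dots> < Re A"
      using A by (simp add: field_simps) (smt (verit) mult_nonneg_nonneg)
    finally have "t * \<bar>Im A\<bar> < Re A" .
    moreover have "- (t * \<bar>Im A\<bar>) \<le> t * Im A" using mult_left_mono[of "- \<bar>Im A\<bar>" "Im A" t] t(1) by simp
    ultimately have "complex_of_real t \<in> U" by (simp add: U_def S_def a_def)
    then show "\<exists>x'\<in>U. x' \<noteq> 0 \<and> dist x' 0 < e" using t by (intro bexI[of _ "of_real t"]) auto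
  qed
  have "0 \<in> S" "\<i> \<in> S" using A by (auto simp: S_def a_def)
  then have "F \<i> - G \<i> = 0"
    using analytic_continuation[OF hol S _ _ lim zero] by (auto simp: U_def)
  moreover have "a \<i> = A" "b \<i> = w" by (auto simp: a_def b_def complex_eq_iff)
  ultimately have "(\<Sum>\<^sub>\<infinity>n\<in>(UNIV::int set). exp ((- pi / A) * (of_int n)\<^sup>2 + (- 2 * pi * w / A) * of_int n + (- pi * w\<^sup>2 / A))) =
     csqrt A * (\<Sum>\<^sub>\<infinity>n\<in>(UNIV::int set). exp ((- pi * A) * (of_int n)\<^sup>2 + (2 * pi * \<i> * w) * of_int n + 0))"
    by (simp add: F_def G_def)
  moreover have "(- pi / A) * (of_int n)\<^sup>2 + (- 2 * pi * w / A) * of_int n + (- pi * w\<^sup>2 / A) = - pi * (of_int n + w)\<^sup>2 / A" for n :: int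
    by (simp add: power2_eq_square algebra_simps add_divide_distrib diff_divide_distrib minus_divide_left[symmetric])
  ultimately show ?thesis by simp
qed


section \<open>Homogeneous polynomial functions\<close>

text \<open>Homogeneous polynomial functions, encoded by pulling out one coordinate at a time. This form makes
substitution of linear maps and division by linear forms immediate inductions and avoids monomials.\<close>

primrec homogeneous :: "nat \<Rightarrow> (complex^'n::finite \<Rightarrow> complex) \<Rightarrow> bool" where
  "homogeneous 0 f \<longleftrightarrow> (\<exists>c. \<forall>X. f X = c)"
| "homogeneous (Suc d) f \<longleftrightarrow> (\<exists>h. (\<forall>i. homogeneous d (h i)) \<and> (\<forall>X. f X = (\<Sum>i\<in>UNIV. X $ i * h i X)))"

lemma homogeneous_zero: "homogeneous d (\<lambda>X. 0)"
proof (induction d)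
  case (Suc d)
  then show ?case by (auto intro!: exI[of _ "\<lambda>i X. 0"])
qed simp

lemma homogeneous_add:
  "homogeneous d f \<Longrightarrow> homogeneous d g \<Longrightarrow> homogeneous d (\<lambda>X. f X + g X)"
proof (induction d arbitrary: f g)
  case (Suc d)
  then obtain h k where "\<forall>i. homogeneous d (h i)" "\<forall>X. f X = (\<Sum>i\<in>UNIV. X $ i * h i X)"
    "\<forall>i. homogeneous d (k i)" "\<forall>X. g X = (\<Sum>i\<in>UNIV. X $ i * k i X)" by auto
  with Suc.IH show ?case
    by (auto intro!: exI[of _ "\<lambda>i X. h i X + k i X"] simp: sum.distrib algebra_simps)
qed auto

lemma homogeneous_sum:
  "finite A \<Longrightarrow> (\<And>a. a \<in> A \<Longrightarrow> homogeneous d (f a)) \<Longrightarrow> homogeneous d (\<lambda>X. \<Sum>a\<in>A. f a X)"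
  by (induction A rule: finite_induct) (auto simp: homogeneous_zero homogeneous_add)

lemma homogeneous_cmult: "homogeneous d f \<Longrightarrow> homogeneous d (\<lambda>X. c * f X)"
proof (induction d arbitrary: f)
  case (Suc d)
  then obtain h where "\<forall>i. homogeneous d (h i)" "\<forall>X. f X = (\<Sum>i\<in>UNIV. X $ i * h i X)" by auto
  with Suc.IH show ?case
    by (auto intro!: exI[of _ "\<lambda>i X. c * h i X"] simp: sum_distrib_left mult_ac)
qed auto

lemma homogeneous_times_coord: "homogeneous d f \<Longrightarrow> homogeneous (Suc d) (\<lambda>X. X $ i * f X)"
proof -
  assume f: "homogeneous d f"
  have "homogeneous d (\<lambda>X. if j = i then f X else 0)" for j
    using f by (cases "j = i") (auto simp: homogeneous_zero)
  then show ?thesis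
    by (auto intro!: exI[of _ "\<lambda>j X. if j = i then f X else 0"] simp: if_distrib cong: if_cong)
qed

lemma homogeneous_coord: "homogeneous 1 (\<lambda>X. X $ i)"
  using homogeneous_times_coord[of 0 "\<lambda>X. 1" i] by simp

lemma homogeneous_mult:
  "homogeneous d f \<Longrightarrow> homogeneous e g \<Longrightarrow> homogeneous (d + e) (\<lambda>X. f X * g X)"
proof (induction d arbitrary: f)
  case 0
  then obtain c where "\<forall>X. f X = c" by auto
  then show ?case using homogeneous_cmult[OF 0(2), of c] by simp
next
  case (Suc d)
  then obtain h where h: "\<forall>i. homogeneous d (h i)" "\<forall>X. f X = (\<Sum>i\<in>UNIV. X $ i * h i X)" by auto
  have "homogeneous (d + e) (\<lambda>X. h i X * g X)" for i
    using Suc h by auto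
  then have "homogeneous (Suc (d + e)) (\<lambda>X. \<Sum>i\<in>UNIV. X $ i * (h i X * g X))"
    by (intro homogeneous_sum homogeneous_times_coord) auto
  moreover have "(\<lambda>X. \<Sum>i\<in>UNIV. X $ i * (h i X * g X)) = (\<lambda>X. f X * g X)"
    using h(2) by (simp add: sum_distrib_right mult.assoc)
  ultimately show ?case by simp
qed

lemma homogeneous_power: "homogeneous d f \<Longrightarrow> homogeneous (n * d) (\<lambda>X. f X ^ n)"
  by (induction n) (auto intro: homogeneous_mult)

lemma homogeneous_prod:
  "finite A \<Longrightarrow> (\<And>a. a \<in> A \<Longrightarrow> homogeneous d (f a)) \<Longrightarrow> homogeneous (card A * d) (\<lambda>X. \<Prod>a\<in>A. f a X)"
  by (induction A rule: finite_induct) (auto intro: homogeneous_mult)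

lemma homogeneous_row: "homogeneous 1 (\<lambda>X. (A *v X) $ i)"
proof -
  have "homogeneous 1 (\<lambda>X. \<Sum>j\<in>UNIV. A $ i $ j * X $ j)"
    by (intro homogeneous_sum homogeneous_cmult homogeneous_coord) simp
  then show ?thesis by (simp add: matrix_vector_mult_def)
qed

lemma homogeneous_compose_linear: "homogeneous d f \<Longrightarrow> homogeneous d (\<lambda>X. f (A *v X))"
proof (induction d arbitrary: f)
  case (Suc d)
  then obtain h where h: "\<forall>i. homogeneous d (h i)" "\<forall>X. f X = (\<Sum>i\<in>UNIV. X $ i * h i X)" by auto
  have "homogeneous (1 + d) (\<lambda>X. \<Sum>i\<in>UNIV. (A *v X) $ i * h i (A *v X))"
    using Suc h by (intro homogeneous_sum homogeneous_mult homogeneous_row) auto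
  then show ?case using h(2) by simp
qed auto

lemma homogeneous_scale: "homogeneous d f \<Longrightarrow> f (c *s X) = c ^ d * f X"
proof (induction d arbitrary: f)
  case (Suc d)
  then obtain h where h: "\<forall>i. homogeneous d (h i)" "\<forall>X. f X = (\<Sum>i\<in>UNIV. X $ i * h i X)" by auto
  then have "h i (c *s X) = c ^ d * h i X" for i using Suc.IH by blast
  then show ?case using h(2) by (simp add: sum_distrib_left mult_ac)
qed auto

lemma homogeneous_continuous: "homogeneous d f \<Longrightarrow> continuous_on UNIV f"
proof (induction d arbitrary: f)
  case 0
  then obtain c where "f = (\<lambda>X. c)" by auto
  then show ?case by simp
next
  case (Suc d)
  then obtain h where h: "\<forall>i. homogeneous d (h i)" "f = (\<lambda>X. \<Sum>i\<in>UNIV. X $ i * h i X)" by (auto simp: fun_eq_iff)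
  show ?case unfolding h(2) using Suc.IH h(1) by (intro continuous_intros) auto
qed

text \<open>If two linear maps differ by a linear form times a fixed vector, then the values of a homogeneous
polynomial on them differ by a multiple of that form. Division by a linear form and removal of one
coordinate are both instances.\<close>

lemma homogeneous_difference:
  assumes "\<And>X i. (A *v X) $ i - (B *v X) $ i = l X * c i"
    and l: "homogeneous 1 l"
  shows "homogeneous (Suc d) f \<Longrightarrow> \<exists>g. homogeneous d g \<and> (\<forall>X. f (A *v X) - f (B *v X) = l X * g X)"
proof (induction d arbitrary: f)
  case 0
  then obtain h where h: "\<forall>i. \<exists>e. \<forall>X. h i X = e" "\<forall>X. f X = (\<Sum>i\<in>UNIV. X $ i * h i X)" by auto
  obtain e where e: "\<And>i X. h i X = e i" using h(1) by metis
  have "f (A *v X) - f (B *v X) = l X * (\<Sum>i\<in>UNIV. c i * e i)" for X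
  proof -
    have "f (A *v X) - f (B *v X) = (\<Sum>i\<in>UNIV. ((A *v X) $ i - (B *v X) $ i) * e i)"
      by (simp add: h(2) e sum_subtractf left_diff_distrib)
    then show ?thesis by (simp add: assms(1) sum_distrib_left mult.assoc)
  qed
  then show ?case by auto
next
  case (Suc d)
  then obtain h where h: "\<forall>i. homogeneous (Suc d) (h i)" "\<forall>X. f X = (\<Sum>i\<in>UNIV. X $ i * h i X)" by (metis homogeneous.simps(2))
  then have "\<forall>i. \<exists>g. homogeneous d g \<and> (\<forall>X. h i (A *v X) - h i (B *v X) = l X * g X)"
    using Suc.IH by blast
  from choice[OF this] obtain g
    where g: "\<And>i. homogeneous d (g i)" "\<And>i X. h i (A *v X) - h i (B *v X) = l X * g i X"
    by blast
  let ?g = "\<lambda>X. \<Sum>i\<in>UNIV. c i * h i (A *v X) + (B *v X) $ i * g i X"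
  have "homogeneous (Suc d) ?g"
    using homogeneous_mult[OF homogeneous_row g(1)] h(1)
    by (intro homogeneous_sum homogeneous_add homogeneous_cmult homogeneous_compose_linear) auto
  moreover have "f (A *v X) - f (B *v X) = l X * ?g X" for X
  proof -
    have "f (A *v X) - f (B *v X) = (\<Sum>i\<in>UNIV. ((A *v X) $ i - (B *v X) $ i) * h i (A *v X) + (B *v X) $ i * (h i (A *v X) - h i (B *v X)))"
      by (simp add: h(2) left_diff_distrib right_diff_distrib sum_subtractf sum.distrib)
    also have "\<dots> = (\<Sum>i\<in>UNIV. l X * (c i * h i (A *v X) + (B *v X) $ i * g i X))"
      by (simp add: assms(1) g(2) algebra_simps)
    finally show ?thesis by (simp add: sum_distrib_left)
  qed
  ultimately show ?case by blast
qed

text \<open>Compare the identity with a projection onto the kernel of the form, where the polynomial is zero.\<close>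

lemma linear_form_divides:
  fixes v :: "complex^'n"
  assumes f: "homogeneous (Suc d) f" and v: "v \<noteq> 0"
    and zero: "\<And>X. scalar_product v X = 0 \<Longrightarrow> f X = 0"
  obtains g where "homogeneous d g" "\<And>X. f X = scalar_product v X * g X"
proof -
  obtain k where k: "v $ k \<noteq> 0" using v by (auto simp: vec_eq_iff)
  define B :: "complex^'n^'n" where "B = (\<chi> i j. of_bool (i = j) - of_bool (i = k) * v $ j / v $ k)"
  have B: "(B *v X) $ i = X $ i - of_bool (i = k) * scalar_product v X / v $ k" for X i
  proof -
    have "(B *v X) $ i = (\<Sum>j\<in>UNIV. of_bool (i = j) * X $ j) - (\<Sum>j\<in>UNIV. of_bool (i = k) * (v $ j * X $ j / v $ k))"
      by (simp add: B_def matrix_vector_mult_def left_diff_distrib sum_subtractf)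
    also have "(\<Sum>j\<in>UNIV. of_bool (i = j) * X $ j) = X $ i"
      by (simp add: of_bool_def if_distribR if_distrib[of "\<lambda>x. x * _"] cong: if_cong)
    finally show ?thesis by (simp add: scalar_product_def sum_divide_distrib sum_distrib_left)
  qed
  have l: "homogeneous 1 (\<lambda>X. scalar_product v X)"
    unfolding scalar_product_def by (intro homogeneous_sum homogeneous_cmult homogeneous_coord) simp
  have "\<exists>g. homogeneous d g \<and> (\<forall>X. f (mat 1 *v X) - f (B *v X) = scalar_product v X * g X)"
    by (rule homogeneous_difference[where c = "\<lambda>i. of_bool (i = k) / v $ k", OF _ l f]) (simp add: B)
  moreover have "f (B *v X) = 0" for X
  proof (rule zero)
    have "scalar_product v (B *v X) = (\<Sum>i\<in>UNIV. v $ i * X $ i) - scalar_product v X"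
    proof -
      have "(\<Sum>i\<in>UNIV. v $ i * (of_bool (i = k) * scalar_product v X / v $ k)) = (\<Sum>i\<in>UNIV. if i = k then scalar_product v X else 0)"
        using k by (intro sum.cong) auto
      then show ?thesis
        by (simp add: scalar_product_def[of v "B *v X"] B right_diff_distrib sum_subtractf)
    qed
    then show "scalar_product v (B *v X) = 0" by (simp add: scalar_product_def)
  qed
  ultimately show ?thesis using that by auto
qed

lemma scalar_product_add_scale:
  fixes u :: "complex^'n"
  shows "scalar_product u (X + t *s Y) = scalar_product u X + t * scalar_product u Y"
  by (simp add: scalar_product_def sum.distrib sum_distrib_left algebra_simps)

text \<open>Divide by the forms one after the other. After division by one form the quotient still vanishes on the
kernel of any other: on a line in that kernel on which the first form is not constant, the quotient is
zero except possibly at one point, hence everywhere by continuity.\<close>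

lemma product_of_linear_forms_divides:
  fixes v :: "'k \<Rightarrow> complex^'n"
  assumes "finite K"
  shows "homogeneous (card K + d) f \<Longrightarrow>
     (\<And>k X. k \<in> K \<Longrightarrow> scalar_product (v k) X = 0 \<Longrightarrow> f X = 0) \<Longrightarrow>
     (\<And>k. k \<in> K \<Longrightarrow> v k \<noteq> 0) \<Longrightarrow>
     (\<And>k k'. k \<in> K \<Longrightarrow> k' \<in> K \<Longrightarrow> k \<noteq> k' \<Longrightarrow> \<exists>Y. scalar_product (v k') Y = 0 \<and> scalar_product (v k) Y \<noteq> 0) \<Longrightarrow>
     \<exists>g. homogeneous d g \<and> (\<forall>X. f X = (\<Prod>k\<in>K. scalar_product (v k) X) * g X)"
  using assms
proof (induction K arbitrary: f rule: finite_induct)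
  case empty then show ?case by auto
next
  case (insert a K)
  have "homogeneous (Suc (card K + d)) f" using insert by simp
  then obtain g where g: "homogeneous (card K + d) g" "\<And>X. f X = scalar_product (v a) X * g X"
    using linear_form_divides[of _ f "v a"] insert.prems by (metis insertI1)
  have "\<exists>g'. homogeneous d g' \<and> (\<forall>X. g X = (\<Prod>k\<in>K. scalar_product (v k) X) * g' X)"
  proof (rule insert.IH[OF g(1)])
    fix k X assume k: "k \<in> K" and X: "scalar_product (v k) X = 0"
    then have "a \<noteq> k" using insert.hyps by auto
    then obtain Y where Y: "scalar_product (v k) Y = 0" "scalar_product (v a) Y \<noteq> 0"
      using insert.prems(4)[of a k] k by auto
    \<comment> \<open>The only parameter at which the line through \<open>X\<close> meets the kernel of the form \<open>a\<close>.\<close>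
    define t0 where "t0 = - scalar_product (v a) X / scalar_product (v a) Y"
    have zero: "g (X + t *s Y) = 0" if "t \<noteq> t0" for t
    proof -
      have "scalar_product (v a) (X + t *s Y) \<noteq> 0"
        using that Y(2) by (auto simp: scalar_product_add_scale t0_def field_simps add_eq_0_iff)
      moreover have "f (X + t *s Y) = 0"
        by (rule insert.prems(2)[of k]) (use k X Y in \<open>auto simp: scalar_product_add_scale\<close>)
      ultimately show ?thesis using g(2) by auto
    qed
    have "continuous_on UNIV (\<lambda>t. g (X + t *s Y))"
      unfolding vector_scalar_mult_def
      by (intro continuous_on_compose2[OF homogeneous_continuous[OF g(1)]] continuous_intros) auto
    then have "isCont (\<lambda>t. g (X + t *s Y)) 0" by (simp add: continuous_on_eq_continuous_at)
    then have "((\<lambda>t. g (X + t *s Y)) \<longlongrightarrow> g (X + 0 *s Y)) (at 0)" by (simp add: isCont_def)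
    moreover have "((\<lambda>t. g (X + t *s Y)) \<longlongrightarrow> 0) (at 0)"
    proof (rule tendsto_eventually)
      have "\<forall>\<^sub>F t in at 0. t \<noteq> t0"
        by (rule eventually_neq_at_within)
      then show "\<forall>\<^sub>F t in at 0. g (X + t *s Y) = 0" by eventually_elim (rule zero)
    qed
    ultimately have "g (X + 0 *s Y) = 0" using tendsto_unique by (metis at_neq_bot)
    then show "g X = 0" by simp
  qed (use insert.prems in auto)
  then obtain g' where "homogeneous d g'" "\<And>X. g X = (\<Prod>k\<in>K. scalar_product (v k) X) * g' X" by blast
  then show ?case using g(2) insert.hyps by (auto intro!: exI[of _ g'] simp: mult_ac)
qed


section \<open>Homogeneous polynomials vanishing along a curve\<close>

definition zero_coord :: "'n \<Rightarrow> complex^'n::finite \<Rightarrow> complex^'n" where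
  "zero_coord k X = (\<chi> i. if i = k then 0 else X $ i)"

lemma homogeneous_zero_coord:
  fixes f :: "complex^'n::finite \<Rightarrow> complex"
  assumes f: "homogeneous (Suc d) f"
  obtains h where "homogeneous d h" "\<And>X. f X = f (zero_coord k X) + X $ k * h X"
proof -
  define B :: "complex^'n^'n" where "B = (\<chi> i j. of_bool (i = j \<and> i \<noteq> k))"
  have B: "B *v X = zero_coord k X" for X
  proof -
    have "(\<Sum>j\<in>UNIV. of_bool (i = j \<and> i \<noteq> k) * X $ j) = (\<Sum>j\<in>UNIV. if j = i then (if i = k then 0 else X $ i) else 0)" for i
      by (rule sum.cong) auto
    then show ?thesis by (simp add: B_def zero_coord_def matrix_vector_mult_def vec_eq_iff)
  qed
  have "\<exists>g. homogeneous d g \<and> (\<forall>X. f (mat 1 *v X) - f (B *v X) = X $ k * g X)"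
    by (rule homogeneous_difference[where c = "\<lambda>i. of_bool (i = k)", OF _ homogeneous_coord f]) (simp add: B zero_coord_def)
  then show ?thesis using that unfolding B by (metis add.commute diff_eq_eq matrix_vector_mul_lid)
qed

lemma homogeneous_tendsto:
  assumes "homogeneous d f" "(X \<longlongrightarrow> L) F"
  shows "((\<lambda>s. f (X s)) \<longlongrightarrow> f L) F"
  by (rule continuous_on_tendsto_compose[OF homogeneous_continuous[OF assms(1)] assms(2)]) auto

text \<open>Algebraic independence by orders of vanishing, two coordinates. Along the curve \<open>Z\<close> the coordinate \<open>a\<close>
tends to a non-zero limit and \<open>b\<close> decays exactly like \<open>E\<close>. A form of degree \<open>d\<close> that is smaller than
\<open>E\<^sup>d\<close> on the curve vanishes at the limit point, so it is divisible by the coordinate \<open>b\<close>, and the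
quotient satisfies the same assumption in degree \<open>d - 1\<close>.\<close>

lemma homogeneous_zero_on_plane:
  fixes E :: "real \<Rightarrow> complex" and Z :: "real \<Rightarrow> complex^'n::finite"
  assumes ab: "a \<noteq> b" and E: "(E \<longlongrightarrow> 0) at_top" "\<And>s. E s \<noteq> 0"
    and supp: "\<And>s i. i \<noteq> a \<Longrightarrow> i \<noteq> b \<Longrightarrow> Z s $ i = 0"
    and La: "((\<lambda>s. Z s $ a) \<longlongrightarrow> La) at_top" "La \<noteq> 0"
    and Lb: "((\<lambda>s. Z s $ b / E s) \<longlongrightarrow> Lb) at_top" "Lb \<noteq> 0"
  shows "homogeneous d g \<Longrightarrow> ((\<lambda>s. g (Z s) / E s ^ d) \<longlongrightarrow> 0) at_top \<Longrightarrow>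
    (\<And>i. i \<noteq> a \<Longrightarrow> i \<noteq> b \<Longrightarrow> Y $ i = 0) \<Longrightarrow> g Y = 0"
proof (induction d arbitrary: g Y)
  case 0
  then obtain c where c: "\<And>X. g X = c" by auto
  have "((\<lambda>s::real. c) \<longlongrightarrow> 0) at_top" using 0(2) by (simp add: c)
  then have "c = 0" using tendsto_unique[OF trivial_limit_at_top_linorder tendsto_const[of c]] by blast
  then show ?case by (simp add: c)
next
  case (Suc d)
  have Zb0: "((\<lambda>s. Z s $ b) \<longlongrightarrow> 0) at_top"
    using tendsto_mult[OF Lb(1) E(1)] E(2) by simp
  have Zlim: "(Z \<longlongrightarrow> axis a La) at_top"
  proof (rule vec_tendstoI)
    fix i
    show "((\<lambda>s. Z s $ i) \<longlongrightarrow> axis a La $ i) at_top"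
      using La(1) Zb0 supp[of i] by (cases "i = a"; cases "i = b") (auto simp: axis_def)
  qed
  have "((\<lambda>s. g (Z s) / E s ^ Suc d * E s ^ Suc d) \<longlongrightarrow> 0 * 0 ^ Suc d) at_top"
    by (intro tendsto_mult Suc.prems tendsto_power E(1))
  then have "((\<lambda>s. g (Z s)) \<longlongrightarrow> 0) at_top" using E(2) by simp
  moreover have "((\<lambda>s. g (Z s)) \<longlongrightarrow> g (axis a La)) at_top"
    by (rule homogeneous_tendsto[OF Suc.prems(1) Zlim])
  ultimately have g0: "g (axis a La) = 0" using tendsto_unique[OF trivial_limit_at_top_linorder] by blast
  have ga: "g (axis a y) = 0" for y
  proof -
    have "axis a y = (y / La) *s axis a La" using La(2) by (simp add: axis_def vec_eq_iff)
    then show ?thesis using homogeneous_scale[OF Suc.prems(1)] g0 by simp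
  qed
  obtain h where h: "homogeneous d h" "\<And>X. g X = g (zero_coord b X) + X $ b * h X"
    using homogeneous_zero_coord[OF Suc.prems(1)] by blast
  have zc: "zero_coord b X = axis a (X $ a)" if "\<And>i. i \<noteq> a \<Longrightarrow> i \<noteq> b \<Longrightarrow> X $ i = 0" for X
    using that ab by (auto simp: zero_coord_def axis_def vec_eq_iff)
  have gh: "g X = X $ b * h X" if "\<And>i. i \<noteq> a \<Longrightarrow> i \<noteq> b \<Longrightarrow> X $ i = 0" for X
    using h(2)[of X] zc[OF that] ga by simp
  have "((\<lambda>s. (g (Z s) / E s ^ Suc d) / (Z s $ b / E s)) \<longlongrightarrow> 0 / Lb) at_top"
    by (intro tendsto_divide Suc.prems Lb)
  moreover have "\<forall>\<^sub>F s in at_top. Z s $ b / E s \<noteq> 0"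
    by (rule tendsto_imp_eventually_ne[OF Lb])
  then have "\<forall>\<^sub>F s in at_top. (g (Z s) / E s ^ Suc d) / (Z s $ b / E s) = h (Z s) / E s ^ d"
  proof eventually_elim
    case (elim s)
    then show ?case using gh[of "Z s"] supp E(2)[of s] by (simp add: field_simps)
  qed
  ultimately have "((\<lambda>s. h (Z s) / E s ^ d) \<longlongrightarrow> 0) at_top"
    by (simp add: tendsto_cong)
  then have "h Y = 0" using Suc.IH[OF h(1)] Suc.prems(3) by blast
  then show ?case using gh[of Y] Suc.prems(3) by simp
qed

text \<open>Three coordinates, the third decaying like \<open>E\<^sup>N\<close> with \<open>N\<close> larger than the degree. Setting that
coordinate to zero changes the value on the curve by something negligible against \<open>E\<^sup>d\<close>, so the previous
lemma gives divisibility by the coordinate \<open>c\<close>, and induction on the degree applies to the quotient.\<close>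

lemma homogeneous_zero_on_space:
  fixes E :: "real \<Rightarrow> complex" and X :: "real \<Rightarrow> complex^'n::finite"
  assumes abc: "a \<noteq> b" "a \<noteq> c" "b \<noteq> c" and E: "(E \<longlongrightarrow> 0) at_top" "\<And>s. E s \<noteq> 0"
    and supp: "\<And>s i. i \<noteq> a \<Longrightarrow> i \<noteq> b \<Longrightarrow> i \<noteq> c \<Longrightarrow> X s $ i = 0"
    and La: "((\<lambda>s. X s $ a) \<longlongrightarrow> La) at_top" "La \<noteq> 0"
    and Lb: "((\<lambda>s. X s $ b / E s) \<longlongrightarrow> Lb) at_top" "Lb \<noteq> 0"
    and Lc: "((\<lambda>s. X s $ c / E s ^ N) \<longlongrightarrow> Lc) at_top" "Lc \<noteq> 0"
  shows "homogeneous d f \<Longrightarrow> d < N \<Longrightarrow> \<forall>\<^sub>F s in at_top. f (X s) = 0 \<Longrightarrow>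
    (\<And>i. i \<noteq> a \<Longrightarrow> i \<noteq> b \<Longrightarrow> i \<noteq> c \<Longrightarrow> Y $ i = 0) \<Longrightarrow> f Y = 0"
proof (induction d arbitrary: f Y)
  case 0
  then obtain e where e: "\<And>X. f X = e" by auto
  then show ?case using 0(3) by (simp add: eventually_const)
next
  case (Suc d)
  obtain h where h: "homogeneous d h" "\<And>X. f X = f (zero_coord c X) + X $ c * h X"
    using homogeneous_zero_coord[OF Suc.prems(1)] by blast
  have EN: "((\<lambda>s. E s ^ n) \<longlongrightarrow> 0) at_top" if "n > 0" for n
    using tendsto_power[OF E(1), of n] that by (simp add: power_0_left)
  have Xb0: "((\<lambda>s. X s $ b) \<longlongrightarrow> 0) at_top"
    using tendsto_mult[OF Lb(1) E(1)] E(2) by simp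
  have Xc0: "((\<lambda>s. X s $ c) \<longlongrightarrow> 0) at_top"
    using tendsto_mult[OF Lc(1) EN[of N]] E(2) Suc.prems(2) by simp
  have Xlim: "(X \<longlongrightarrow> axis a La) at_top"
  proof (rule vec_tendstoI)
    fix i
    show "((\<lambda>s. X s $ i) \<longlongrightarrow> axis a La $ i) at_top"
      using La(1) Xb0 Xc0 supp[of i] by (cases "i = a"; cases "i = b"; cases "i = c") (auto simp: axis_def)
  qed
  have plane: "f Y = 0" if Y: "\<And>i. i \<noteq> a \<Longrightarrow> i \<noteq> b \<Longrightarrow> Y $ i = 0" for Y
  proof (rule homogeneous_zero_on_plane[OF abc(1) E _ _ La(2) _ Lb(2) Suc.prems(1), where Z = "\<lambda>s. zero_coord c (X s)"])
    show "zero_coord c (X s) $ i = 0" if "i \<noteq> a" "i \<noteq> b" for s i using supp that by (simp add: zero_coord_def)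
    show "((\<lambda>s. zero_coord c (X s) $ a) \<longlongrightarrow> La) at_top" "((\<lambda>s. zero_coord c (X s) $ b / E s) \<longlongrightarrow> Lb) at_top"
      using La Lb abc by (simp_all add: zero_coord_def)
    have "((\<lambda>s. - (X s $ c / E s ^ N) * E s ^ (N - Suc d) * h (X s)) \<longlongrightarrow> - Lc * 0 * h (axis a La)) at_top"
      by (intro tendsto_mult tendsto_minus Lc EN homogeneous_tendsto[OF h(1) Xlim]) (use Suc.prems(2) in simp)
    moreover have "\<forall>\<^sub>F s in at_top. - (X s $ c / E s ^ N) * E s ^ (N - Suc d) * h (X s) = f (zero_coord c (X s)) / E s ^ Suc d"
      using Suc.prems(3)
    proof eventually_elim
      case (elim s)
      have "f (zero_coord c (X s)) = - (X s $ c * h (X s))"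
        using h(2)[of "X s"] elim by (simp add: eq_neg_iff_add_eq_0)
      moreover have "E s ^ N = E s ^ Suc d * E s ^ (N - Suc d)"
        using Suc.prems(2) by (metis le_add_diff_inverse less_imp_le power_add)
      ultimately show ?case using E(2)[of s] by simp
    qed
    ultimately show "((\<lambda>s. f (zero_coord c (X s)) / E s ^ Suc d) \<longlongrightarrow> 0) at_top"
      by (simp add: tendsto_cong)
  qed (use Y in auto)
  have fh: "f Y = Y $ c * h Y" if "\<And>i. i \<noteq> a \<Longrightarrow> i \<noteq> b \<Longrightarrow> i \<noteq> c \<Longrightarrow> Y $ i = 0" for Y
  proof -
    have "f (zero_coord c Y) = 0" by (rule plane) (use that in \<open>auto simp: zero_coord_def\<close>)
    then show ?thesis using h(2)[of Y] by simp
  qed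
  have "\<forall>\<^sub>F s in at_top. X s $ c / E s ^ N \<noteq> 0"
    by (rule tendsto_imp_eventually_ne[OF Lc])
  with Suc.prems(3) have "\<forall>\<^sub>F s in at_top. h (X s) = 0"
  proof eventually_elim
    case (elim s)
    then show ?case using fh[of "X s"] supp by auto
  qed
  then have "h Y = 0" using Suc.IH[OF h(1)] Suc.prems by simp
  then show ?case using fh[of Y] Suc.prems(4) by simp
qed


section \<open>Generators of the integral symplectic group\<close>

lemma UNIV_2_2: "(UNIV :: (2 + 2) set) = {Inl 1, Inl 2, Inr 1, Inr 2}"
  unfolding UNIV_sum UNIV_2 by auto

lemma sum_UNIV_2_2: "sum f (UNIV :: (2 + 2) set) = f (Inl 1) + f (Inl 2) + (f (Inr 1) + f (Inr 2))"
  unfolding UNIV_2_2 by (simp add: add.assoc)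

lemma forall_2_2: "(\<forall>i::2 + 2. P i) \<longleftrightarrow> P (Inl 1) \<and> P (Inl 2) \<and> P (Inr 1) \<and> P (Inr 2)"
proof -
  have "(\<forall>i::2 + 2. P i) \<longleftrightarrow> (\<forall>i\<in>(UNIV :: (2 + 2) set). P i)" by simp
  then show ?thesis unfolding UNIV_2_2 by simp
qed

definition mat2 :: "'a::zero \<Rightarrow> 'a \<Rightarrow> 'a \<Rightarrow> 'a \<Rightarrow> 'a^2^2" where
  "mat2 x y z w = vector [vector [x, y], vector [z, w]]"

lemma mat2_nth [simp]:
  "mat2 x y z w $ 1 $ 1 = x" "mat2 x y z w $ 1 $ 2 = y"
  "mat2 x y z w $ 2 $ 1 = z" "mat2 x y z w $ 2 $ 2 = w"
  by (simp_all add: mat2_def)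

lemma mat2_eq_iff: "(A :: 'a^2^2) = B \<longleftrightarrow> A $ 1 $ 1 = B $ 1 $ 1 \<and> A $ 1 $ 2 = B $ 1 $ 2 \<and> A $ 2 $ 1 = B $ 2 $ 1 \<and> A $ 2 $ 2 = B $ 2 $ 2"
  unfolding vec_eq_iff forall_2 by blast

definition blocks :: "int^2^2 \<Rightarrow> int^2^2 \<Rightarrow> int^2^2 \<Rightarrow> int^2^2 \<Rightarrow> mat4" where
  "blocks a b c d = (\<chi> i j. case i of
      Inl k \<Rightarrow> (case j of Inl l \<Rightarrow> a $ k $ l | Inr l \<Rightarrow> b $ k $ l)
    | Inr k \<Rightarrow> (case j of Inl l \<Rightarrow> c $ k $ l | Inr l \<Rightarrow> d $ k $ l))"

lemma blocks_nth [simp]: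
  "blocks a b c d $ Inl k $ Inl l = a $ k $ l" "blocks a b c d $ Inl k $ Inr l = b $ k $ l"
  "blocks a b c d $ Inr k $ Inl l = c $ k $ l" "blocks a b c d $ Inr k $ Inr l = d $ k $ l"
  by (simp_all add: blocks_def)

lemma block_blocks [simp]:
  "block_a (blocks a b c d) = a" "block_b (blocks a b c d) = b"
  "block_c (blocks a b c d) = c" "block_d (blocks a b c d) = d"
  by (simp_all add: block_a_def block_b_def block_c_def block_d_def vec_eq_iff)

definition trans11 :: "int \<Rightarrow> mat4" where
  "trans11 k = blocks (mat2 1 0 0 1) (mat2 k 0 0 0) (mat2 0 0 0 0) (mat2 1 0 0 1)"
definition trans12 :: "int \<Rightarrow> mat4" where
  "trans12 k = blocks (mat2 1 0 0 1) (mat2 0 k k 0) (mat2 0 0 0 0) (mat2 1 0 0 1)"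
definition partial_inversion :: mat4 where
  "partial_inversion = blocks (mat2 0 0 0 1) (mat2 (-1) 0 0 0) (mat2 1 0 0 0) (mat2 0 0 0 1)"
definition swap_coords :: mat4 where
  "swap_coords = blocks (mat2 0 1 1 0) (mat2 0 0 0 0) (mat2 0 0 0 0) (mat2 0 1 1 0)"
text \<open>An elementary matrix of \<open>SL(2, \<int>)\<close>, embedded in the symplectic group: the lower right block has to be
the inverse transpose of the upper left one.\<close>

definition shear :: "int \<Rightarrow> mat4" where
  "shear k = blocks (mat2 1 k 0 1) (mat2 0 0 0 0) (mat2 0 0 0 0) (mat2 1 0 (-k) 1)"

lemmas generator_defs = trans11_def trans12_def partial_inversion_def swap_coords_def shear_def

lemma trans11_rows [simp]:
  "(trans11 k ** M) $ Inl 1 $ j = M $ Inl 1 $ j + k * M $ Inr 1 $ j"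
  "(trans11 k ** M) $ Inl 2 $ j = M $ Inl 2 $ j"
  "(trans11 k ** M) $ Inr 1 $ j = M $ Inr 1 $ j"
  "(trans11 k ** M) $ Inr 2 $ j = M $ Inr 2 $ j"
  by (simp_all add: generator_defs matrix_matrix_mult_def sum_UNIV_2_2)

lemma trans12_rows [simp]:
  "(trans12 k ** M) $ Inl 1 $ j = M $ Inl 1 $ j + k * M $ Inr 2 $ j"
  "(trans12 k ** M) $ Inl 2 $ j = M $ Inl 2 $ j + k * M $ Inr 1 $ j"
  "(trans12 k ** M) $ Inr 1 $ j = M $ Inr 1 $ j"
  "(trans12 k ** M) $ Inr 2 $ j = M $ Inr 2 $ j"
  by (simp_all add: generator_defs matrix_matrix_mult_def sum_UNIV_2_2)

lemma partial_inversion_rows [simp]: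
  "(partial_inversion ** M) $ Inl 1 $ j = - M $ Inr 1 $ j"
  "(partial_inversion ** M) $ Inl 2 $ j = M $ Inl 2 $ j"
  "(partial_inversion ** M) $ Inr 1 $ j = M $ Inl 1 $ j"
  "(partial_inversion ** M) $ Inr 2 $ j = M $ Inr 2 $ j"
  by (simp_all add: generator_defs matrix_matrix_mult_def sum_UNIV_2_2)

lemma swap_coords_rows [simp]:
  "(swap_coords ** M) $ Inl 1 $ j = M $ Inl 2 $ j"
  "(swap_coords ** M) $ Inl 2 $ j = M $ Inl 1 $ j"
  "(swap_coords ** M) $ Inr 1 $ j = M $ Inr 2 $ j"
  "(swap_coords ** M) $ Inr 2 $ j = M $ Inr 1 $ j"
  by (simp_all add: generator_defs matrix_matrix_mult_def sum_UNIV_2_2)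

lemma shear_rows [simp]:
  "(shear k ** M) $ Inl 1 $ j = M $ Inl 1 $ j + k * M $ Inl 2 $ j"
  "(shear k ** M) $ Inl 2 $ j = M $ Inl 2 $ j"
  "(shear k ** M) $ Inr 1 $ j = M $ Inr 1 $ j"
  "(shear k ** M) $ Inr 2 $ j = M $ Inr 2 $ j - k * M $ Inr 1 $ j"
  by (simp_all add: generator_defs matrix_matrix_mult_def sum_UNIV_2_2)

text \<open>The symplectic form evaluated on two columns. A matrix is symplectic if and only if its columns pair
like the standard basis, which is the form used in the column reduction.\<close>

definition col_pairing :: "mat4 \<Rightarrow> 2 + 2 \<Rightarrow> 2 + 2 \<Rightarrow> int" where
  "col_pairing M i j = M $ Inl 1 $ i * M $ Inr 1 $ j + M $ Inl 2 $ i * M $ Inr 2 $ j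
     - M $ Inr 1 $ i * M $ Inl 1 $ j - M $ Inr 2 $ i * M $ Inl 2 $ j"

lemma transpose_symplectic_J_nth: "(transpose M ** symplectic_J ** M) $ i $ j = col_pairing M i j"
  by (simp add: matrix_matrix_mult_def sum_UNIV_2_2 transpose_def symplectic_J_def col_pairing_def algebra_simps)

lemma in_Gamma2_iff: "M \<in> carrier Gamma2 \<longleftrightarrow> (\<forall>i j. col_pairing M i j = symplectic_J $ i $ j)"
  by (simp add: Gamma2_def vec_eq_iff transpose_symplectic_J_nth)

lemma symplectic_J_nth [simp]:
  "symplectic_J $ Inl k $ Inl l = 0" "symplectic_J $ Inr k $ Inr l = 0"
  "symplectic_J $ Inl k $ Inr l = of_bool (k = l)" "symplectic_J $ Inr k $ Inl l = - of_bool (k = l)"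
  by (simp_all add: symplectic_J_def)

lemma col_pairing_generator [simp]:
  "col_pairing (trans11 k ** M) i j = col_pairing M i j"
  "col_pairing (trans12 k ** M) i j = col_pairing M i j"
  "col_pairing (partial_inversion ** M) i j = col_pairing M i j"
  "col_pairing (swap_coords ** M) i j = col_pairing M i j"
  "col_pairing (shear k ** M) i j = col_pairing M i j"
  by (simp_all add: col_pairing_def algebra_simps)

text \<open>Products of generators, built by left multiplication. Since the inverse of a generator is again a
product of generators, a matrix is in this set as soon as a generator times it is.\<close>

inductive_set generated :: "mat4 set" where
  one: "mat 1 \<in> generated"
| trans11: "M \<in> generated \<Longrightarrow> trans11 k ** M \<in> generated"
| trans12: "M \<in> generated \<Longrightarrow> trans12 k ** M \<in> generated"
| partial_inversion: "M \<in> generated \<Longrightarrow> partial_inversion ** M \<in> generated"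
| swap_coords: "M \<in> generated \<Longrightarrow> swap_coords ** M \<in> generated"
| shear: "M \<in> generated \<Longrightarrow> shear k ** M \<in> generated"

lemma generated_cancel:
  "trans11 k ** M \<in> generated \<Longrightarrow> M \<in> generated"
  "trans12 k ** M \<in> generated \<Longrightarrow> M \<in> generated"
  "partial_inversion ** M \<in> generated \<Longrightarrow> M \<in> generated"
  "swap_coords ** M \<in> generated \<Longrightarrow> M \<in> generated"
  "shear k ** M \<in> generated \<Longrightarrow> M \<in> generated"
proof -
  have "trans11 (-k) ** (trans11 k ** M) = M" "trans12 (-k) ** (trans12 k ** M) = M"
    "partial_inversion ** (partial_inversion ** (partial_inversion ** (partial_inversion ** M))) = M"
    "swap_coords ** (swap_coords ** M) = M" "shear (-k) ** (shear k ** M) = M"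
    by (simp_all add: vec_eq_iff forall_2_2)
  then show
    "trans11 k ** M \<in> generated \<Longrightarrow> M \<in> generated"
    "trans12 k ** M \<in> generated \<Longrightarrow> M \<in> generated"
    "partial_inversion ** M \<in> generated \<Longrightarrow> M \<in> generated"
    "swap_coords ** M \<in> generated \<Longrightarrow> M \<in> generated"
    "shear k ** M \<in> generated \<Longrightarrow> M \<in> generated"
    by (metis generated.trans11, metis generated.trans12, metis generated.partial_inversion,
        metis generated.swap_coords, metis generated.shear)
qed

text \<open>Translation and inversion in the second variable are conjugates, under the exchange of the variables, of
those in the first one.\<close>

definition trans22 :: "int \<Rightarrow> mat4 \<Rightarrow> mat4" where
  "trans22 k M = swap_coords ** (trans11 k ** (swap_coords ** M))"
definition partial_inversion2 :: "mat4 \<Rightarrow> mat4" where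
  "partial_inversion2 M = swap_coords ** (partial_inversion ** (swap_coords ** M))"

lemma trans22_rows [simp]:
  "trans22 k M $ Inl 1 $ j = M $ Inl 1 $ j" "trans22 k M $ Inl 2 $ j = M $ Inl 2 $ j + k * M $ Inr 2 $ j"
  "trans22 k M $ Inr 1 $ j = M $ Inr 1 $ j" "trans22 k M $ Inr 2 $ j = M $ Inr 2 $ j"
  "partial_inversion2 M $ Inl 1 $ j = M $ Inl 1 $ j" "partial_inversion2 M $ Inl 2 $ j = - M $ Inr 2 $ j"
  "partial_inversion2 M $ Inr 1 $ j = M $ Inr 1 $ j" "partial_inversion2 M $ Inr 2 $ j = M $ Inl 2 $ j"
  by (simp_all add: trans22_def partial_inversion2_def)

lemma trans22_pairing [simp]:
  "col_pairing (trans22 k M) i j = col_pairing M i j"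
  "col_pairing (partial_inversion2 M) i j = col_pairing M i j"
  by (simp_all add: trans22_def partial_inversion2_def)

lemma generated_cancel2:
  "trans22 k M \<in> generated \<Longrightarrow> M \<in> generated" "partial_inversion2 M \<in> generated \<Longrightarrow> M \<in> generated"
  unfolding trans22_def partial_inversion2_def by (blast dest: generated_cancel)+

lemma in_Gamma2_generators [simp]:
  "trans11 k ** M \<in> carrier Gamma2 \<longleftrightarrow> M \<in> carrier Gamma2"
  "trans12 k ** M \<in> carrier Gamma2 \<longleftrightarrow> M \<in> carrier Gamma2"
  "partial_inversion ** M \<in> carrier Gamma2 \<longleftrightarrow> M \<in> carrier Gamma2"
  "swap_coords ** M \<in> carrier Gamma2 \<longleftrightarrow> M \<in> carrier Gamma2"
  "shear k ** M \<in> carrier Gamma2 \<longleftrightarrow> M \<in> carrier Gamma2"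
  "trans22 k M \<in> carrier Gamma2 \<longleftrightarrow> M \<in> carrier Gamma2"
  "partial_inversion2 M \<in> carrier Gamma2 \<longleftrightarrow> M \<in> carrier Gamma2"
  by (simp_all add: in_Gamma2_iff)

lemma nat_abs_mod_less: "(y::int) \<noteq> 0 \<Longrightarrow> nat \<bar>x mod y\<bar> < nat \<bar>y\<bar>"
  using abs_mod_less[of y x] by linarith

lemma add_minus_div_mult: "(x::int) + - (x div y) * y = x mod y" "x - x div y * y = x mod y"
  by (simp_all add: minus_div_mult_eq_mod)

lemma generated_if_col1_col3_col2:
  assumes M: "M \<in> carrier Gamma2"
    and c: "M $ Inl 1 $ Inl 1 = 1" "M $ Inl 2 $ Inl 1 = 0" "M $ Inr 1 $ Inl 1 = 0" "M $ Inr 2 $ Inl 1 = 0"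
      "M $ Inl 1 $ Inr 1 = 0" "M $ Inl 2 $ Inr 1 = 0" "M $ Inr 1 $ Inr 1 = 1" "M $ Inr 2 $ Inr 1 = 0"
      "M $ Inl 1 $ Inl 2 = 0" "M $ Inl 2 $ Inl 2 = 1" "M $ Inr 1 $ Inl 2 = 0" "M $ Inr 2 $ Inl 2 = 0"
  shows "M \<in> generated"
proof (rule generated_cancel2(1))
  have "col_pairing M (Inl 1) (Inr 2) = 0" "col_pairing M (Inr 1) (Inr 2) = 0" "col_pairing M (Inl 2) (Inr 2) = 1"
    using M by (simp_all add: in_Gamma2_iff)
  then have "trans22 (- (M $ Inl 2 $ Inr 2)) M = mat 1"
    by (simp add: vec_eq_iff forall_2_2 c col_pairing_def mat_def)
  then show "trans22 (- (M $ Inl 2 $ Inr 2)) M \<in> generated" by (simp add: generated.one)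
qed

text \<open>The first and third column already being standard, the other two live in an \<open>SL(2, \<int>)\<close>, which the
Euclidean algorithm reduces.\<close>

lemma generated_if_col1_col3:
  assumes M: "M \<in> carrier Gamma2"
    and c: "M $ Inl 1 $ Inl 1 = 1" "M $ Inl 2 $ Inl 1 = 0" "M $ Inr 1 $ Inl 1 = 0" "M $ Inr 2 $ Inl 1 = 0"
      "M $ Inl 1 $ Inr 1 = 0" "M $ Inl 2 $ Inr 1 = 0" "M $ Inr 1 $ Inr 1 = 1" "M $ Inr 2 $ Inr 1 = 0"
  shows "M \<in> generated"
  using assms
proof (induction "nat \<bar>M $ Inr 2 $ Inl 2\<bar>" arbitrary: M rule: less_induct)
  case less
  have p: "col_pairing M (Inl 1) (Inl 2) = 0" "col_pairing M (Inr 1) (Inl 2) = 0" "col_pairing M (Inl 2) (Inr 2) = 1"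
    using less.prems by (simp_all add: in_Gamma2_iff)
  show ?case
  proof (cases "M $ Inr 2 $ Inl 2 = 0")
    case True
    with p less.prems have c2: "M $ Inr 1 $ Inl 2 = 0" "M $ Inl 1 $ Inl 2 = 0" "M $ Inl 2 $ Inl 2 * M $ Inr 2 $ Inr 2 = 1"
      by (simp_all add: col_pairing_def)
    then consider "M $ Inl 2 $ Inl 2 = 1" | "M $ Inl 2 $ Inl 2 = -1"
      by (auto simp: zmult_eq_1_iff)
    then show ?thesis
    proof cases
      case 1
      then show ?thesis using generated_if_col1_col3_col2[of M] less.prems True c2 by simp
    next
      case 2
      have "partial_inversion2 (partial_inversion2 M) \<in> generated"
        by (rule generated_if_col1_col3_col2) (use less.prems True c2 2 in simp_all)
      then show ?thesis using generated_cancel2(2) by blast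
    qed
  next
    case False
    have "partial_inversion2 (trans22 (- (M $ Inl 2 $ Inl 2 div M $ Inr 2 $ Inl 2)) M) \<in> generated"
      by (rule less.hyps) (use less.prems nat_abs_mod_less[OF False] in \<open>simp_all add: add_minus_div_mult\<close>)
    then show ?thesis using generated_cancel2 by blast
  qed
qed

text \<open>The third column pairs to 1 with the first one, so its third entry is 1. This entry clears the others
by a shear and two translations, none of which moves the first column.\<close>

lemma generated_if_col1:
  assumes M: "M \<in> carrier Gamma2"
    and c: "M $ Inl 1 $ Inl 1 = 1" "M $ Inl 2 $ Inl 1 = 0" "M $ Inr 1 $ Inl 1 = 0" "M $ Inr 2 $ Inl 1 = 0"
  shows "M \<in> generated"
proof -
  have "col_pairing M (Inl 1) (Inr 1) = 1" using M by (simp add: in_Gamma2_iff)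
  then have w: "M $ Inr 1 $ Inr 1 = 1" using c by (simp add: col_pairing_def)
  define M1 where "M1 = shear (M $ Inr 2 $ Inr 1) ** M"
  define M2 where "M2 = trans12 (- (M1 $ Inl 2 $ Inr 1)) ** M1"
  have M1: "M1 \<in> carrier Gamma2" "M1 $ Inl 1 $ Inl 1 = 1" "M1 $ Inl 2 $ Inl 1 = 0" "M1 $ Inr 1 $ Inl 1 = 0" "M1 $ Inr 2 $ Inl 1 = 0"
    "M1 $ Inr 1 $ Inr 1 = 1" "M1 $ Inr 2 $ Inr 1 = 0"
    using M c w by (simp_all add: M1_def)
  have M2: "M2 \<in> carrier Gamma2" "M2 $ Inl 1 $ Inl 1 = 1" "M2 $ Inl 2 $ Inl 1 = 0" "M2 $ Inr 1 $ Inl 1 = 0" "M2 $ Inr 2 $ Inl 1 = 0"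
    "M2 $ Inl 2 $ Inr 1 = 0" "M2 $ Inr 1 $ Inr 1 = 1" "M2 $ Inr 2 $ Inr 1 = 0"
    using M1 by (simp_all add: M2_def)
  have "trans11 (- (M2 $ Inl 1 $ Inr 1)) ** M2 \<in> generated"
    by (rule generated_if_col1_col3) (use M2 in simp_all)
  then show ?thesis unfolding M2_def M1_def using generated_cancel by blast
qed

text \<open>The first column is primitive because it pairs to 1 with the third one. The Euclidean algorithm on its
two upper entries therefore ends with a unit.\<close>

lemma generated_if_col1_upper:
  assumes M: "M \<in> carrier Gamma2" and c: "M $ Inr 1 $ Inl 1 = 0" "M $ Inr 2 $ Inl 1 = 0"
  shows "M \<in> generated"
  using assms
proof (induction "nat \<bar>M $ Inl 2 $ Inl 1\<bar>" arbitrary: M rule: less_induct)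
  case less
  show ?case
  proof (cases "M $ Inl 2 $ Inl 1 = 0")
    case True
    have "col_pairing M (Inl 1) (Inr 1) = 1" using less.prems by (simp add: in_Gamma2_iff)
    then consider "M $ Inl 1 $ Inl 1 = 1" | "M $ Inl 1 $ Inl 1 = -1"
      using less.prems True by (auto simp: zmult_eq_1_iff col_pairing_def)
    then show ?thesis
    proof cases
      case 1
      then show ?thesis using generated_if_col1[of M] less.prems True by simp
    next
      case 2
      \<comment> \<open>The square of the partial inversion is \<open>-1\<close> on the first conjugate pair.\<close>
      have "partial_inversion ** (partial_inversion ** M) \<in> generated"
        by (rule generated_if_col1) (use less.prems True 2 in simp_all)
      then show ?thesis using generated_cancel(3) by blast
    qed
  next
    case False
    have "swap_coords ** (shear (- (M $ Inl 1 $ Inl 1 div M $ Inl 2 $ Inl 1)) ** M) \<in> generated"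
      by (rule less.hyps) (use less.prems nat_abs_mod_less[OF False] in \<open>simp_all add: add_minus_div_mult\<close>)
    then show ?thesis using generated_cancel by blast
  qed
qed

lemma generated_if_col1_third_zero:
  assumes M: "M \<in> carrier Gamma2" and c: "M $ Inr 1 $ Inl 1 = 0"
  shows "M \<in> generated"
  using assms
proof (induction "nat \<bar>M $ Inr 2 $ Inl 1\<bar>" arbitrary: M rule: less_induct)
  case less
  show ?case
  proof (cases "M $ Inr 2 $ Inl 1 = 0")
    case True
    then show ?thesis using generated_if_col1_upper less.prems by blast
  next
    case False
    have "partial_inversion2 (trans22 (- (M $ Inl 2 $ Inl 1 div M $ Inr 2 $ Inl 1)) M) \<in> generated"
      by (rule less.hyps) (use less.prems nat_abs_mod_less[OF False] in \<open>simp_all add: add_minus_div_mult\<close>)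
    then show ?thesis using generated_cancel2 by blast
  qed
qed

text \<open>Column reduction. The Euclidean algorithm in the first conjugate pair of entries makes the third entry
of the first column zero, the second pair is treated in the same way, and the lemmas above finish.\<close>

theorem Gamma2_generated:
  assumes "M \<in> carrier Gamma2"
  shows "M \<in> generated"
  using assms
proof (induction "nat \<bar>M $ Inr 1 $ Inl 1\<bar>" arbitrary: M rule: less_induct)
  case less
  show ?case
  proof (cases "M $ Inr 1 $ Inl 1 = 0")
    case True
    then show ?thesis using generated_if_col1_third_zero less.prems by blast
  next
    case False
    have "partial_inversion ** (trans11 (- (M $ Inl 1 $ Inl 1 div M $ Inr 1 $ Inl 1)) ** M) \<in> generated"
      by (rule less.hyps) (use less.prems nat_abs_mod_less[OF False] in \<open>simp_all add: add_minus_div_mult\<close>)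
    then show ?thesis using generated_cancel by blast
  qed
qed


section \<open>Inverses and cosets in the symplectic group\<close>

lemma map_matrix_mult: "map_matrix of_int (A ** B) = (map_matrix of_int A ** map_matrix of_int B :: 'a::comm_ring_1^'n^'m)"
  by (simp add: vec_eq_iff matrix_matrix_mult_def)

lemma matrix_add_rdistrib: "(A + B) ** C = A ** C + B ** C" for A :: "'a::semiring_1^'n^'m"
  by (simp add: vec_eq_iff matrix_matrix_mult_def sum.distrib distrib_right)

lemma block_mult:
  "block_a (G ** M) = block_a G ** block_a M + block_b G ** block_c M"
  "block_b (G ** M) = block_a G ** block_b M + block_b G ** block_d M"
  "block_c (G ** M) = block_c G ** block_a M + block_d G ** block_c M"
  "block_d (G ** M) = block_c G ** block_b M + block_d G ** block_d M"
  by (simp_all add: mat2_eq_iff block_a_def block_b_def block_c_def block_d_def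
      matrix_matrix_mult_def sum_UNIV_2_2 sum_2)

text \<open>Over the integers the statement is inherited from the real numbers.\<close>

lemma int_matrix_right_inverse:
  fixes A B :: "int^'n^'n"
  assumes "A ** B = mat 1"
  shows "B ** A = mat 1"
proof -
  let ?r = "map_matrix of_int :: int^'n^'n \<Rightarrow> real^'n^'n"
  have one: "?r (mat 1) = mat 1" by (simp add: vec_eq_iff mat_def)
  have "?r A ** ?r B = mat 1" using assms one by (metis map_matrix_mult)
  then have "?r B ** ?r A = mat 1" using matrix_left_right_inverse by blast
  then have "?r (B ** A) = ?r (mat 1)" using one by (simp add: map_matrix_mult)
  then show ?thesis by (simp add: vec_eq_iff)
qed

text \<open>The defining equation, solved for the inverse. The block formula shows that congruence of the lower left
block to zero modulo 2 is preserved.\<close>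

definition symplectic_inverse :: "mat4 \<Rightarrow> mat4" where
  "symplectic_inverse M = (- symplectic_J) ** (transpose M ** symplectic_J)"

lemma symplectic_J_square: "(- symplectic_J) ** symplectic_J = mat 1"
  unfolding vec_eq_iff forall_2_2 by (simp add: matrix_matrix_mult_def sum_UNIV_2_2 mat_def)

lemma symplectic_inverse:
  assumes "M \<in> carrier Gamma2"
  shows "symplectic_inverse M ** M = mat 1" "M ** symplectic_inverse M = mat 1"
    "symplectic_inverse M \<in> carrier Gamma2"
proof -
  have M: "transpose M ** symplectic_J ** M = symplectic_J" using assms by (simp add: Gamma2_def)
  show 1: "symplectic_inverse M ** M = mat 1"
    unfolding symplectic_inverse_def matrix_mul_assoc[symmetric]
    using M symplectic_J_square by (simp add: matrix_mul_assoc)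
  show 2: "M ** symplectic_inverse M = mat 1" by (rule int_matrix_right_inverse[OF 1])
  let ?S = "symplectic_inverse M"
  have "transpose ?S ** symplectic_J ** ?S = transpose ?S ** (transpose M ** symplectic_J ** M) ** ?S" by (simp only: M)
  also have "\<dots> = transpose (M ** ?S) ** symplectic_J ** (M ** ?S)"
    by (simp only: matrix_transpose_mul matrix_mul_assoc)
  also have "\<dots> = symplectic_J" by (simp add: 2 transpose_mat)
  finally show "?S \<in> carrier Gamma2" by (simp add: Gamma2_def)
qed

lemma Gamma2_mult_closed: "A \<in> carrier Gamma2 \<Longrightarrow> B \<in> carrier Gamma2 \<Longrightarrow> A ** B \<in> carrier Gamma2"
proof -
  assume A: "A \<in> carrier Gamma2" and B: "B \<in> carrier Gamma2"
  have "transpose (A ** B) ** symplectic_J ** (A ** B) = transpose B ** (transpose A ** symplectic_J ** A) ** B"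
    by (simp only: matrix_transpose_mul matrix_mul_assoc)
  then show ?thesis using A B by (simp add: Gamma2_def)
qed

lemma Gamma20_2_mult_closed: "A \<in> Gamma20_2 \<Longrightarrow> B \<in> Gamma20_2 \<Longrightarrow> A ** B \<in> Gamma20_2"
  unfolding Gamma20_2_def mem_Collect_eq block_mult
  by (simp add: Gamma2_mult_closed matrix_matrix_mult_def[of "block_c _"] matrix_matrix_mult_def[of "block_d _"] sum_2)

lemma symplectic_inverse_Gamma20_2: "A \<in> Gamma20_2 \<Longrightarrow> symplectic_inverse A \<in> Gamma20_2"
proof -
  assume A: "A \<in> Gamma20_2"
  have "symplectic_inverse A $ Inr i $ Inl j = - A $ Inr j $ Inl i" for i j
  proof -
    have "(\<forall>i j. symplectic_inverse A $ Inr i $ Inl j = - A $ Inr j $ Inl i)"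
      unfolding forall_2 by (simp add: symplectic_inverse_def matrix_matrix_mult_def sum_UNIV_2_2 transpose_def)
    then show ?thesis by blast
  qed
  then show ?thesis using A symplectic_inverse(3)[of A] by (simp add: Gamma20_2_def block_c_def)
qed

lemma rcos_eqI:
  assumes a: "a \<in> carrier Gamma2" and b: "b \<in> carrier Gamma2"
    and "a ** symplectic_inverse b \<in> Gamma20_2"
  shows "Gamma20_2 #>\<^bsub>Gamma2\<^esub> a = Gamma20_2 #>\<^bsub>Gamma2\<^esub> b"
proof -
  have m: "x \<otimes>\<^bsub>Gamma2\<^esub> y = x ** y" for x y by (simp add: Gamma2_def)
  obtain h where h: "h \<in> Gamma20_2" and ab: "a = h ** b"
  proof
    show "a = a ** symplectic_inverse b ** b"
      using symplectic_inverse(1)[OF b] by (simp add: matrix_mul_assoc[symmetric])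
  qed (rule assms(3))
  have ba: "b = symplectic_inverse h ** a"
    using h symplectic_inverse(1)[of h] unfolding ab Gamma20_2_def by (simp add: matrix_mul_assoc)
  have "\<exists>k'\<in>Gamma20_2. k ** a = k' ** b" if "k \<in> Gamma20_2" for k
    unfolding ab matrix_mul_assoc using Gamma20_2_mult_closed[OF that h] by blast
  moreover have "\<exists>k'\<in>Gamma20_2. k ** b = k' ** a" if "k \<in> Gamma20_2" for k
    by (subst ba) (use Gamma20_2_mult_closed[OF that symplectic_inverse_Gamma20_2[OF h]] in \<open>auto simp: matrix_mul_assoc\<close>)
  ultimately show ?thesis unfolding r_coset_def m by blast
qed


section \<open>The Siegel upper half-plane in coordinates\<close>

definition sym_mat :: "complex \<Rightarrow> complex \<Rightarrow> complex \<Rightarrow> complex^2^2" where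
  "sym_mat t1 t2 t3 = mat2 t1 t2 t2 t3"

lemma mat2_mult: "mat2 a b c d ** mat2 x y z w =
    mat2 (a * x + b * z) (a * y + b * w) (c * x + d * z) (c * y + d * w)"
  for a :: "'a::comm_semiring_1"
  by (simp add: mat2_eq_iff matrix_matrix_mult_def sum_2)

lemma mat2_add: "mat2 a b c d + mat2 x y z w = mat2 (a + x) (b + y) (c + z) (d + w)"
  for a :: "'a::comm_semiring_1"
  by (simp add: mat2_eq_iff)

lemma map_matrix_mat2: "map_matrix f (mat2 a b c d) = mat2 (f a) (f b) (f c) (f d)"
  by (simp add: mat2_eq_iff)

lemma mat_1_mat2: "mat 1 = (mat2 1 0 0 1 :: 'a::comm_semiring_1^2^2)"
  by (simp add: mat2_eq_iff mat_def)

lemma det_mat2: "det (mat2 a b c d) = a * d - b * c" for a :: complex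
  by (simp add: det_2)

lemma matrix_inv_unique:
  fixes A B :: "'a::semiring_1^'n^'n"
  assumes "A ** B = mat 1" "B ** A = mat 1"
  shows "matrix_inv A = B"
proof -
  have "A ** matrix_inv A = mat 1 \<and> matrix_inv A ** A = mat 1"
    unfolding matrix_inv_def by (rule someI[of _ B]) (use assms in simp)
  then show ?thesis
    by (metis assms(1) matrix_mul_assoc matrix_mul_lid matrix_mul_rid)
qed

lemma matrix_inv_mult_cancel:
  fixes A :: "complex^'n^'n"
  assumes "det A \<noteq> 0"
  shows "A ** matrix_inv A = mat 1" "matrix_inv A ** A = mat 1"
proof -
  have "\<exists>B. A ** B = mat 1 \<and> B ** A = mat 1"
    using assms by (simp add: invertible_det_nz[symmetric] invertible_def)
  then have "A ** matrix_inv A = mat 1 \<and> matrix_inv A ** A = mat 1"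
    unfolding matrix_inv_def by (rule someI_ex)
  then show "A ** matrix_inv A = mat 1" "matrix_inv A ** A = mat 1" by auto
qed

lemma matrix_inv_mat2:
  fixes a :: complex
  assumes "a * d - b * c \<noteq> 0"
  shows "matrix_inv (mat2 a b c d) = mat2 (d / (a * d - b * c)) (- b / (a * d - b * c)) (- c / (a * d - b * c)) (a / (a * d - b * c))"
  by (rule matrix_inv_unique; unfold mat2_mult mat_1_mat2 mat2_eq_iff)
     (use assms in \<open>simp_all add: diff_divide_distrib[symmetric] add_divide_distrib[symmetric] mult_ac\<close>)

lemma siegel_H2_iff:
  "\<tau> \<in> siegel_H2 \<longleftrightarrow> \<tau> $ 2 $ 1 = \<tau> $ 1 $ 2 \<and> 0 < Im (\<tau> $ 1 $ 1) \<and>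
     (Im (\<tau> $ 1 $ 2))\<^sup>2 < Im (\<tau> $ 1 $ 1) * Im (\<tau> $ 2 $ 2)"
proof -
  let ?a = "Im (\<tau> $ 1 $ 1)" and ?b = "Im (\<tau> $ 1 $ 2)" and ?d = "Im (\<tau> $ 2 $ 2)"
  have tr: "transpose \<tau> = \<tau> \<longleftrightarrow> \<tau> $ 2 $ 1 = \<tau> $ 1 $ 2"
    by (auto simp: mat2_eq_iff transpose_def)
  have q: "x \<bullet> (map_matrix Im \<tau> *v x) = ?a * (x $ 1)\<^sup>2 + 2 * ?b * (x $ 1) * (x $ 2) + ?d * (x $ 2)\<^sup>2"
    if "\<tau> $ 2 $ 1 = \<tau> $ 1 $ 2" for x :: "real^2"
    using that by (simp add: inner_vec_def matrix_vector_mult_def sum_2 power2_eq_square algebra_simps)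
  have "(\<forall>x::real^2. x \<noteq> 0 \<longrightarrow> x \<bullet> (map_matrix Im \<tau> *v x) > 0) \<longleftrightarrow> 0 < ?a \<and> ?b\<^sup>2 < ?a * ?d"
    if s: "\<tau> $ 2 $ 1 = \<tau> $ 1 $ 2"
  proof
    assume pd: "\<forall>x::real^2. x \<noteq> 0 \<longrightarrow> x \<bullet> (map_matrix Im \<tau> *v x) > 0"
    have a: "?a > 0"
      using pd[rule_format, of "vector [1, 0]"] q[OF s, of "vector [1, 0]"] by (auto simp: vec_eq_iff forall_2)
    have "vector [- ?b, ?a] \<noteq> (0 :: real^2)" using a by (auto simp: vec_eq_iff forall_2)
    with pd have "0 < ?a * (- ?b)\<^sup>2 + 2 * ?b * (- ?b) * ?a + ?d * ?a\<^sup>2"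
      using q[OF s, of "vector [- ?b, ?a]"] by fastforce
    also have "\<dots> = ?a * (?a * ?d - ?b\<^sup>2)" by (simp add: power2_eq_square algebra_simps)
    finally show "0 < ?a \<and> ?b\<^sup>2 < ?a * ?d" using a by (simp add: zero_less_mult_iff)
  next
    assume p: "0 < ?a \<and> ?b\<^sup>2 < ?a * ?d"
    show "\<forall>x::real^2. x \<noteq> 0 \<longrightarrow> x \<bullet> (map_matrix Im \<tau> *v x) > 0"
    proof (intro allI impI)
      fix x :: "real^2" assume x: "x \<noteq> 0"
      have "?a * (?a * (x $ 1)\<^sup>2 + 2 * ?b * (x $ 1) * (x $ 2) + ?d * (x $ 2)\<^sup>2) =
          (?a * x $ 1 + ?b * x $ 2)\<^sup>2 + (?a * ?d - ?b\<^sup>2) * (x $ 2)\<^sup>2"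
        by (simp add: power2_eq_square algebra_simps)
      also have "\<dots> > 0"
      proof (cases "x $ 2 = 0")
        case True
        then have "x $ 1 \<noteq> 0" using x by (auto simp: vec_eq_iff forall_2)
        then show ?thesis using True p by simp
      next
        case False
        then show ?thesis using p by (intro add_nonneg_pos) auto
      qed
      finally show "x \<bullet> (map_matrix Im \<tau> *v x) > 0" using p q[OF s] by (simp add: zero_less_mult_iff)
    qed
  qed
  then show ?thesis unfolding siegel_H2_def using tr by auto
qed

lemma sym_mat_in_H2_iff: "sym_mat t1 t2 t3 \<in> siegel_H2 \<longleftrightarrow> 0 < Im t1 \<and> (Im t2)\<^sup>2 < Im t1 * Im t3"
  by (simp add: siegel_H2_iff sym_mat_def)

lemma siegel_H2_cases:
  assumes "\<tau> \<in> siegel_H2"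
  obtains t1 t2 t3 where "\<tau> = sym_mat t1 t2 t3" "0 < Im t1" "(Im t2)\<^sup>2 < Im t1 * Im t3"
proof -
  have "\<tau> = sym_mat (\<tau> $ 1 $ 1) (\<tau> $ 1 $ 2) (\<tau> $ 2 $ 2)"
    using assms by (simp add: siegel_H2_iff sym_mat_def mat2_eq_iff)
  then show ?thesis using assms that by (simp add: siegel_H2_iff)
qed

lemma map_matrix_add: "map_matrix of_int (A + B) = (map_matrix of_int A + map_matrix of_int B :: 'a::comm_ring_1^'n^'m)"
  by (simp add: vec_eq_iff)

text \<open>The numerator \<open>a\<tau> + b\<close> of the fractional linear action; \<open>cfactor\<close> is the denominator.\<close>

definition numerator :: "mat4 \<Rightarrow> complex^2^2 \<Rightarrow> complex^2^2" where
  "numerator \<gamma> \<tau> = map_matrix of_int (block_a \<gamma>) ** \<tau> + map_matrix of_int (block_b \<gamma>)"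

lemma siegel_act_numerator: "siegel_act \<gamma> \<tau> = numerator \<gamma> \<tau> ** matrix_inv (cfactor \<gamma> \<tau>)"
  by (simp add: siegel_act_def numerator_def)

text \<open>The column with blocks \<open>a\<tau> + b\<close> and \<open>c\<tau> + d\<close> is multiplied by the matrix on the left. This gives both
the cocycle property of the denominator and the group action.\<close>

lemma numerator_cfactor_mult:
  assumes "det (cfactor M \<tau>) \<noteq> 0"
  shows "numerator (G ** M) \<tau> = numerator G (siegel_act M \<tau>) ** cfactor M \<tau>"
    and "cfactor (G ** M) \<tau> = cfactor G (siegel_act M \<tau>) ** cfactor M \<tau>"
proof -
  have s: "siegel_act M \<tau> ** cfactor M \<tau> = numerator M \<tau>"
    using matrix_inv_mult_cancel(2)[OF assms] by (simp add: siegel_act_numerator matrix_mul_assoc[symmetric])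
  show "numerator (G ** M) \<tau> = numerator G (siegel_act M \<tau>) ** cfactor M \<tau>"
    unfolding numerator_def[of "G ** M"] numerator_def[of G] matrix_add_rdistrib matrix_mul_assoc[symmetric] s
    by (simp add: block_mult map_matrix_mult map_matrix_add matrix_add_rdistrib matrix_add_ldistrib numerator_def cfactor_def matrix_mul_assoc)
  show "cfactor (G ** M) \<tau> = cfactor G (siegel_act M \<tau>) ** cfactor M \<tau>"
    unfolding cfactor_def[of "G ** M"] cfactor_def[of G] matrix_add_rdistrib matrix_mul_assoc[symmetric] s
    by (simp add: block_mult map_matrix_mult map_matrix_add matrix_add_rdistrib matrix_add_ldistrib numerator_def cfactor_def matrix_mul_assoc)
qed

lemma siegel_act_mult:
  assumes M: "det (cfactor M \<tau>) \<noteq> 0" and G: "det (cfactor G (siegel_act M \<tau>)) \<noteq> 0"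
  shows "siegel_act (G ** M) \<tau> = siegel_act G (siegel_act M \<tau>)"
proof -
  let ?X = "cfactor G (siegel_act M \<tau>)" and ?C = "cfactor M \<tau>"
  have "matrix_inv (?X ** ?C) = matrix_inv ?C ** matrix_inv ?X"
  proof (rule matrix_inv_unique)
    have "?X ** ?C ** (matrix_inv ?C ** matrix_inv ?X) = ?X ** (?C ** matrix_inv ?C) ** matrix_inv ?X"
      by (simp only: matrix_mul_assoc)
    then show "?X ** ?C ** (matrix_inv ?C ** matrix_inv ?X) = mat 1"
      using matrix_inv_mult_cancel[OF M] matrix_inv_mult_cancel[OF G] by simp
    have "matrix_inv ?C ** matrix_inv ?X ** (?X ** ?C) = matrix_inv ?C ** (matrix_inv ?X ** ?X) ** ?C"
      by (simp only: matrix_mul_assoc)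
    then show "matrix_inv ?C ** matrix_inv ?X ** (?X ** ?C) = mat 1"
      using matrix_inv_mult_cancel[OF M] matrix_inv_mult_cancel[OF G] by simp
  qed
  then have "siegel_act (G ** M) \<tau> = numerator G (siegel_act M \<tau>) ** (?C ** matrix_inv ?C) ** matrix_inv ?X"
    by (simp add: siegel_act_numerator[of "G ** M"] numerator_cfactor_mult[OF M] matrix_mul_assoc)
  then show ?thesis using matrix_inv_mult_cancel[OF M] by (simp add: siegel_act_numerator[of G])
qed

lemma cfactor_generators:
  "cfactor (trans11 k) \<tau> = mat 1" "cfactor (trans12 k) \<tau> = mat 1"
  "cfactor (partial_inversion) (sym_mat t1 t2 t3) = mat2 t1 t2 0 1"
  "cfactor swap_coords \<tau> = mat2 0 1 1 0" "cfactor (shear k) \<tau> = mat2 1 0 (- of_int k) 1"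
  by (simp_all add: cfactor_def generator_defs map_matrix_mat2 mat_1_mat2 sym_mat_def mat2_mult mat2_add
      mat2_eq_iff matrix_matrix_mult_def sum_2)

lemma det_cfactor_generators:
  "det (cfactor (trans11 k) \<tau>) = 1" "det (cfactor (trans12 k) \<tau>) = 1"
  "det (cfactor (partial_inversion) (sym_mat t1 t2 t3)) = t1"
  "det (cfactor swap_coords \<tau>) = -1" "det (cfactor (shear k) \<tau>) = 1"
  by (simp_all add: cfactor_generators det_mat2)

lemma siegel_act_generators:
  "siegel_act (trans11 k) (sym_mat t1 t2 t3) = sym_mat (t1 + of_int k) t2 t3"
  "siegel_act (trans12 k) (sym_mat t1 t2 t3) = sym_mat t1 (t2 + of_int k) t3"
  "t1 \<noteq> 0 \<Longrightarrow> siegel_act partial_inversion (sym_mat t1 t2 t3) = sym_mat (- 1 / t1) (t2 / t1) (t3 - t2\<^sup>2 / t1)"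
  "siegel_act swap_coords (sym_mat t1 t2 t3) = sym_mat t3 t2 t1"
  "siegel_act (shear k) (sym_mat t1 t2 t3) = sym_mat (t1 + 2 * of_int k * t2 + (of_int k)\<^sup>2 * t3) (t2 + of_int k * t3) t3"
proof -
  have i1: "matrix_inv (mat 1) = (mat 1 :: complex^2^2)" by (rule matrix_inv_unique) auto
  show "siegel_act (trans11 k) (sym_mat t1 t2 t3) = sym_mat (t1 + of_int k) t2 t3"
    "siegel_act (trans12 k) (sym_mat t1 t2 t3) = sym_mat t1 (t2 + of_int k) t3"
    unfolding siegel_act_numerator cfactor_generators i1
    by (simp_all add: numerator_def generator_defs map_matrix_mat2 sym_mat_def mat2_mult mat2_add)
  show "t1 \<noteq> 0 \<Longrightarrow> siegel_act partial_inversion (sym_mat t1 t2 t3) = sym_mat (- 1 / t1) (t2 / t1) (t3 - t2\<^sup>2 / t1)"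
    by (simp add: siegel_act_numerator cfactor_generators matrix_inv_mat2)
       (simp add: numerator_def generator_defs map_matrix_mat2 sym_mat_def mat2_mult mat2_add mat2_eq_iff power2_eq_square)
  show "siegel_act swap_coords (sym_mat t1 t2 t3) = sym_mat t3 t2 t1"
  "siegel_act (shear k) (sym_mat t1 t2 t3) = sym_mat (t1 + 2 * of_int k * t2 + (of_int k)\<^sup>2 * t3) (t2 + of_int k * t3) t3"
    unfolding siegel_act_numerator cfactor_generators
    by (simp_all add: matrix_inv_mat2)
       (simp_all add: numerator_def generator_defs map_matrix_mat2 sym_mat_def mat2_mult mat2_add mat2_eq_iff power2_eq_square algebra_simps)
qed

text \<open>For the partial inversion, clear the common factor \<open>N = |t1|\<^sup>2\<close> from the imaginary parts; the determinant
of the imaginary part is then divided by exactly \<open>N\<close>.\<close>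

lemma siegel_act_generators_in_H2:
  assumes t: "sym_mat t1 t2 t3 \<in> siegel_H2"
  shows "siegel_act (trans11 k) (sym_mat t1 t2 t3) \<in> siegel_H2"
    "siegel_act (trans12 k) (sym_mat t1 t2 t3) \<in> siegel_H2"
    "siegel_act partial_inversion (sym_mat t1 t2 t3) \<in> siegel_H2"
    "siegel_act swap_coords (sym_mat t1 t2 t3) \<in> siegel_H2"
    "siegel_act (shear k) (sym_mat t1 t2 t3) \<in> siegel_H2"
proof -
  have p: "0 < Im t1" "(Im t2)\<^sup>2 < Im t1 * Im t3" using t by (simp_all add: sym_mat_in_H2_iff)
  have p3: "0 < Im t3"
  proof -
    have "0 < Im t1 * Im t3" using p(2) zero_le_power2[of "Im t2"] by linarith
    then show ?thesis using p(1) by (simp add: zero_less_mult_iff)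
  qed
  have t1: "t1 \<noteq> 0" using p(1) by auto
  show "siegel_act (trans11 k) (sym_mat t1 t2 t3) \<in> siegel_H2"
    "siegel_act (trans12 k) (sym_mat t1 t2 t3) \<in> siegel_H2"
    "siegel_act swap_coords (sym_mat t1 t2 t3) \<in> siegel_H2"
    using p p3 by (simp_all add: siegel_act_generators sym_mat_in_H2_iff mult.commute)
  show "siegel_act (shear k) (sym_mat t1 t2 t3) \<in> siegel_H2"
  proof -
    let ?k = "real_of_int k"
    let ?q = "Im t1 + 2 * ?k * Im t2 + ?k\<^sup>2 * Im t3"
    have det: "?q * Im t3 - (Im t2 + ?k * Im t3)\<^sup>2 = Im t1 * Im t3 - (Im t2)\<^sup>2"
      by (simp add: power2_eq_square algebra_simps)
    then have "0 < ?q * Im t3" using p(2) zero_le_power2[of "Im t2 + ?k * Im t3"] by linarith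
    then have "0 < ?q" using p3 by (simp add: zero_less_mult_iff)
    moreover have "Im (t1 + 2 * of_int k * t2 + (of_int k)\<^sup>2 * t3) = ?q" "Im (t2 + of_int k * t3) = Im t2 + ?k * Im t3"
      by (simp_all add: power2_eq_square)
    ultimately show ?thesis using det p(2) unfolding siegel_act_generators sym_mat_in_H2_iff by simp
  qed
  show "siegel_act partial_inversion (sym_mat t1 t2 t3) \<in> siegel_H2"
  proof -
    obtain x1 y1 where e1: "t1 = Complex x1 y1" by (cases t1)
    obtain x2 y2 where e2: "t2 = Complex x2 y2" by (cases t2)
    obtain x3 y3 where e3: "t3 = Complex x3 y3" by (cases t3)
    define N where "N = x1\<^sup>2 + y1\<^sup>2"
    have N: "N > 0" using p(1) e1 by (simp add: N_def add_nonneg_pos)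
    have i1: "Im (- 1 / t1) = y1 / N" by (simp add: e1 Im_divide N_def)
    have i2: "Im (t2 / t1) = (y2 * x1 - x2 * y1) / N" by (simp add: e1 e2 Im_divide N_def mult.commute)
    have i3: "Im (t3 - t2\<^sup>2 / t1) = y3 - (2 * x2 * y2 * x1 - (x2\<^sup>2 - y2\<^sup>2) * y1) / N"
      by (simp add: e1 e2 e3 Im_divide N_def power2_eq_square algebra_simps)
    have "N * (y1 * (N * y3 - (2 * x2 * y2 * x1 - (x2\<^sup>2 - y2\<^sup>2) * y1)) - (y2 * x1 - x2 * y1)\<^sup>2) = N * (N * (y1 * y3 - y2\<^sup>2))"
      by (simp add: N_def power2_eq_square algebra_simps)
    then have eq: "y1 * (N * y3 - (2 * x2 * y2 * x1 - (x2\<^sup>2 - y2\<^sup>2) * y1)) - (y2 * x1 - x2 * y1)\<^sup>2 = N * (y1 * y3 - y2\<^sup>2)"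
      using N by (metis mult_left_cancel less_irrefl)
    have "y1 / N * (y3 - (2 * x2 * y2 * x1 - (x2\<^sup>2 - y2\<^sup>2) * y1) / N) - ((y2 * x1 - x2 * y1) / N)\<^sup>2 =
        (y1 * (N * y3 - (2 * x2 * y2 * x1 - (x2\<^sup>2 - y2\<^sup>2) * y1)) - (y2 * x1 - x2 * y1)\<^sup>2) / N\<^sup>2"
      using N by (simp add: field_simps power2_eq_square)
    also have "\<dots> > 0" unfolding eq using N p(2) e1 e2 e3 by simp
    finally show ?thesis
      unfolding siegel_act_generators(3)[OF t1] sym_mat_in_H2_iff i1 i2 i3 using N p(1) e1 by simp
  qed
qed


section \<open>Theta constants as sums over classes modulo two\<close>

text \<open>The sign character of the field with two elements.\<close>

definition bit_sign :: "bit \<Rightarrow> complex" where "bit_sign b = (if b = 0 then 1 else -1)"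

lemma bit_sign_simps [simp]: "bit_sign 0 = 1" "bit_sign 1 = -1" by (simp_all add: bit_sign_def)

lemma bit_sign_add: "bit_sign (x + y) = bit_sign x * bit_sign y"
  by (cases x; cases y) simp_all

lemma of_int_bit: "(of_int k :: bit) = of_bool (odd k)"
proof (cases "even k")
  case True
  then obtain j where "k = j + j" by (metis evenE mult_2)
  then show ?thesis by simp
next
  case False
  then obtain j where "k = j + j + 1" by (metis oddE mult_2)
  then show ?thesis by simp
qed

lemma UNIV_bit: "(UNIV :: bit set) = {0, 1}"
  by (auto intro: bit.exhaust)

lemma bit2_exhaust: obtains x y where "(\<sigma>::bit^2) = vector [x, y]"
proof -
  have "\<sigma> = vector [\<sigma> $ 1, \<sigma> $ 2]" by (simp add: vec_eq_iff forall_2)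
  then show ?thesis using that by blast
qed

lemma bit2_eq_iff: "(\<sigma>::bit^2) = \<tau> \<longleftrightarrow> \<sigma> $ 1 = \<tau> $ 1 \<and> \<sigma> $ 2 = \<tau> $ 2"
  by (simp add: vec_eq_iff forall_2)

lemma sum_bit2: "(\<Sum>\<sigma>\<in>(UNIV :: (bit^2) set). f \<sigma>) =
    f (vector [0, 0]) + f (vector [0, 1]) + f (vector [1, 0]) + (f (vector [1, 1]) :: 'a::comm_monoid_add)"
proof -
  have v: "vector [\<sigma> $ 1, \<sigma> $ 2] = \<sigma>" for \<sigma> :: "bit^2" by (simp add: bit2_eq_iff)
  have "(\<Sum>\<sigma>\<in>(UNIV :: (bit^2) set). f \<sigma>) = (\<Sum>(x, y)\<in>(UNIV :: (bit \<times> bit) set). f (vector [x, y]))"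
    by (rule sum.reindex_bij_witness[of _ "\<lambda>(x, y). vector [x, y]" "\<lambda>\<sigma>. (\<sigma> $ 1, \<sigma> $ 2)"])
       (auto simp: v)
  also have "(UNIV :: (bit \<times> bit) set) = {(0, 0), (0, 1), (1, 0), (1, 1)}"
    unfolding UNIV_Times_UNIV[symmetric] UNIV_bit by auto
  finally show ?thesis by (simp add: add.assoc)
qed

definition parity_class :: "bit \<Rightarrow> int set" where "parity_class x = {k. of_int k = x}"

definition parity_lattice :: "bit^2 \<Rightarrow> (int \<times> int) set" where "parity_lattice \<sigma> = parity_class (\<sigma> $ 1) \<times> parity_class (\<sigma> $ 2)"

text \<open>The general term of a second order theta constant after the substitution \<open>p = 2n + \<sigma>\<close>. The
characteristic \<open>\<sigma>\<close> then only restricts \<open>p\<close> to a class modulo 2, which makes shears and swaps into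
substitutions of the summation index.\<close>

definition gauss_term :: "complex \<Rightarrow> complex \<Rightarrow> complex \<Rightarrow> int \<times> int \<Rightarrow> complex" where
  "gauss_term t1 t2 t3 p = exp (of_real pi * \<i> / 2 *
     (t1 * (of_int (fst p))\<^sup>2 + 2 * t2 * of_int (fst p) * of_int (snd p) + t3 * (of_int (snd p))\<^sup>2))"

lemma parity_class_iff: "k \<in> parity_class x \<longleftrightarrow> of_int k = x" by (simp add: parity_class_def)

lemma parity_class_double_add: "2 * n + of_bool (odd x) \<in> parity_class x"
  by (cases x) (simp_all add: parity_class_iff of_int_bit)

lemma parity_class_div: "k \<in> parity_class x \<Longrightarrow> 2 * (k div 2) + of_bool (odd x) = k"
  by (cases x) (auto simp: parity_class_iff of_int_bit split: if_splits elim!: evenE oddE)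

lemma theta_const_sym_mat:
  "theta_const m (sym_mat t1 t2 t3) = (\<Sum>\<^sub>\<infinity>p\<in>parity_lattice (fst m). gauss_term (t1 / 2) (t2 / 2) (t3 / 2) p *
     exp (of_real pi * \<i> / 2 * (of_int (fst p) * of_bool (odd (snd m $ 1)) + of_int (snd p) * of_bool (odd (snd m $ 2)))))"
  unfolding theta_const_def
proof (rule infsum_reindex_bij_witness[of _ "\<lambda>p. vector [fst p div 2, snd p div 2]"
      "\<lambda>n. (2 * n $ 1 + of_bool (odd (fst m $ 1)), 2 * n $ 2 + of_bool (odd (fst m $ 2)))"], goal_cases)
  case (1 n)
  show ?case by (simp add: vec_eq_iff forall_2)
next
  case (2 n)
  show ?case by (simp only: parity_lattice_def mem_Times_iff fst_conv snd_conv parity_class_double_add simp_thms)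
next
  case (3 p)
  then show ?case by (cases p) (simp only: parity_lattice_def mem_Times_iff fst_conv snd_conv vector_2 parity_class_div simp_thms)
next
  case (4 p) show ?case by simp
next
  case (5 n)
  show ?case
    by (simp only: Let_def scalar_product_def matrix_vector_mult_def sum_2 sym_mat_def mat2_nth vec_lambda_beta
        gauss_term_def fst_conv snd_conv of_int_add of_int_mult of_int_of_bool of_int_numeral exp_add[symmetric])
       (rule arg_cong[where f = exp], simp add: field_simps power2_eq_square)
qed

lemma second_order_theta_sym_mat:
  "second_order_theta \<sigma> (sym_mat t1 t2 t3) = (\<Sum>\<^sub>\<infinity>p\<in>parity_lattice \<sigma>. gauss_term t1 t2 t3 p)"
proof -
  have "2 *\<^sub>R sym_mat t1 t2 t3 = sym_mat (2 * t1) (2 * t2) (2 * t3)"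
    by (simp add: sym_mat_def mat2_eq_iff scaleR_conv_of_real)
  then show ?thesis by (simp add: second_order_theta_def theta_const_sym_mat)
qed

lemma norm_summable_product:
  fixes f :: "'a \<Rightarrow> complex" and g :: "'b \<Rightarrow> complex"
  assumes f: "(\<lambda>x. norm (f x)) summable_on A" and g: "(\<lambda>y. norm (g y)) summable_on B"
  shows "(\<lambda>p. norm (f (fst p) * g (snd p))) summable_on A \<times> B"
    and "(\<Sum>\<^sub>\<infinity>p\<in>A \<times> B. f (fst p) * g (snd p)) = infsum f A * infsum g B"
proof -
  show s: "(\<lambda>p. norm (f (fst p) * g (snd p))) summable_on A \<times> B"
  proof (subst Infinite_Sum.abs_summable_on_Sigma_iff, intro conjI ballI)
    show "(\<lambda>y. norm (f (fst (x, y)) * g (snd (x, y)))) summable_on B" for x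
      using summable_on_cmult_right[OF g, of "norm (f x)"] by (simp add: norm_mult)
    show "(\<lambda>x. norm (\<Sum>\<^sub>\<infinity>y\<in>B. norm (f (fst (x, y)) * g (snd (x, y))))) summable_on A"
      using summable_on_cmult_left[OF f, of "infsum (\<lambda>y. norm (g y)) B"]
      by (simp add: norm_mult infsum_cmult_right' abs_mult infsum_nonneg)
  qed
  have "(\<Sum>\<^sub>\<infinity>p\<in>A \<times> B. f (fst p) * g (snd p)) = (\<Sum>\<^sub>\<infinity>x\<in>A. \<Sum>\<^sub>\<infinity>y\<in>B. f x * g y)"
    using infsum_Sigma_banach[OF abs_summable_summable[OF s]] by simp
  then show "(\<Sum>\<^sub>\<infinity>p\<in>A \<times> B. f (fst p) * g (snd p)) = infsum f A * infsum g B"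
    by (simp add: infsum_cmult_right' infsum_cmult_left')
qed

text \<open>The determinant divided by the trace is a lower bound for the smaller eigenvalue.\<close>

lemma pos_def_lower_bound:
  fixes y1 y2 y3 u v :: real
  assumes "0 < y1" "y2\<^sup>2 < y1 * y3"
  obtains c where "c > 0" "\<And>u v. c * (u\<^sup>2 + v\<^sup>2) \<le> y1 * u\<^sup>2 + 2 * y2 * u * v + y3 * v\<^sup>2"
proof -
  have y3: "y3 > 0"
    using assms by (metis less_trans zero_less_mult_pos zero_le_power2 le_less_trans)
  define c where "c = (y1 * y3 - y2\<^sup>2) / (y1 + y3)"
  have cT: "c * (y1 + y3) = y1 * y3 - y2\<^sup>2" using assms(1) y3 by (simp add: c_def)
  have "(y1 - c) * (y1 + y3) = y1\<^sup>2 + y2\<^sup>2" unfolding left_diff_distrib cT by (simp add: power2_eq_square algebra_simps)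
  moreover have "y1\<^sup>2 + y2\<^sup>2 > 0" using assms(1) by (simp add: add_pos_nonneg)
  ultimately have pos: "y1 - c > 0" using assms(1) y3 by (metis add_pos_pos zero_less_mult_pos2)
  have "(y1 - c) * (y3 - c) - y2\<^sup>2 = y1 * y3 - y2\<^sup>2 - c * (y1 + y3) + c\<^sup>2"
    by (simp add: power2_eq_square algebra_simps)
  then have det: "(y1 - c) * (y3 - c) - y2\<^sup>2 = c\<^sup>2" unfolding cT by simp
  show ?thesis
  proof (rule that[of c])
    show "c > 0" using assms y3 by (simp add: c_def)
    fix u v :: real
    have "(y1 - c) * ((y1 - c) * u\<^sup>2 + 2 * y2 * u * v + (y3 - c) * v\<^sup>2) = ((y1 - c) * u + y2 * v)\<^sup>2 + ((y1 - c) * (y3 - c) - y2\<^sup>2) * v\<^sup>2"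
      by (simp add: power2_eq_square algebra_simps)
    also have "\<dots> \<ge> 0" unfolding det by simp
    finally have "0 \<le> (y1 - c) * u\<^sup>2 + 2 * y2 * u * v + (y3 - c) * v\<^sup>2"
      using pos by (simp add: zero_le_mult_iff)
    then show "c * (u\<^sup>2 + v\<^sup>2) \<le> y1 * u\<^sup>2 + 2 * y2 * u * v + y3 * v\<^sup>2" by (simp add: algebra_simps)
  qed
qed

lemma norm_gauss_term: "norm (gauss_term t1 t2 t3 p) = exp (- pi / 2 * (Im t1 * (of_int (fst p))\<^sup>2 + 2 * Im t2 * of_int (fst p) * of_int (snd p) + Im t3 * (of_int (snd p))\<^sup>2))"
  by (simp add: gauss_term_def norm_exp_eq_Re power2_eq_square algebra_simps)

lemma summable_gauss_term:
  assumes "0 < Im t1" "(Im t2)\<^sup>2 < Im t1 * Im t3"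
  shows "(\<lambda>p. norm (gauss_term t1 t2 t3 p)) summable_on A"
proof -
  obtain c where c: "c > 0" "\<And>u v. c * (u\<^sup>2 + v\<^sup>2) \<le> Im t1 * u\<^sup>2 + 2 * Im t2 * u * v + Im t3 * v\<^sup>2"
    using pos_def_lower_bound[OF assms] by blast
  let ?g = "\<lambda>j::int. complex_of_real (exp (- (pi / 2 * c) * (of_int j + 0)\<^sup>2))"
  have "(\<lambda>j. norm (?g j)) summable_on UNIV"
    using summable_on_int_gaussian[of "pi / 2 * c" 0] c(1) by simp
  from norm_summable_product(1)[OF this this]
  have s: "(\<lambda>p. norm (?g (fst p) * ?g (snd p))) summable_on UNIV" by simp
  have "(\<lambda>p. norm (gauss_term t1 t2 t3 p)) summable_on UNIV"
  proof (rule summable_on_comparison_test[OF s])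
    fix p :: "int \<times> int"
    let ?u = "real_of_int (fst p)" and ?v = "real_of_int (snd p)"
    have "pi / 2 * (c * (?u\<^sup>2 + ?v\<^sup>2)) \<le> pi / 2 * (Im t1 * ?u\<^sup>2 + 2 * Im t2 * ?u * ?v + Im t3 * ?v\<^sup>2)"
      by (intro mult_left_mono c(2)) simp
    then have "- pi / 2 * (Im t1 * ?u\<^sup>2 + 2 * Im t2 * ?u * ?v + Im t3 * ?v\<^sup>2) \<le> - (pi / 2 * c) * ?u\<^sup>2 + - (pi / 2 * c) * ?v\<^sup>2"
      by (simp add: algebra_simps)
    then show "norm (gauss_term t1 t2 t3 p) \<le> norm (?g (fst p) * ?g (snd p))"
      unfolding norm_gauss_term norm_mult by (simp flip: exp_add)
  qed simp
  then show ?thesis by (rule summable_on_subset_banach) simp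
qed

lemma gauss_term_product:
  "gauss_term (t1/2) (t2/2) (t3/2) (r1 + s1, r2 + s2) * gauss_term (t1/2) (t2/2) (t3/2) (r1 - s1, r2 - s2) =
   gauss_term t1 t2 t3 (r1, r2) * gauss_term t1 t2 t3 (s1, s2)"
  unfolding gauss_term_def exp_add[symmetric]
  by (rule arg_cong[where f = exp]) (simp add: power2_eq_square algebra_simps)

lemma exp_pi_i_int: "exp (of_real pi * \<i> * of_int k) = bit_sign (of_int k)"
proof (cases "even k")
  case True
  then obtain j where j: "k = 2 * j" by (elim evenE)
  have "exp (of_real pi * \<i> * of_int k) = exp (2 * of_int j * of_real pi * \<i>)"
    by (rule arg_cong[where f = exp]) (simp add: j)
  then show ?thesis using True exp_integer_2pi[of "of_int j"] by (simp add: of_int_bit)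
next
  case False
  then obtain j where j: "k = 2 * j + 1" by (elim oddE)
  have "exp (of_real pi * \<i> * of_int k) = exp (2 * of_int j * of_real pi * \<i> + of_real pi * \<i>)"
    by (rule arg_cong[where f = exp]) (simp add: j algebra_simps)
  then show ?thesis using False exp_integer_2pi[of "of_int j"] by (simp add: of_int_bit exp_add)
qed

text \<open>The product of two theta series is summed over pairs \<open>(p, q)\<close> in the same class modulo 2. Put
\<open>p = r + s\<close> and \<open>q = r - s\<close>: the quadratic form separates, \<open>r\<close> ranges over all integral vectors, and the
class of \<open>s\<close> is that of \<open>r\<close> shifted by the upper characteristic. The lower characteristic contributes a
sign that depends only on the class of \<open>r\<close>.\<close>

lemma theta_const_square:
  assumes t: "0 < Im t1" "(Im t2)\<^sup>2 < Im t1 * Im t3"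
  shows "(theta_const m (sym_mat t1 t2 t3))\<^sup>2 = (\<Sum>\<sigma>\<in>UNIV. bit_sign (snd m $ 1 * \<sigma> $ 1 + snd m $ 2 * \<sigma> $ 2) *
     second_order_theta \<sigma> (sym_mat t1 t2 t3) * second_order_theta (\<sigma> + fst m) (sym_mat t1 t2 t3))"
proof -
  obtain a b where m: "m = (a, b)" by (cases m)
  let ?c = "\<lambda>p::int \<times> int. exp (of_real pi * \<i> / 2 * (of_int (fst p) * of_bool (odd (b $ 1)) + of_int (snd p) * of_bool (odd (b $ 2))))"
  let ?f = "\<lambda>p. gauss_term (t1 / 2) (t2 / 2) (t3 / 2) p * ?c p"
  let ?S = "\<lambda>\<sigma>. bit_sign (b $ 1 * \<sigma> $ 1 + b $ 2 * \<sigma> $ 2)"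
  let ?g = "\<lambda>\<sigma> rs. ?S \<sigma> * (gauss_term t1 t2 t3 (fst rs) * gauss_term t1 t2 t3 (snd rs))"
  have f: "(\<lambda>p. norm (?f p)) summable_on parity_lattice a"
  proof -
    have "norm (?c p) = 1" for p by (simp add: norm_exp_eq_Re)
    moreover have "(\<lambda>p. norm (gauss_term (t1/2) (t2/2) (t3/2) p)) summable_on parity_lattice a"
      by (rule summable_gauss_term) (use t in \<open>simp_all add: power_divide\<close>)
    ultimately show ?thesis by (simp add: norm_mult)
  qed
  have q: "(\<lambda>p. norm (gauss_term t1 t2 t3 p)) summable_on A" for A by (rule summable_gauss_term[OF t])
  let ?T = "Sigma (UNIV :: (bit^2) set) (\<lambda>\<sigma>. parity_lattice \<sigma> \<times> parity_lattice (\<sigma> + a))"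
  let ?j = "\<lambda>(\<sigma>, r, s). ((fst r + fst s, snd r + snd s), (fst r - fst s, snd r - snd s))"
  let ?i = "\<lambda>(p, q). (vector [of_int ((fst p + fst q) div 2), of_int ((snd p + snd q) div 2)] :: bit^2,
     ((fst p + fst q) div 2, (snd p + snd q) div 2), ((fst p - fst q) div 2, (snd p - snd q) div 2))"
  have h: "?f (fst (?j x)) * ?f (snd (?j x)) = ?g (fst x) (snd x)" if "x \<in> ?T" for x
  proof -
    obtain \<sigma> r1 r2 s1 s2 where x: "x = (\<sigma>, (r1, r2), (s1, s2))" by (metis prod.exhaust)
    have r: "of_int r1 = \<sigma> $ 1" "of_int r2 = \<sigma> $ 2" using that by (auto simp: x parity_lattice_def parity_class_iff)
    have "?c (r1 + s1, r2 + s2) * ?c (r1 - s1, r2 - s2) =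
        exp (of_real pi * \<i> * of_int (r1 * of_bool (odd (b $ 1)) + r2 * of_bool (odd (b $ 2))))"
      unfolding exp_add[symmetric] by (rule arg_cong[where f = exp]) (simp add: algebra_simps)
    also have "\<dots> = ?S \<sigma>"
      unfolding exp_pi_i_int by (cases "b $ 1"; cases "b $ 2") (simp_all add: r add.commute)
    finally have c: "?c (r1 + s1, r2 + s2) * ?c (r1 - s1, r2 - s2) = ?S \<sigma>" .
    have "?f (r1 + s1, r2 + s2) * ?f (r1 - s1, r2 - s2) =
        (gauss_term (t1/2) (t2/2) (t3/2) (r1 + s1, r2 + s2) * gauss_term (t1/2) (t2/2) (t3/2) (r1 - s1, r2 - s2)) *
        (?c (r1 + s1, r2 + s2) * ?c (r1 - s1, r2 - s2))"
      by (simp only: mult_ac)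
    then show ?thesis unfolding gauss_term_product c by (simp add: x)
  qed
  have bit_cases: "z + z = 0" "y + (y + z) = z" "y - (y + z) = z" "y + z + y = z" for y z :: bit
    by (cases y; cases z; simp)+
  have sT: "(\<lambda>x. ?g (fst x) (snd x)) summable_on ?T" and
    eq: "(\<Sum>\<^sub>\<infinity>x\<in>?T. ?g (fst x) (snd x)) = (\<Sum>\<^sub>\<infinity>p\<in>parity_lattice a \<times> parity_lattice a. ?f (fst p) * ?f (snd p))"
  proof -
    have b: "?i (?j x) = x" "?j x \<in> parity_lattice a \<times> parity_lattice a" if "x \<in> ?T" for x
    proof -
      obtain \<sigma> r1 r2 s1 s2 where x: "x = (\<sigma>, (r1, r2), (s1, s2))" by (metis prod.exhaust)
      have r: "of_int r1 = \<sigma> $ 1" "of_int r2 = \<sigma> $ 2" "of_int s1 = \<sigma> $ 1 + a $ 1" "of_int s2 = \<sigma> $ 2 + a $ 2"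
        using that by (auto simp: x parity_lattice_def parity_class_iff)
      show "?i (?j x) = x" by (simp add: x bit2_eq_iff r)
      show "?j x \<in> parity_lattice a \<times> parity_lattice a" 
        by (simp only: x case_prod_conv fst_conv snd_conv parity_lattice_def parity_class_iff mem_Times_iff of_int_add of_int_diff r bit_cases simp_thms)
    qed
    have b': "?j (?i y) = y" "?i y \<in> ?T" if y: "y \<in> parity_lattice a \<times> parity_lattice a" for y
    proof -
      obtain p1 p2 q1 q2 where yy: "y = ((p1, p2), (q1, q2))" by (metis prod.exhaust)
      have e: "of_int p1 = a $ 1" "of_int p2 = a $ 2" "of_int q1 = a $ 1" "of_int q2 = a $ 2"
        using y by (auto simp: yy parity_lattice_def parity_class_iff)
      have "odd p1 \<longleftrightarrow> odd q1" "odd p2 \<longleftrightarrow> odd q2"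
        using e by (metis of_int_bit of_bool_eq_iff)+
      then have "even (p1 - q1)" "even (p2 - q2)" by simp_all
      then obtain u1 u2 where "p1 - q1 = 2 * u1" "p2 - q2 = 2 * u2" by (elim dvdE) blast
      then have u: "p1 = q1 + 2 * u1" "p2 = q2 + 2 * u2" by linarith+
      have d: "(p1 + q1) div 2 = q1 + u1" "(p2 + q2) div 2 = q2 + u2" "(p1 - q1) div 2 = u1" "(p2 - q2) div 2 = u2"
        using u by auto
      have dj: "?i y = (vector [of_int (q1 + u1), of_int (q2 + u2)], (q1 + u1, q2 + u2), (u1, u2))"
        by (simp add: yy d)
      show "?j (?i y) = y" unfolding dj by (simp add: yy u)
      show "?i y \<in> ?T" 
        unfolding dj by (simp only: mem_Sigma_iff UNIV_I fst_conv snd_conv parity_lattice_def parity_class_iff mem_Times_iff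
            vector_2 vector_add_component of_int_add e bit_cases simp_thms)
    qed
    have "(\<lambda>p. ?f (fst p) * ?f (snd p)) summable_on parity_lattice a \<times> parity_lattice a"
      by (rule abs_summable_summable[OF norm_summable_product(1)[OF f f]])
    then show "(\<lambda>x. ?g (fst x) (snd x)) summable_on ?T"
      using summable_on_reindex_bij_witness[of ?T ?i ?j "parity_lattice a \<times> parity_lattice a" "\<lambda>p. ?f (fst p) * ?f (snd p)" "\<lambda>x. ?g (fst x) (snd x)"]
        b b' h by blast
    show "(\<Sum>\<^sub>\<infinity>x\<in>?T. ?g (fst x) (snd x)) = (\<Sum>\<^sub>\<infinity>p\<in>parity_lattice a \<times> parity_lattice a. ?f (fst p) * ?f (snd p))"
      by (rule infsum_reindex_bij_witness[of ?T ?i ?j]) (use b b' h in blast)+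
  qed
  have "(theta_const m (sym_mat t1 t2 t3))\<^sup>2 = (\<Sum>\<^sub>\<infinity>p\<in>parity_lattice a \<times> parity_lattice a. ?f (fst p) * ?f (snd p))"
    unfolding norm_summable_product(2)[OF f f] by (simp add: theta_const_sym_mat m power2_eq_square)
  also have "\<dots> = (\<Sum>\<^sub>\<infinity>\<sigma>\<in>UNIV. \<Sum>\<^sub>\<infinity>rs\<in>parity_lattice \<sigma> \<times> parity_lattice (\<sigma> + a). ?g \<sigma> rs)"
    unfolding eq[symmetric] using infsum_Sigma_banach[OF sT] by simp
  also have "\<dots> = (\<Sum>\<sigma>\<in>UNIV. ?S \<sigma> * (second_order_theta \<sigma> (sym_mat t1 t2 t3) * second_order_theta (\<sigma> + a) (sym_mat t1 t2 t3)))"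
    by (simp add: infsum_cmult_right' norm_summable_product(2)[OF q q] second_order_theta_sym_mat)
  finally show ?thesis by (simp add: m mult.assoc)
qed


section \<open>Transformation of the second order theta constants\<close>

text \<open>The extra factor of a term depends on \<open>p\<^sub>1\<^sup>2\<close> modulo 4, hence only on the parity of \<open>p\<^sub>1\<close>.\<close>

lemma second_order_theta_trans11:
  "second_order_theta \<sigma> (sym_mat (t1 + of_int k) t2 t3) =
     exp (of_real pi * \<i> / 2 * of_int k * of_bool (\<sigma> $ 1 = 1)) * second_order_theta \<sigma> (sym_mat t1 t2 t3)"
  unfolding second_order_theta_sym_mat infsum_cmult_right'[symmetric]
proof (rule infsum_cong)
  fix p assume p: "p \<in> parity_lattice \<sigma>"
  obtain p1 p2 where pp: "p = (p1, p2)" by (cases p)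
  have o: "of_int p1 = \<sigma> $ 1" using p by (simp add: pp parity_lattice_def parity_class_iff)
  have "exp (of_real pi * \<i> / 2 * of_int k * (of_int p1)\<^sup>2) = exp (of_real pi * \<i> / 2 * of_int k * of_bool (\<sigma> $ 1 = 1))"
  proof -
    obtain n where n: "p1\<^sup>2 = of_bool (odd p1) + 4 * n"
    proof (cases "even p1")
      case True
      then obtain j where "p1 = 2 * j" by (elim evenE)
      then show ?thesis using that[of "j * j"] by (simp add: power2_eq_square)
    next
      case False
      then obtain j where "p1 = 2 * j + 1" by (elim oddE)
      then show ?thesis using that[of "j * j + j"] False by (simp add: power2_eq_square algebra_simps)
    qed
    have "(of_int p1 :: complex)\<^sup>2 = of_int (p1\<^sup>2)" by simp
    also have "\<dots> = of_bool (\<sigma> $ 1 = 1) + 4 * of_int n"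
      unfolding n o[symmetric] of_int_bit by simp
    finally have "of_real pi * \<i> / 2 * of_int k * (of_int p1)\<^sup>2 =
        of_real pi * \<i> / 2 * of_int k * of_bool (\<sigma> $ 1 = 1) + of_real pi * \<i> * of_int (2 * (k * n))"
      by (simp add: algebra_simps)
    then show ?thesis by (simp only: exp_add exp_pi_i_int) (simp add: of_int_bit)
  qed
  then show "gauss_term (t1 + of_int k) t2 t3 p = exp (of_real pi * \<i> / 2 * of_int k * of_bool (\<sigma> $ 1 = 1)) * gauss_term t1 t2 t3 p"
    unfolding gauss_term_def pp by (simp add: exp_add[symmetric] distrib_left distrib_right add_divide_distrib mult_ac add_ac flip: mult_exp_exp)
qed

lemma second_order_theta_trans12:
  "second_order_theta \<sigma> (sym_mat t1 (t2 + of_int k) t3) =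
     bit_sign (of_int k * \<sigma> $ 1 * \<sigma> $ 2) * second_order_theta \<sigma> (sym_mat t1 t2 t3)"
  unfolding second_order_theta_sym_mat infsum_cmult_right'[symmetric]
proof (rule infsum_cong)
  fix p assume p: "p \<in> parity_lattice \<sigma>"
  obtain p1 p2 where pp: "p = (p1, p2)" by (cases p)
  have o: "of_int p1 = \<sigma> $ 1" "of_int p2 = \<sigma> $ 2" using p by (simp_all add: pp parity_lattice_def parity_class_iff)
  have "gauss_term t1 (t2 + of_int k) t3 p = exp (of_real pi * \<i> * of_int (k * p1 * p2)) * gauss_term t1 t2 t3 p"
    unfolding gauss_term_def pp exp_add[symmetric] by (rule arg_cong[where f = exp]) (simp add: algebra_simps)
  also have "exp (of_real pi * \<i> * of_int (k * p1 * p2)) = bit_sign (of_int k * \<sigma> $ 1 * \<sigma> $ 2)"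
    unfolding exp_pi_i_int by (simp add: o)
  finally show "gauss_term t1 (t2 + of_int k) t3 p = bit_sign (of_int k * \<sigma> $ 1 * \<sigma> $ 2) * gauss_term t1 t2 t3 p" .
qed

lemma second_order_theta_swap:
  "second_order_theta \<sigma> (sym_mat t3 t2 t1) = second_order_theta (vector [\<sigma> $ 2, \<sigma> $ 1]) (sym_mat t1 t2 t3)"
  unfolding second_order_theta_sym_mat
  by (rule infsum_reindex_bij_witness[of _ prod.swap prod.swap])
     (auto simp: parity_lattice_def gauss_term_def algebra_simps)

lemma gauss_term_shear:
  "gauss_term t1 t2 t3 (p1, k * p1 + p2) = gauss_term (t1 + 2 * of_int k * t2 + (of_int k)\<^sup>2 * t3) (t2 + of_int k * t3) t3 (p1, p2)"
  unfolding gauss_term_def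
  by (rule arg_cong[where f = "\<lambda>x. exp (of_real pi * \<i> / 2 * x)"]) (simp add: power2_eq_square algebra_simps)

lemma second_order_theta_shear:
  "second_order_theta \<sigma> (sym_mat (t1 + 2 * of_int k * t2 + (of_int k)\<^sup>2 * t3) (t2 + of_int k * t3) t3) =
     second_order_theta (vector [\<sigma> $ 1, of_int k * \<sigma> $ 1 + \<sigma> $ 2]) (sym_mat t1 t2 t3)"
proof -
  have bit: "x - (x + y) = y" "x + (y - x) = y" for x y :: bit by (cases x; cases y; simp)+
  show ?thesis
    unfolding second_order_theta_sym_mat
    by (rule infsum_reindex_bij_witness[of _ "\<lambda>(p1, p2). (p1, p2 - k * p1)" "\<lambda>(p1, p2). (p1, k * p1 + p2)"])
       (auto simp: parity_lattice_def parity_class_iff gauss_term_shear bit)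
qed

lemma Un_parity_lattice: "UNIV \<times> parity_class y = parity_lattice (vector [0, y]) \<union> parity_lattice (vector [1, y])"
  and parity_lattice_disjoint: "parity_lattice (vector [0, y]) \<inter> parity_lattice (vector [1, y]) = {}"
  by (auto simp: parity_lattice_def parity_class_iff)

lemma infsum_parity_class:
  "(\<Sum>\<^sub>\<infinity>k\<in>parity_class x. f k) = (\<Sum>\<^sub>\<infinity>n\<in>(UNIV::int set). f (2 * n + of_bool (odd x)))"
  by (rule infsum_reindex_bij_witness[of _ "\<lambda>n. 2 * n + of_bool (odd x)" "\<lambda>k. k div 2"])
     (simp_all only: parity_class_div parity_class_double_add UNIV_I, simp)

text \<open>For fixed second index, completing the square leaves a one-variable theta series in the first index,
to which the inversion formula applies with \<open>A = t1/(2\<i>)\<close>. The factor that depends on \<open>p2\<close> alone is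
kept aside as \<open>E\<close>.\<close>

lemma one_dim_inversion:
  assumes t: "0 < Im t1"
  shows "(\<Sum>\<^sub>\<infinity>p1\<in>parity_class x. gauss_term (- 1 / t1) (t2 / t1) (t3 - t2\<^sup>2 / t1) (p1, p2)) =
    csqrt (t1 / (2 * \<i>)) * (\<Sum>\<^sub>\<infinity>k\<in>UNIV. bit_sign (of_int k * x) * gauss_term t1 t2 t3 (k, p2))"
proof -
  define A where "A = t1 / (2 * \<i>)"
  define w where "w = (of_bool (odd x) - of_int p2 * t2) / 2"
  define E where "E = exp (of_real pi * \<i> / 2 * t3 * (of_int p2)\<^sup>2)"
  have t0: "t1 \<noteq> 0" using t by auto
  have A: "Re A > 0" using t by (simp add: A_def Re_divide)
  have 1: "gauss_term (- 1 / t1) (t2 / t1) (t3 - t2\<^sup>2 / t1) (2 * n + of_bool (odd x), p2) = E * exp (- pi * (of_int n + w)\<^sup>2 / A)" for n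
  proof -
    have "2 * w = of_bool (odd x) - of_int p2 * t2" by (simp add: w_def)
    then have u: "of_int (2 * n + of_bool (odd x)) = 2 * (of_int n + w) + of_int p2 * t2"
      by (simp only: distrib_left of_int_add of_int_mult of_int_of_bool of_int_numeral) (simp only: add.assoc diff_add_cancel)
    have "(- 1 / t1) * u\<^sup>2 + 2 * (t2 / t1) * u * q + (t3 - t2\<^sup>2 / t1) * q\<^sup>2 = t3 * q\<^sup>2 - (u - q * t2)\<^sup>2 / t1" for u q :: complex
      by (simp add: power2_eq_square algebra_simps add_divide_distrib diff_divide_distrib)
    then have "gauss_term (- 1 / t1) (t2 / t1) (t3 - t2\<^sup>2 / t1) (2 * n + of_bool (odd x), p2) =
        exp (of_real pi * \<i> / 2 * (t3 * (of_int p2)\<^sup>2 - (2 * (of_int n + w))\<^sup>2 / t1))"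
      by (simp only: gauss_term_def fst_conv snd_conv u add_diff_cancel)
    moreover have "of_real pi * \<i> / 2 * (t3 * q - (2 * X)\<^sup>2 / t1) = of_real pi * \<i> / 2 * t3 * q + (- of_real pi * X\<^sup>2 / A)" for q X :: complex
      using t0 by (simp add: A_def right_diff_distrib power_mult_distrib mult_ac)
    ultimately show ?thesis by (simp only: E_def exp_add of_real_minus)
  qed
  have 2: "E * exp (- pi * A * (of_int (- k))\<^sup>2 + 2 * pi * \<i> * w * of_int (- k)) = bit_sign (of_int k * x) * gauss_term t1 t2 t3 (k, p2)" for k
  proof -
    have "bit_sign (of_int k * x) = exp (of_real pi * \<i> * of_int (- (k * of_bool (odd x))))"
      unfolding exp_pi_i_int by (cases x) (simp_all add: of_int_bit)
    then have "bit_sign (of_int k * x) * gauss_term t1 t2 t3 (k, p2) =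
       exp (of_real pi * \<i> * of_int (- (k * of_bool (odd x))) + of_real pi * \<i> / 2 *
         (t1 * (of_int k)\<^sup>2 + 2 * t2 * of_int k * of_int p2 + t3 * (of_int p2)\<^sup>2))"
      by (simp only: gauss_term_def exp_add fst_conv snd_conv)
    moreover have "of_real pi * \<i> * - (K * o1) + of_real pi * \<i> / 2 * (t1 * K\<^sup>2 + 2 * t2 * K * q + t3 * q\<^sup>2) =
       of_real pi * \<i> / 2 * t3 * q\<^sup>2 + (- of_real pi * A * (- K)\<^sup>2 + 2 * of_real pi * \<i> * ((o1 - q * t2) / 2) * - K)" for K q o1 :: complex
    proof -
      have A': "A = - (\<i> * t1) / 2" by (simp add: A_def field_simps)
      show ?thesis unfolding A' by (simp add: field_simps)
    qed
    ultimately show ?thesis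
      by (simp only: E_def exp_add of_real_minus of_int_minus of_int_mult of_int_of_bool w_def of_real_mult of_real_numeral)
  qed
  have "(\<Sum>\<^sub>\<infinity>p1\<in>parity_class x. gauss_term (- 1 / t1) (t2 / t1) (t3 - t2\<^sup>2 / t1) (p1, p2)) =
      E * (\<Sum>\<^sub>\<infinity>n\<in>UNIV. exp (- pi * (of_int n + w)\<^sup>2 / A))"
    unfolding infsum_parity_class 1 infsum_cmult_right' ..
  also have "\<dots> = csqrt A * (\<Sum>\<^sub>\<infinity>n\<in>(UNIV::int set). E * exp (- pi * A * (of_int n)\<^sup>2 + 2 * pi * \<i> * w * of_int n))"
    unfolding theta_inversion[OF A] infsum_cmult_right' by (simp only: mult_ac)
  also have "(\<Sum>\<^sub>\<infinity>n\<in>(UNIV::int set). E * exp (- pi * A * (of_int n)\<^sup>2 + 2 * pi * \<i> * w * of_int n)) =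
      (\<Sum>\<^sub>\<infinity>k\<in>UNIV. bit_sign (of_int k * x) * gauss_term t1 t2 t3 (k, p2))"
    by (rule infsum_reindex_bij_witness[of _ uminus uminus]) (simp_all only: 2[symmetric] UNIV_I minus_minus)
  finally show ?thesis by (simp add: A_def)
qed

lemma second_order_theta_inversion:
  assumes t: "0 < Im t1" "(Im t2)\<^sup>2 < Im t1 * Im t3"
  shows "second_order_theta \<sigma> (sym_mat (- 1 / t1) (t2 / t1) (t3 - t2\<^sup>2 / t1)) =
    csqrt (t1 / (2 * \<i>)) * (second_order_theta (vector [0, \<sigma> $ 2]) (sym_mat t1 t2 t3) +
       bit_sign (\<sigma> $ 1) * second_order_theta (vector [1, \<sigma> $ 2]) (sym_mat t1 t2 t3))"
proof -
  define s1 s2 s3 where s: "s1 = - 1 / t1" "s2 = t2 / t1" "s3 = t3 - t2\<^sup>2 / t1"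
  have t0: "t1 \<noteq> 0" using t by auto
  have "sym_mat s1 s2 s3 \<in> siegel_H2"
    using siegel_act_generators_in_H2(3)[of t1 t2 t3] t by (simp add: s siegel_act_generators(3)[OF t0] sym_mat_in_H2_iff)
  then have sp: "0 < Im s1" "(Im s2)\<^sup>2 < Im s1 * Im s3" by (simp_all add: sym_mat_in_H2_iff)
  let ?A = "parity_class (\<sigma> $ 1)" and ?B = "parity_class (\<sigma> $ 2)"
  let ?F = "\<lambda>p. bit_sign (of_int (fst p) * \<sigma> $ 1) * gauss_term t1 t2 t3 p"
  have F: "?F summable_on S" for S
  proof (rule abs_summable_summable)
    have "norm (bit_sign x) = 1" for x by (cases x) auto
    then show "(\<lambda>p. norm (?F p)) summable_on S" using summable_gauss_term[OF t] by (simp add: norm_mult)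
  qed
  have Fx: "(\<Sum>\<^sub>\<infinity>p\<in>parity_lattice (vector [x, \<sigma> $ 2]). ?F p) = bit_sign (x * \<sigma> $ 1) * second_order_theta (vector [x, \<sigma> $ 2]) (sym_mat t1 t2 t3)" for x
    unfolding second_order_theta_sym_mat infsum_cmult_right'[symmetric]
    by (rule infsum_cong) (auto simp: parity_lattice_def parity_class_iff)
  have "second_order_theta \<sigma> (sym_mat s1 s2 s3) = (\<Sum>\<^sub>\<infinity>p1\<in>?A. \<Sum>\<^sub>\<infinity>p2\<in>?B. gauss_term s1 s2 s3 (p1, p2))"
    unfolding second_order_theta_sym_mat parity_lattice_def
    by (rule infsum_Sigma_banach[symmetric], rule abs_summable_summable, rule summable_gauss_term[OF sp])
  also have "\<dots> = (\<Sum>\<^sub>\<infinity>p2\<in>?B. \<Sum>\<^sub>\<infinity>p1\<in>?A. gauss_term s1 s2 s3 (p1, p2))"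
    by (rule infsum_swap_banach) (simp add: abs_summable_summable[OF summable_gauss_term[OF sp]])
  also have "\<dots> = (\<Sum>\<^sub>\<infinity>p2\<in>?B. csqrt (t1 / (2 * \<i>)) * (\<Sum>\<^sub>\<infinity>k\<in>UNIV. ?F (k, p2)))"
    unfolding s one_dim_inversion[OF t(1)] by simp
  also have "\<dots> = csqrt (t1 / (2 * \<i>)) * (\<Sum>\<^sub>\<infinity>p2\<in>?B. \<Sum>\<^sub>\<infinity>k\<in>UNIV. ?F (k, p2))"
    by (rule infsum_cmult_right')
  also have "(\<Sum>\<^sub>\<infinity>p2\<in>?B. \<Sum>\<^sub>\<infinity>k\<in>UNIV. ?F (k, p2)) = (\<Sum>\<^sub>\<infinity>k\<in>UNIV. \<Sum>\<^sub>\<infinity>p2\<in>?B. ?F (k, p2))"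
    by (rule infsum_swap_banach[symmetric]) (use F in \<open>simp add: case_prod_unfold\<close>)
  also have "\<dots> = (\<Sum>\<^sub>\<infinity>p\<in>UNIV \<times> ?B. ?F p)"
    by (rule infsum_Sigma_banach[OF F])
  also have "\<dots> = (\<Sum>\<^sub>\<infinity>p\<in>parity_lattice (vector [0, \<sigma> $ 2]). ?F p) + (\<Sum>\<^sub>\<infinity>p\<in>parity_lattice (vector [1, \<sigma> $ 2]). ?F p)"
    unfolding Un_parity_lattice by (rule infsum_Un_disjoint[OF F F parity_lattice_disjoint])
  finally show ?thesis unfolding Fx by (simp add: s)
qed


section \<open>The action on the vector of theta constants and the Heisenberg group\<close>

definition Theta :: "complex^2^2 \<Rightarrow> complex^(bit^2)" where
  "Theta \<tau> = (\<chi> \<sigma>. second_order_theta \<sigma> \<tau>)"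

text \<open>A vector \<open>v\<close> modulo 2 has a left half, which acts on the coordinates of \<open>X\<close> by signs, and a right half,
which shifts their index.\<close>

definition phase :: "bit^(2 + 2) \<Rightarrow> bit^2 \<Rightarrow> complex" where
  "phase v \<sigma> = bit_sign (v $ Inl 1 * \<sigma> $ 1 + v $ Inl 2 * \<sigma> $ 2)"

definition shift :: "bit^(2 + 2) \<Rightarrow> bit^2 \<Rightarrow> bit^2" where
  "shift v \<sigma> = vector [\<sigma> $ 1 + v $ Inr 1, \<sigma> $ 2 + v $ Inr 2]"

text \<open>The Heisenberg operator of \<open>v\<close>; these operators form a group up to signs.\<close>

definition heisenberg :: "bit^(2 + 2) \<Rightarrow> complex^(bit^2) \<Rightarrow> complex^(bit^2)" where
  "heisenberg v X = (\<chi> \<sigma>. phase v \<sigma> * X $ shift v \<sigma>)"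

lemma heisenberg_nth: "heisenberg v X $ \<sigma> = phase v \<sigma> * X $ shift v \<sigma>"
  by (simp add: heisenberg_def)

abbreviation mod2_act :: "mat4 \<Rightarrow> bit^(2 + 2) \<Rightarrow> bit^(2 + 2)" where
  "mod2_act M v \<equiv> map_matrix of_int M *v v"

text \<open>The matrix \<open>\<rho>\<close> describes the action of \<open>M\<close> on the vector of theta constants up to a scalar \<open>\<kappa>\<close>. Only the
fourth power of \<open>\<kappa>\<close> is recorded: the product of four theta constants depends on nothing else, and the
choice of a square root of \<open>det (c\<tau> + d)\<close> is avoided. The last clause says that \<open>\<rho>\<close> normalises the
Heisenberg group and acts on it through \<open>M\<close> modulo 2.\<close>

definition theta_rep :: "mat4 \<Rightarrow> complex^(bit^2)^(bit^2) \<Rightarrow> bool" where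
  "theta_rep M \<rho> \<longleftrightarrow> invertible \<rho> \<and>
     (\<exists>\<zeta>. \<zeta> \<noteq> 0 \<and> (\<forall>\<tau>\<in>siegel_H2. siegel_act M \<tau> \<in> siegel_H2 \<and> det (cfactor M \<tau>) \<noteq> 0 \<and>
        (\<exists>\<kappa>. \<kappa> ^ 4 = \<zeta> * det (cfactor M \<tau>) ^ 2 \<and> Theta (siegel_act M \<tau>) = \<kappa> *s (\<rho> *v Theta \<tau>)))) \<and>
     (\<forall>v. \<exists>c. c \<noteq> 0 \<and> (\<forall>X. \<rho> *v heisenberg v X = c *s heisenberg (mod2_act M v) (\<rho> *v X)))"

lemma matrix_vector_scale: "A *v (c *s X) = c *s (A *v X)" for A :: "complex^'n^'m"
  by (simp add: vec_eq_iff matrix_vector_mult_def sum_distrib_left mult_ac)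

lemma theta_rep_mult:
  assumes G: "theta_rep G \<rho>" and M: "theta_rep M \<rho>'"
  shows "theta_rep (G ** M) (\<rho> ** \<rho>')"
  unfolding theta_rep_def
proof (intro conjI allI)
  show "invertible (\<rho> ** \<rho>')" using G M by (auto simp: theta_rep_def intro: invertible_mult)
  obtain z where z: "z \<noteq> 0" "\<And>\<tau>. \<tau> \<in> siegel_H2 \<Longrightarrow> siegel_act G \<tau> \<in> siegel_H2" "\<And>\<tau>. \<tau> \<in> siegel_H2 \<Longrightarrow> det (cfactor G \<tau>) \<noteq> 0"
    "\<And>\<tau>. \<tau> \<in> siegel_H2 \<Longrightarrow> \<exists>\<kappa>. \<kappa> ^ 4 = z * det (cfactor G \<tau>) ^ 2 \<and> Theta (siegel_act G \<tau>) = \<kappa> *s (\<rho> *v Theta \<tau>)"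
    using G unfolding theta_rep_def by blast
  obtain z' where z': "z' \<noteq> 0" "\<And>\<tau>. \<tau> \<in> siegel_H2 \<Longrightarrow> siegel_act M \<tau> \<in> siegel_H2" "\<And>\<tau>. \<tau> \<in> siegel_H2 \<Longrightarrow> det (cfactor M \<tau>) \<noteq> 0"
    "\<And>\<tau>. \<tau> \<in> siegel_H2 \<Longrightarrow> \<exists>\<kappa>. \<kappa> ^ 4 = z' * det (cfactor M \<tau>) ^ 2 \<and> Theta (siegel_act M \<tau>) = \<kappa> *s (\<rho>' *v Theta \<tau>)"
    using M unfolding theta_rep_def by blast
  show "\<exists>\<zeta>. \<zeta> \<noteq> 0 \<and> (\<forall>\<tau>\<in>siegel_H2. siegel_act (G ** M) \<tau> \<in> siegel_H2 \<and> det (cfactor (G ** M) \<tau>) \<noteq> 0 \<and>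
        (\<exists>\<kappa>. \<kappa> ^ 4 = \<zeta> * det (cfactor (G ** M) \<tau>) ^ 2 \<and> Theta (siegel_act (G ** M) \<tau>) = \<kappa> *s (\<rho> ** \<rho>' *v Theta \<tau>)))"
  proof (rule exI[of _ "z * z'"], intro conjI ballI)
    show "z * z' \<noteq> 0" using z(1) z'(1) by simp
    fix \<tau> assume t: "\<tau> \<in> siegel_H2"
    have a: "siegel_act (G ** M) \<tau> = siegel_act G (siegel_act M \<tau>)"
      by (rule siegel_act_mult) (use z z' t in auto)
    have c: "det (cfactor (G ** M) \<tau>) = det (cfactor G (siegel_act M \<tau>)) * det (cfactor M \<tau>)"
      using numerator_cfactor_mult(2)[OF z'(3)[OF t]] by (simp add: det_mul)
    show "siegel_act (G ** M) \<tau> \<in> siegel_H2" "det (cfactor (G ** M) \<tau>) \<noteq> 0" using a c z z' t by auto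
    obtain k where k: "k ^ 4 = z * det (cfactor G (siegel_act M \<tau>)) ^ 2" "Theta (siegel_act G (siegel_act M \<tau>)) = k *s (\<rho> *v Theta (siegel_act M \<tau>))"
      using z(4)[OF z'(2)[OF t]] by blast
    obtain k' where k': "k' ^ 4 = z' * det (cfactor M \<tau>) ^ 2" "Theta (siegel_act M \<tau>) = k' *s (\<rho>' *v Theta \<tau>)"
      using z'(4)[OF t] by blast
    show "\<exists>\<kappa>. \<kappa> ^ 4 = z * z' * det (cfactor (G ** M) \<tau>) ^ 2 \<and> Theta (siegel_act (G ** M) \<tau>) = \<kappa> *s (\<rho> ** \<rho>' *v Theta \<tau>)"
      by (intro exI[of _ "k * k'"])
         (simp add: a c k k' power_mult_distrib matrix_vector_scale matrix_vector_mul_assoc[symmetric] mult_ac)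
  qed
  fix v
  obtain c where c: "c \<noteq> 0" "\<And>X. \<rho>' *v heisenberg v X = c *s heisenberg (mod2_act M v) (\<rho>' *v X)"
    using M unfolding theta_rep_def by blast
  obtain d where d: "d \<noteq> 0" "\<And>X. \<rho> *v heisenberg (mod2_act M v) X = d *s heisenberg (mod2_act G (mod2_act M v)) (\<rho> *v X)"
    using G unfolding theta_rep_def by blast
  have m: "mod2_act (G ** M) v = mod2_act G (mod2_act M v)"
    by (simp add: map_matrix_mult matrix_vector_mul_assoc)
  show "\<exists>c. c \<noteq> 0 \<and> (\<forall>X. \<rho> ** \<rho>' *v heisenberg v X = c *s heisenberg (mod2_act (G ** M) v) (\<rho> ** \<rho>' *v X))"
    unfolding m by (intro exI[of _ "c * d"]) (simp add: c d matrix_vector_scale matrix_vector_mul_assoc[symmetric] mult_ac)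
qed

definition monomial_matrix :: "(bit^2 \<Rightarrow> complex) \<Rightarrow> (bit^2 \<Rightarrow> bit^2) \<Rightarrow> complex^(bit^2)^(bit^2)" where
  "monomial_matrix g f = (\<chi> \<sigma> \<sigma>'. g \<sigma> * of_bool (\<sigma>' = f \<sigma>))"

lemma monomial_matrix_nth [simp]: "(monomial_matrix g f *v X) $ \<sigma> = g \<sigma> * X $ f \<sigma>"
proof -
  have "(monomial_matrix g f *v X) $ \<sigma> = (\<Sum>\<sigma>'\<in>UNIV. if \<sigma>' = f \<sigma> then g \<sigma> * X $ \<sigma>' else 0)"
    unfolding matrix_vector_mult_def monomial_matrix_def vec_lambda_beta by (rule sum.cong) auto
  then show ?thesis by simp
qed

lemma invertibleI_inj: "inj ((*v) A) \<Longrightarrow> invertible A" for A :: "complex^'n^'n"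
  by (simp add: invertible_left_inverse matrix_left_invertible_injective)

text \<open>Four of the five types of generators permute the theta constants up to factors, by an involution \<open>f\<close> of
the characteristics.\<close>

lemma theta_rep_monomial:
  assumes f: "\<And>\<sigma>. f (f \<sigma>) = \<sigma>" and g: "\<And>\<sigma>. g \<sigma> \<noteq> 0"
    and H: "\<And>\<tau>. \<tau> \<in> siegel_H2 \<Longrightarrow> siegel_act M \<tau> \<in> siegel_H2"
    and det: "\<And>\<tau>. \<tau> \<in> siegel_H2 \<Longrightarrow> det (cfactor M \<tau>) ^ 2 = 1"
    and act: "\<And>\<tau> \<sigma>. \<tau> \<in> siegel_H2 \<Longrightarrow> second_order_theta \<sigma> (siegel_act M \<tau>) = g \<sigma> * second_order_theta (f \<sigma>) \<tau>"
    and heisenberg: "\<And>v. \<exists>c. c \<noteq> 0 \<and> (\<forall>\<sigma>. f (shift (mod2_act M v) \<sigma>) = shift v (f \<sigma>) \<and>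
       g \<sigma> * phase v (f \<sigma>) = c * phase (mod2_act M v) \<sigma> * g (shift (mod2_act M v) \<sigma>))"
  shows "theta_rep M (monomial_matrix g f)"
  unfolding theta_rep_def
proof (intro conjI allI)
  show "invertible (monomial_matrix g f)"
  proof (rule invertibleI_inj, rule injI)
    fix X Y assume "monomial_matrix g f *v X = monomial_matrix g f *v Y"
    then have "(monomial_matrix g f *v X) $ f \<sigma> = (monomial_matrix g f *v Y) $ f \<sigma>" for \<sigma> by simp
    then show "X = Y" using g by (simp add: f vec_eq_iff)
  qed
  show "\<exists>\<zeta>. \<zeta> \<noteq> 0 \<and> (\<forall>\<tau>\<in>siegel_H2. siegel_act M \<tau> \<in> siegel_H2 \<and> det (cfactor M \<tau>) \<noteq> 0 \<and>
        (\<exists>\<kappa>. \<kappa> ^ 4 = \<zeta> * det (cfactor M \<tau>) ^ 2 \<and> Theta (siegel_act M \<tau>) = \<kappa> *s (monomial_matrix g f *v Theta \<tau>)))"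
    using H det act by (intro exI[of _ 1] conjI ballI) (force simp: Theta_def vec_eq_iff)+
  fix v
  obtain c where c: "c \<noteq> 0" "\<forall>\<sigma>. f (shift (mod2_act M v) \<sigma>) = shift v (f \<sigma>) \<and>
       g \<sigma> * phase v (f \<sigma>) = c * phase (mod2_act M v) \<sigma> * g (shift (mod2_act M v) \<sigma>)"
    using heisenberg by blast
  show "\<exists>c. c \<noteq> 0 \<and> (\<forall>X. monomial_matrix g f *v heisenberg v X = c *s heisenberg (mod2_act M v) (monomial_matrix g f *v X))"
    using c by (intro exI[of _ c]) (simp add: vec_eq_iff[where 'b = "bit^2"] heisenberg_nth mult.assoc[symmetric])
qed

lemma exp_half_pi_i_int_square: "exp (of_real pi * \<i> / 2 * of_int k) * exp (of_real pi * \<i> / 2 * of_int k) = bit_sign (of_int k)"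
  unfolding exp_pi_i_int[symmetric] exp_add[symmetric] by (simp add: field_simps)

lemma mod2_act_generators:
  "mod2_act (trans11 k) v $ Inl 1 = v $ Inl 1 + of_int k * v $ Inr 1" "mod2_act (trans11 k) v $ Inl 2 = v $ Inl 2"
  "mod2_act (trans11 k) v $ Inr 1 = v $ Inr 1" "mod2_act (trans11 k) v $ Inr 2 = v $ Inr 2"
  "mod2_act (trans12 k) v $ Inl 1 = v $ Inl 1 + of_int k * v $ Inr 2" "mod2_act (trans12 k) v $ Inl 2 = v $ Inl 2 + of_int k * v $ Inr 1"
  "mod2_act (trans12 k) v $ Inr 1 = v $ Inr 1" "mod2_act (trans12 k) v $ Inr 2 = v $ Inr 2"
  "mod2_act partial_inversion v $ Inl 1 = v $ Inr 1" "mod2_act partial_inversion v $ Inl 2 = v $ Inl 2"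
  "mod2_act partial_inversion v $ Inr 1 = v $ Inl 1" "mod2_act partial_inversion v $ Inr 2 = v $ Inr 2"
  "mod2_act swap_coords v $ Inl 1 = v $ Inl 2" "mod2_act swap_coords v $ Inl 2 = v $ Inl 1"
  "mod2_act swap_coords v $ Inr 1 = v $ Inr 2" "mod2_act swap_coords v $ Inr 2 = v $ Inr 1"
  "mod2_act (shear k) v $ Inl 1 = v $ Inl 1 + of_int k * v $ Inl 2" "mod2_act (shear k) v $ Inl 2 = v $ Inl 2"
  "mod2_act (shear k) v $ Inr 1 = v $ Inr 1" "mod2_act (shear k) v $ Inr 2 = of_int k * v $ Inr 1 + v $ Inr 2"
  by (simp_all add: matrix_vector_mult_def sum_UNIV_2_2 generator_defs)

lemma cfactor_one: "cfactor (mat 1) \<tau> = mat 1"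
  and siegel_act_one: "siegel_act (mat 1) \<tau> = \<tau>"
proof -
  have b: "block_a (mat 1) = mat 1" "block_b (mat 1) = 0" "block_c (mat 1) = 0" "block_d (mat 1) = mat 1"
    by (simp_all add: block_a_def block_b_def block_c_def block_d_def mat_def vec_eq_iff)
  have m: "map_matrix of_int (mat 1 :: int^2^2) = (mat 1 :: complex^2^2)" "map_matrix of_int (0 :: int^2^2) = (0 :: complex^2^2)"
    by (simp_all add: vec_eq_iff mat_def)
  show "cfactor (mat 1) \<tau> = mat 1" "siegel_act (mat 1) \<tau> = \<tau>"
    by (simp_all add: cfactor_def siegel_act_def b m matrix_inv_unique[of "mat 1" "mat 1"])
qed

lemma theta_rep_one: "theta_rep (mat 1) (mat 1)"
proof -
  have 1: "mod2_act (mat 1) v = v" for v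
  proof -
    have "map_matrix of_int (mat 1 :: mat4) = (mat 1 :: bit^(2 + 2)^(2 + 2))"
      by (simp add: vec_eq_iff mat_def)
    then show ?thesis by simp
  qed
  show ?thesis unfolding theta_rep_def
    by (auto simp: 1 cfactor_one siegel_act_one invertible_def intro!: exI[of _ 1])
qed

lemma theta_rep_trans11:
  "\<exists>\<rho>. theta_rep (trans11 k) \<rho> \<and>
     (\<forall>X \<sigma>. (\<rho> *v X) $ \<sigma> = (if \<sigma> $ 1 = 1 then exp (of_real pi * \<i> / 2 * of_int k) else 1) * X $ \<sigma>)"
proof -
  define E where "E = exp (of_real pi * \<i> / 2 * of_int k)"
  have E: "E \<noteq> 0" "E * E = bit_sign (of_int k)"
    unfolding E_def by (rule exp_not_eq_zero, rule exp_half_pi_i_int_square)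
  have g: "second_order_theta \<sigma> (sym_mat (t1 + of_int k) t2 t3) = (if \<sigma> $ 1 = 1 then E else 1) * second_order_theta \<sigma> (sym_mat t1 t2 t3)" for \<sigma> t1 t2 t3
    by (simp add: second_order_theta_trans11 E_def)
  have "theta_rep (trans11 k) (monomial_matrix (\<lambda>\<sigma>. if \<sigma> $ 1 = 1 then E else 1) (\<lambda>\<sigma>. \<sigma>))"
  proof (rule theta_rep_monomial)
    fix v :: "bit^(2+2)"
    \<comment> \<open>A shift of the first index exchanges the diagonal entries 1 and \<open>E\<close>, and \<open>E * bit_sign (of_int k)\<close> is
the inverse of \<open>E\<close>.\<close>
    let ?c = "if v $ Inr 1 = 0 then 1 else E * bit_sign (of_int k)"
    let ?v = "mod2_act (trans11 k) v"
    show "\<exists>c. c \<noteq> 0 \<and> (\<forall>\<sigma>. shift ?v \<sigma> = shift v \<sigma> \<and>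
       (if \<sigma> $ 1 = 1 then E else 1) * phase v \<sigma> = c * phase ?v \<sigma> * (if shift ?v \<sigma> $ 1 = 1 then E else 1))"
      unfolding phase_def shift_def mod2_act_generators vector_2
    proof (intro exI[of _ ?c] conjI allI)
      show "?c \<noteq> 0" using E(1) by (simp add: bit_sign_def)
      fix \<sigma> :: "bit^2"
      show "(if \<sigma> $ 1 = 1 then E else 1) * bit_sign (v $ Inl 1 * \<sigma> $ 1 + v $ Inl 2 * \<sigma> $ 2) =
       ?c * bit_sign ((v $ Inl 1 + of_int k * v $ Inr 1) * \<sigma> $ 1 + v $ Inl 2 * \<sigma> $ 2) * (if \<sigma> $ 1 + v $ Inr 1 = 1 then E else 1)"
        by (cases "\<sigma> $ 1"; cases "\<sigma> $ 2"; cases "v $ Inr 1"; cases "v $ Inl 1"; cases "v $ Inl 2"; cases "of_int k :: bit";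
            simp add: E)
    qed simp
  next
    fix \<tau> assume "\<tau> \<in> siegel_H2"
    then show "siegel_act (trans11 k) \<tau> \<in> siegel_H2"
      by (metis siegel_H2_cases siegel_act_generators_in_H2(1))
  qed (auto simp: det_cfactor_generators siegel_act_generators g E(1) elim!: siegel_H2_cases)
  then show ?thesis by (intro exI conjI, assumption) (simp add: E_def)
qed

lemma theta_rep_trans12: "\<exists>\<rho>. theta_rep (trans12 k) \<rho>"
proof -
  have "theta_rep (trans12 k) (monomial_matrix (\<lambda>\<sigma>. bit_sign (of_int k * \<sigma> $ 1 * \<sigma> $ 2)) (\<lambda>\<sigma>::bit^2. \<sigma>))"
  proof (rule theta_rep_monomial)
    fix v :: "bit^(2+2)"
    let ?c = "bit_sign (of_int k * v $ Inr 1 * v $ Inr 2)"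
    let ?v = "mod2_act (trans12 k) v"
    show "\<exists>c. c \<noteq> 0 \<and> (\<forall>\<sigma>. shift ?v \<sigma> = shift v \<sigma> \<and>
       bit_sign (of_int k * \<sigma> $ 1 * \<sigma> $ 2) * phase v \<sigma> =
       c * phase ?v \<sigma> * bit_sign (of_int k * shift ?v \<sigma> $ 1 * shift ?v \<sigma> $ 2))"
      unfolding phase_def shift_def mod2_act_generators vector_2
    proof (intro exI[of _ ?c] conjI allI)
      show "?c \<noteq> 0" by (simp add: bit_sign_def)
      fix \<sigma> :: "bit^2"
      show "bit_sign (of_int k * \<sigma> $ 1 * \<sigma> $ 2) * bit_sign (v $ Inl 1 * \<sigma> $ 1 + v $ Inl 2 * \<sigma> $ 2) =
        ?c * bit_sign ((v $ Inl 1 + of_int k * v $ Inr 2) * \<sigma> $ 1 + (v $ Inl 2 + of_int k * v $ Inr 1) * \<sigma> $ 2) *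
        bit_sign (of_int k * (\<sigma> $ 1 + v $ Inr 1) * (\<sigma> $ 2 + v $ Inr 2))"
        by (cases "\<sigma> $ 1"; cases "\<sigma> $ 2"; cases "v $ Inr 1"; cases "v $ Inr 2"; cases "v $ Inl 1"; cases "v $ Inl 2";
            cases "of_int k :: bit"; simp)
    qed simp
  next
    fix \<tau> assume "\<tau> \<in> siegel_H2"
    then show "siegel_act (trans12 k) \<tau> \<in> siegel_H2"
      by (metis siegel_H2_cases siegel_act_generators_in_H2(2))
  next
    show "bit_sign (of_int k * \<sigma> $ 1 * \<sigma> $ 2) \<noteq> 0" for \<sigma> :: "bit^2" by (simp add: bit_sign_def)
  qed (auto simp: det_cfactor_generators siegel_act_generators second_order_theta_trans12 elim!: siegel_H2_cases)
  then show ?thesis ..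
qed

lemma theta_rep_swap:
  "\<exists>\<rho>. theta_rep swap_coords \<rho> \<and> (\<forall>X \<sigma>. (\<rho> *v X) $ \<sigma> = X $ vector [\<sigma> $ 2, \<sigma> $ 1])"
proof -
  define f :: "bit^2 \<Rightarrow> bit^2" where "f = (\<lambda>\<sigma>. vector [\<sigma> $ 2, \<sigma> $ 1])"
  have f: "f \<sigma> $ 1 = \<sigma> $ 2" "f \<sigma> $ 2 = \<sigma> $ 1" for \<sigma> by (simp_all add: f_def)
  have "theta_rep swap_coords (monomial_matrix (\<lambda>\<sigma>. 1) f)"
  proof (rule theta_rep_monomial)
    show "f (f \<sigma>) = \<sigma>" for \<sigma> by (simp add: bit2_eq_iff f)
    fix v :: "bit^(2+2)"
    let ?v = "mod2_act swap_coords v"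
    show "\<exists>c. c \<noteq> 0 \<and> (\<forall>\<sigma>. f (shift ?v \<sigma>) = shift v (f \<sigma>) \<and> 1 * phase v (f \<sigma>) = c * phase ?v \<sigma> * 1)"
      unfolding phase_def shift_def mod2_act_generators bit2_eq_iff f vector_2
      by (rule exI[of _ 1]) (simp add: bit_sign_add mult.commute)
  next
    fix \<tau> assume "\<tau> \<in> siegel_H2"
    then obtain t1 t2 t3 where t: "\<tau> = sym_mat t1 t2 t3" and H: "sym_mat t1 t2 t3 \<in> siegel_H2"
      by (metis siegel_H2_cases)
    show "siegel_act swap_coords \<tau> \<in> siegel_H2" unfolding t by (rule siegel_act_generators_in_H2(4)[OF H])
    show "second_order_theta \<sigma> (siegel_act swap_coords \<tau>) = 1 * second_order_theta (f \<sigma>) \<tau>" for \<sigma>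
      unfolding t siegel_act_generators f_def mult_1_left by (rule second_order_theta_swap)
  qed (simp_all add: det_cfactor_generators)
  then show ?thesis by (intro exI conjI, assumption) (simp add: f_def)
qed

lemma theta_rep_shear: "\<exists>\<rho>. theta_rep (shear k) \<rho>"
proof -
  define f :: "bit^2 \<Rightarrow> bit^2" where "f = (\<lambda>\<sigma>. vector [\<sigma> $ 1, of_int k * \<sigma> $ 1 + \<sigma> $ 2])"
  have f: "f \<sigma> $ 1 = \<sigma> $ 1" "f \<sigma> $ 2 = of_int k * \<sigma> $ 1 + \<sigma> $ 2" for \<sigma> by (simp_all add: f_def)
  have bit: "x + (x + y) = y" for x y :: bit by (cases x; cases y; simp)
  have "theta_rep (shear k) (monomial_matrix (\<lambda>\<sigma>. 1) f)"
  proof (rule theta_rep_monomial)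
    show "f (f \<sigma>) = \<sigma>" for \<sigma> by (simp only: bit2_eq_iff f bit simp_thms)
    fix v :: "bit^(2+2)"
    let ?v = "mod2_act (shear k) v"
    show "\<exists>c. c \<noteq> 0 \<and> (\<forall>\<sigma>. f (shift ?v \<sigma>) = shift v (f \<sigma>) \<and> 1 * phase v (f \<sigma>) = c * phase ?v \<sigma> * 1)"
      unfolding phase_def shift_def mod2_act_generators bit2_eq_iff f vector_2
    proof (intro exI[of _ 1] conjI allI)
      fix \<sigma> :: "bit^2"
      show "of_int k * (\<sigma> $ 1 + v $ Inr 1) + (\<sigma> $ 2 + (of_int k * v $ Inr 1 + v $ Inr 2)) = of_int k * \<sigma> $ 1 + \<sigma> $ 2 + v $ Inr 2"
        by (cases "of_int k :: bit"; cases "v $ Inr 1"; cases "v $ Inr 2"; cases "\<sigma> $ 1"; cases "\<sigma> $ 2"; simp)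
      show "1 * bit_sign (v $ Inl 1 * \<sigma> $ 1 + v $ Inl 2 * (of_int k * \<sigma> $ 1 + \<sigma> $ 2)) =
          1 * bit_sign ((v $ Inl 1 + of_int k * v $ Inl 2) * \<sigma> $ 1 + v $ Inl 2 * \<sigma> $ 2) * 1"
        by (cases "of_int k :: bit"; cases "\<sigma> $ 1"; cases "v $ Inl 1"; cases "v $ Inl 2"; simp)
    qed simp_all
  next
    fix \<tau> assume "\<tau> \<in> siegel_H2"
    then obtain t1 t2 t3 where t: "\<tau> = sym_mat t1 t2 t3" and H: "sym_mat t1 t2 t3 \<in> siegel_H2"
      by (metis siegel_H2_cases)
    show "siegel_act (shear k) \<tau> \<in> siegel_H2" unfolding t by (rule siegel_act_generators_in_H2(5)[OF H])
    show "second_order_theta \<sigma> (siegel_act (shear k) \<tau>) = 1 * second_order_theta (f \<sigma>) \<tau>" for \<sigma>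
      unfolding t siegel_act_generators f_def mult_1_left by (rule second_order_theta_shear)
  qed (simp_all add: det_cfactor_generators)
  then show ?thesis ..
qed

text \<open>The Fourier transform in the first coordinate exchanges signs and shifts in that coordinate.\<close>

lemma partial_inversion_heisenberg_identity:
  fixes X :: "complex^(bit^2)"
  shows "bit_sign (b1 * 0 + b2 * s2) * X $ vector [0 + a1, s2 + a2] + bit_sign s1 * (bit_sign (b1 * 1 + b2 * s2) * X $ vector [1 + a1, s2 + a2]) =
    bit_sign (b1 * a1) * (bit_sign (a1 * s1 + b2 * s2) * (X $ vector [0, s2 + a2] + bit_sign (s1 + b1) * X $ vector [1, s2 + a2]))"
proof -
  have "S * Y (0 + a1) + bit_sign s1 * (bit_sign b1 * S * Y (1 + a1)) =
    bit_sign (b1 * a1) * (bit_sign (a1 * s1) * S * (Y 0 + bit_sign (s1 + b1) * Y 1))" for S and Y :: "bit \<Rightarrow> complex"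
    by (cases b1; cases a1; cases s1; simp add: algebra_simps)
  from this[of "bit_sign (b2 * s2)" "\<lambda>x. X $ vector [x, s2 + a2]"] show ?thesis
    by (simp only: bit_sign_add mult_zero_right mult_1_right bit_sign_simps mult_1_left)
qed

lemma theta_rep_partial_inversion:
  "\<exists>\<rho>. theta_rep partial_inversion \<rho> \<and> (\<forall>X \<sigma>. (\<rho> *v X) $ \<sigma> = X $ vector [0, \<sigma> $ 2] + bit_sign (\<sigma> $ 1) * X $ vector [1, \<sigma> $ 2])"
proof -
  define \<rho> :: "complex^(bit^2)^(bit^2)" where "\<rho> = monomial_matrix (\<lambda>\<sigma>. 1) (\<lambda>\<sigma>. vector [0, \<sigma> $ 2]) + monomial_matrix (\<lambda>\<sigma>. bit_sign (\<sigma> $ 1)) (\<lambda>\<sigma>. vector [1, \<sigma> $ 2])"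
  have r: "(\<rho> *v X) $ \<sigma> = X $ vector [0, \<sigma> $ 2] + bit_sign (\<sigma> $ 1) * X $ vector [1, \<sigma> $ 2]" for X \<sigma>
    by (simp add: \<rho>_def matrix_vector_mult_add_rdistrib)
  have v: "vector [\<sigma> $ 1, \<sigma> $ 2] = \<sigma>" for \<sigma> :: "bit^2" by (simp add: bit2_eq_iff)
  have "theta_rep partial_inversion \<rho>"
    unfolding theta_rep_def
  proof (intro conjI allI)
    show "invertible \<rho>"
    proof (rule invertibleI_inj, rule injI)
      fix X Y assume eq: "\<rho> *v X = \<rho> *v Y"
      have rr: "(\<rho> *v (\<rho> *v X)) $ \<sigma> = 2 * X $ \<sigma>" for X \<sigma>
      proof (cases "\<sigma> $ 1")
        case zero
        then show ?thesis using v[of \<sigma>] by (simp add: r)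
      next
        case one
        then show ?thesis using v[of \<sigma>] by (simp add: r)
      qed
      have "2 * X $ \<sigma> = 2 * Y $ \<sigma>" for \<sigma> unfolding rr[symmetric] eq ..
      then show "X = Y" by (simp add: vec_eq_iff)
    qed
    show "\<exists>\<zeta>. \<zeta> \<noteq> 0 \<and> (\<forall>\<tau>\<in>siegel_H2. siegel_act partial_inversion \<tau> \<in> siegel_H2 \<and> det (cfactor partial_inversion \<tau>) \<noteq> 0 \<and>
        (\<exists>\<kappa>. \<kappa> ^ 4 = \<zeta> * det (cfactor partial_inversion \<tau>) ^ 2 \<and> Theta (siegel_act partial_inversion \<tau>) = \<kappa> *s (\<rho> *v Theta \<tau>)))"
    \<comment> \<open>The constant is the value of \<open>A\<^sup>2 / t1\<^sup>2\<close> for \<open>A = t1/(2\<i>)\<close>.\<close>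
    proof (rule exI[of _ "- 1 / 4"], intro conjI ballI)
      fix \<tau> assume "\<tau> \<in> siegel_H2"
      then obtain t1 t2 t3 where t: "\<tau> = sym_mat t1 t2 t3" and p: "0 < Im t1" "(Im t2)\<^sup>2 < Im t1 * Im t3"
        by (metis siegel_H2_cases)
      have H: "sym_mat t1 t2 t3 \<in> siegel_H2" using p by (simp add: sym_mat_in_H2_iff)
      have t0: "t1 \<noteq> 0" using p(1) by auto
      show "siegel_act partial_inversion \<tau> \<in> siegel_H2" unfolding t by (rule siegel_act_generators_in_H2(3)[OF H])
      show "det (cfactor partial_inversion \<tau>) \<noteq> 0" using t0 by (simp add: t det_cfactor_generators)
      show "\<exists>\<kappa>. \<kappa> ^ 4 = - 1 / 4 * det (cfactor partial_inversion \<tau>) ^ 2 \<and> Theta (siegel_act partial_inversion \<tau>) = \<kappa> *s (\<rho> *v Theta \<tau>)"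
      proof (intro exI[of _ "csqrt (t1 / (2 * \<i>))"] conjI)
        have "x ^ 4 = (x ^ 2) ^ 2" for x :: complex by (simp add: power_mult[symmetric])
        then have "csqrt (t1 / (2 * \<i>)) ^ 4 = (t1 / (2 * \<i>)) ^ 2" by (simp only: power2_csqrt)
        also have "\<dots> = - 1 / 4 * t1 ^ 2" by (simp add: power_divide power_mult_distrib)
        finally show "csqrt (t1 / (2 * \<i>)) ^ 4 = - 1 / 4 * det (cfactor partial_inversion \<tau>) ^ 2"
          by (simp add: t det_cfactor_generators)
        show "Theta (siegel_act partial_inversion \<tau>) = csqrt (t1 / (2 * \<i>)) *s (\<rho> *v Theta \<tau>)"
          by (rule vec_eq_iff[THEN iffD2])
             (simp only: Theta_def vec_lambda_beta vector_smult_component r t siegel_act_generators(3)[OF t0]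
               second_order_theta_inversion[OF p] simp_thms)
      qed
    qed simp
    fix w :: "bit^(2+2)"
    show "\<exists>c. c \<noteq> 0 \<and> (\<forall>X. \<rho> *v heisenberg w X = c *s heisenberg (mod2_act partial_inversion w) (\<rho> *v X))"
    proof (intro exI[of _ "bit_sign (w $ Inl 1 * w $ Inr 1)"] conjI allI)
      fix X
      have "(\<rho> *v heisenberg w X) $ \<sigma> = bit_sign (w $ Inl 1 * w $ Inr 1) * heisenberg (mod2_act partial_inversion w) (\<rho> *v X) $ \<sigma>" for \<sigma>
        unfolding r heisenberg_nth phase_def shift_def mod2_act_generators vector_2
        by (rule partial_inversion_heisenberg_identity)
      then show "\<rho> *v heisenberg w X = bit_sign (w $ Inl 1 * w $ Inr 1) *s heisenberg (mod2_act partial_inversion w) (\<rho> *v X)"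
        by (simp add: vec_eq_iff[where 'b = "bit^2"])
    qed (simp add: bit_sign_def)
  qed
  then show ?thesis using r by blast
qed

text \<open>The property is multiplicative and holds for the generators.\<close>

theorem theta_rep_exists:
  assumes "M \<in> carrier Gamma2"
  shows "\<exists>\<rho>. theta_rep M \<rho>"
  using Gamma2_generated[OF assms]
proof induction
  case one
  then show ?case using theta_rep_one by blast
qed (metis theta_rep_mult theta_rep_trans11, metis theta_rep_mult theta_rep_trans12,
  metis theta_rep_mult theta_rep_partial_inversion, metis theta_rep_mult theta_rep_swap,
  metis theta_rep_mult theta_rep_shear)


section \<open>The form as a polynomial in the theta constants\<close>

definition theta_square_poly :: "characteristic \<Rightarrow> complex^(bit^2) \<Rightarrow> complex" where
  "theta_square_poly m X = (\<Sum>\<sigma>\<in>UNIV. bit_sign (snd m $ 1 * \<sigma> $ 1 + snd m $ 2 * \<sigma> $ 2) * X $ \<sigma> * X $ (\<sigma> + fst m))"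

text \<open>The form \<open>(azy)\<^sub>5\<close> with each twentieth power of a theta constant written as the tenth power of the
quadratic form that represents its square.\<close>

definition azy5_poly :: "(characteristic set \<Rightarrow> int) \<Rightarrow> complex^(bit^2) \<Rightarrow> complex" where
  "azy5_poly s X = (\<Sum>T\<in>C3_minus. 1 / 8 * of_int (s T) * (\<Prod>m\<in>T. theta_square_poly m X ^ 10))"

lemma homogeneous_theta_square_poly: "homogeneous 2 (theta_square_poly m)"
proof -
  have "homogeneous (Suc 1) (\<lambda>X. X $ \<sigma> * X $ (\<sigma> + fst m))" for \<sigma>
    by (intro homogeneous_times_coord homogeneous_coord)
  then have "homogeneous 2 (\<lambda>X. \<Sum>\<sigma>\<in>UNIV. bit_sign (snd m $ 1 * \<sigma> $ 1 + snd m $ 2 * \<sigma> $ 2) * (X $ \<sigma> * X $ (\<sigma> + fst m)))"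
    by (intro homogeneous_sum homogeneous_cmult) (simp_all add: numeral_2_eq_2)
  then show ?thesis by (simp add: theta_square_poly_def[abs_def] mult.assoc)
qed

lemma homogeneous_azy5_poly: "homogeneous 60 (azy5_poly s)"
proof -
  have "homogeneous 60 (\<lambda>X. \<Prod>m\<in>T. theta_square_poly m X ^ 10)" if "T \<in> C3_minus" for T
  proof -
    have T: "card T = 3" "finite T" using that by (auto simp: C3_minus_def)
    have "homogeneous (10 * 2) (\<lambda>X. theta_square_poly m X ^ 10)" for m
      by (intro homogeneous_power homogeneous_theta_square_poly)
    then have "homogeneous (card T * 20) (\<lambda>X. \<Prod>m\<in>T. theta_square_poly m X ^ 10)"
      by (intro homogeneous_prod T) simp
    then show ?thesis by (simp add: T)
  qed
  then show ?thesis
    unfolding azy5_poly_def[abs_def] by (intro homogeneous_sum homogeneous_cmult) auto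
qed

lemma azy5_eq_poly:
  assumes "\<tau> \<in> siegel_H2"
  shows "azy5 s \<tau> = azy5_poly s (Theta \<tau>)"
proof -
  obtain t1 t2 t3 where t: "\<tau> = sym_mat t1 t2 t3" "0 < Im t1" "(Im t2)\<^sup>2 < Im t1 * Im t3"
    using siegel_H2_cases[OF assms] by blast
  have sq: "(theta_const m \<tau>)\<^sup>2 = theta_square_poly m (Theta \<tau>)" for m
    unfolding t(1) theta_const_square[OF t(2,3)] by (simp add: theta_square_poly_def Theta_def)
  have "(\<Prod>m\<in>T. theta_const m \<tau>) ^ 20 = (\<Prod>m\<in>T. theta_square_poly m (Theta \<tau>) ^ 10)" for T
  proof -
    have "theta_const m \<tau> ^ 20 = theta_square_poly m (Theta \<tau>) ^ 10" for m
      unfolding sq[symmetric] by (simp flip: power_mult)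
    then show ?thesis by (simp add: prod_power_distrib)
  qed
  then show ?thesis by (simp add: azy5_def azy5_poly_def sum_distrib_left mult.assoc)
qed


section \<open>The mirror of an involution\<close>

text \<open>As \<open>s \<rightarrow> \<infinity>\<close> along this curve, a theta constant decays like its terms of smallest exponent \<open>\<mu>\<close>. The
off-diagonal entry \<open>1/2\<close> gives these terms the phase \<open>exp (\<pi>\<i> p\<^sub>1p\<^sub>2/2)\<close>, which is 1 when they lie on
the axes, so they cannot cancel: the limit is their number.\<close>

lemma tendsto_second_order_theta_cusp:
  fixes \<mu> :: int and N :: nat
  assumes N: "N > 0"
    and min: "\<And>p. p \<in> parity_lattice \<sigma> \<Longrightarrow> \<mu> \<le> (fst p)\<^sup>2 + int N * (snd p)\<^sup>2"
    and axis: "\<And>p. p \<in> parity_lattice \<sigma> \<Longrightarrow> (fst p)\<^sup>2 + int N * (snd p)\<^sup>2 = \<mu> \<Longrightarrow> fst p * snd p = 0"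
    and ex: "p0 \<in> parity_lattice \<sigma>" "(fst p0)\<^sup>2 + int N * (snd p0)\<^sup>2 = \<mu>"
  shows "\<exists>L. L \<noteq> 0 \<and> ((\<lambda>s. second_order_theta \<sigma> (sym_mat (\<i> * of_real s) (1 / 2) (\<i> * of_real (real N * s))) /
      of_real (exp (- pi / 2 * s * of_int \<mu>))) \<longlongrightarrow> L) at_top"
proof -
  define w where "w = (\<lambda>p::int \<times> int. (fst p)\<^sup>2 + int N * (snd p)\<^sup>2)"
  let ?q = "\<lambda>p s. gauss_term (\<i> * of_real s) (1 / 2) (\<i> * of_real (real N * s)) p"
  let ?f = "\<lambda>p s. ?q p s * of_real (exp (pi / 2 * s * of_int \<mu>))"
  let ?g = "\<lambda>p. if w p = \<mu> then 1 else 0 :: complex"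
  have q: "?f p s = exp (of_real pi * \<i> / 2 * of_int (fst p * snd p)) * of_real (exp (- pi / 2 * s * of_int (w p - \<mu>)))" for p s
    unfolding gauss_term_def exp_of_real[symmetric] exp_add[symmetric]
    by (rule arg_cong[where f = exp]) (simp add: w_def field_simps)
  have nf: "norm (?f p s) = exp (- pi / 2 * s * of_int (w p - \<mu>))" for p s
    unfolding q norm_mult norm_exp_eq_Re by simp
  have "((\<lambda>s. \<Sum>\<^sub>\<infinity>p\<in>parity_lattice \<sigma>. ?f p s) \<longlongrightarrow> (\<Sum>\<^sub>\<infinity>p\<in>parity_lattice \<sigma>. ?g p)) at_top"
  proof (rule tendsto_infsum_dominated)
    fix p assume p: "p \<in> parity_lattice \<sigma>"
    show "((\<lambda>s. ?f p s) \<longlongrightarrow> ?g p) at_top"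
    proof (cases "w p = \<mu>")
      case True
      then have "fst p * snd p = 0" using axis[OF p] by (simp only: w_def)
      then have "?f p s = 1" for s unfolding q using True by (simp del: mult_eq_0_iff)
      then show ?thesis using True by simp
    next
      case False
      then have "w p - \<mu> > 0" using min[OF p] by (simp add: w_def)
      then have pos: "real_of_int (w p - \<mu>) > 0" by linarith
      define c where "c = pi / 2 * real_of_int (w p - \<mu>)"
      have "c > 0" using pos by (simp add: c_def)
      then have "((\<lambda>s. exp (- c * s)) \<longlongrightarrow> 0) at_top" by real_asymp
      then have "((\<lambda>s. norm (?f p s)) \<longlongrightarrow> 0) at_top" unfolding nf by (simp add: c_def mult_ac)
      then show ?thesis using False by (simp add: tendsto_norm_zero_iff)
    qed
  next
    show "\<forall>\<^sub>F s in at_top. \<forall>p\<in>parity_lattice \<sigma>. norm (?f p s) \<le> norm (?f p 1)"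
      using eventually_ge_at_top[of 1]
    proof (eventually_elim, intro ballI)
      fix s :: real and p assume s: "1 \<le> s" and p: "p \<in> parity_lattice \<sigma>"
      have "0 \<le> w p - \<mu>" using min[OF p] by (simp add: w_def)
      then have "0 \<le> real_of_int (w p - \<mu>)" by (simp only: of_int_0_le_iff)
      then have "pi / 2 * 1 * of_int (w p - \<mu>) \<le> pi / 2 * s * of_int (w p - \<mu>)"
        using s by (intro mult_right_mono mult_left_mono) auto
      then show "norm (?f p s) \<le> norm (?f p 1)" unfolding nf by simp
    qed
    have "(\<lambda>p. norm (?q p 1)) summable_on parity_lattice \<sigma>"
      by (rule summable_gauss_term) (use N in simp_all)
    then show "(\<lambda>p. norm (?f p 1)) summable_on parity_lattice \<sigma>"
      unfolding norm_mult by (rule summable_on_cmult_left)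
  qed simp
  moreover have "(\<Sum>\<^sub>\<infinity>p\<in>parity_lattice \<sigma>. ?f p s) = second_order_theta \<sigma> (sym_mat (\<i> * of_real s) (1 / 2) (\<i> * of_real (real N * s))) /
      of_real (exp (- pi / 2 * s * of_int \<mu>))" for s
    unfolding second_order_theta_sym_mat infsum_cmult_left' by (simp add: exp_minus field_simps)
  moreover have "(\<Sum>\<^sub>\<infinity>p\<in>parity_lattice \<sigma>. ?g p) \<noteq> 0"
  proof -
    let ?S = "{p \<in> parity_lattice \<sigma>. w p = \<mu>}"
    have "?S \<subseteq> {- \<mu>..\<mu>} \<times> {- \<mu>..\<mu>}"
    proof
      fix p assume "p \<in> ?S"
      then have e: "(fst p)\<^sup>2 + int N * (snd p)\<^sup>2 = \<mu>" by (simp add: w_def)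
      have sq: "\<bar>x\<bar> \<le> x\<^sup>2" for x :: int
        using mult_left_mono[of 1 "\<bar>x\<bar>" "\<bar>x\<bar>"] by (cases "x = 0") (auto simp: power2_eq_square)
      have "(snd p)\<^sup>2 \<le> int N * (snd p)\<^sup>2" using N by (simp add: mult_le_cancel_right1)
      then have "\<bar>fst p\<bar> \<le> \<mu>" "\<bar>snd p\<bar> \<le> \<mu>"
        using sq[of "fst p"] sq[of "snd p"] e zero_le_power2[of "fst p"] zero_le_power2[of "snd p"] by linarith+
      then show "p \<in> {- \<mu>..\<mu>} \<times> {- \<mu>..\<mu>}" by (cases p) auto
    qed
    then have fin: "finite ?S" by (rule finite_subset) simp
    have "(\<Sum>\<^sub>\<infinity>p\<in>parity_lattice \<sigma>. ?g p) = (\<Sum>\<^sub>\<infinity>p\<in>?S. 1)"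
      by (rule infsum_cong_neutral) auto
    also have "\<dots> = of_nat (card ?S)" using fin by simp
    finally have "(\<Sum>\<^sub>\<infinity>p\<in>parity_lattice \<sigma>. ?g p) = of_nat (card ?S)" .
    moreover have "p0 \<in> ?S" using ex by (simp add: w_def)
    then have "card ?S \<noteq> 0" using fin card_0_eq by blast
    ultimately show ?thesis by (simp only: of_nat_eq_0_iff not_False_eq_True)
  qed
  ultimately show ?thesis by auto
qed

text \<open>The function is even in \<open>\<tau>\<^sub>2\<close> and changes sign under \<open>\<tau>\<^sub>2 \<mapsto> \<tau>\<^sub>2 - 1\<close>; these two maps exchange \<open>1/2\<close> and
\<open>-1/2\<close>.\<close>

lemma second_order_theta_11_half: "second_order_theta (vector [1, 1]) (sym_mat t1 (1 / 2) t3) = 0"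
proof -
  have "second_order_theta (vector [1, 1]) (sym_mat t1 (- (1 / 2)) t3) = second_order_theta (vector [1, 1]) (sym_mat t1 (1 / 2) t3)"
    unfolding second_order_theta_sym_mat
    by (rule infsum_reindex_bij_witness[of _ "\<lambda>p. (fst p, - snd p)" "\<lambda>p. (fst p, - snd p)"])
       (auto simp: parity_lattice_def parity_class_iff gauss_term_def)
  moreover have "second_order_theta (vector [1, 1]) (sym_mat t1 (1 / 2 + of_int (-1)) t3) = - second_order_theta (vector [1, 1]) (sym_mat t1 (1 / 2) t3)"
    unfolding second_order_theta_trans12 by simp
  ultimately show ?thesis by simp
qed

text \<open>The involution \<open>\<tau>\<^sub>2 \<mapsto> 1 - \<tau>\<^sub>2\<close>, which fixes the divisor \<open>\<tau>\<^sub>2 = 1/2\<close>.\<close>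

definition mirror :: mat4 where
  "mirror = blocks (mat2 1 0 0 (-1)) (mat2 0 (-1) 1 0) (mat2 0 0 0 0) (mat2 1 0 0 (-1))"

lemma mirror_in_Gamma2: "mirror \<in> carrier Gamma2"
  unfolding in_Gamma2_iff forall_2_2 by (simp add: mirror_def col_pairing_def)

lemma det_cfactor_mirror: "det (cfactor mirror \<tau>) = -1"
  and siegel_act_mirror: "siegel_act mirror (sym_mat t1 t2 t3) = sym_mat t1 (1 - t2) t3"
proof -
  have c: "cfactor mirror \<tau> = mat2 1 0 0 (-1)" for \<tau>
    by (simp add: cfactor_def mirror_def map_matrix_mat2 mat2_eq_iff matrix_matrix_mult_def sum_2)
  then show "det (cfactor mirror \<tau>) = -1" by (simp add: det_mat2)
  have "matrix_inv (mat2 1 0 0 (-1)) = (mat2 1 0 0 (-1) :: complex^2^2)"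
    by (simp add: matrix_inv_mat2)
  then show "siegel_act mirror (sym_mat t1 t2 t3) = sym_mat t1 (1 - t2) t3"
    unfolding siegel_act_numerator c
    by (simp add: numerator_def mirror_def map_matrix_mat2 sym_mat_def mat2_mult mat2_add)
qed

abbreviation charac :: "bit \<Rightarrow> bit \<Rightarrow> bit \<Rightarrow> bit \<Rightarrow> characteristic" where
  "charac x1 x2 y1 y2 \<equiv> (vector [x1, x2], vector [y1, y2])"

lemma charac_exhaust: obtains x1 x2 y1 y2 where "m = charac x1 x2 y1 y2"
  by (metis bit2_exhaust prod.exhaust)

lemma char_act_mirror: "char_act mirror (charac x1 x2 y1 y2) = charac x1 x2 (y1 + x2) (y2 + x1)"
  by (simp add: char_act_def mirror_def bit2_eq_iff map_matrix_mat2 matrix_vector_mult_def sum_2 Let_def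
      matrix_matrix_mult_def Finite_Cartesian_Product.transpose_def add.commute)

lemma charac_odd_iff: "charac x1 x2 y1 y2 \<in> odd_chars \<longleftrightarrow> x1 * y1 + x2 * y2 = 1"
  by (cases x1; cases x2; cases y1; cases y2; simp add: odd_chars_def parity_def sum_2)

text \<open>The upper characteristic is fixed, and each of its three non-zero values carries two odd
characteristics, which are exchanged. Three transpositions are an odd permutation.\<close>

lemma chi_P_mirror: "chi_P mirror = -1"
proof -
  let ?t1 = "Transposition.transpose (charac 1 0 1 0) (charac 1 0 1 1)"
    and ?t2 = "Transposition.transpose (charac 0 1 0 1) (charac 0 1 1 1)"
    and ?t3 = "Transposition.transpose (charac 1 1 1 0) (charac 1 1 0 1)"
  have ne: "vector [x, y] = (vector [x', y'] :: bit^2) \<longleftrightarrow> x = x' \<and> y = y'" for x y x' y'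
    by (simp add: bit2_eq_iff)
  have tr: "Transposition.transpose a b c = (if c = a then b else if c = b then a else c)" for a b c :: characteristic
    by (simp add: Transposition.transpose_def)
  have "psi_P mirror = ?t1 \<circ> (?t2 \<circ> ?t3)"
  proof
    fix m :: characteristic
    obtain x1 x2 y1 y2 where m: "m = charac x1 x2 y1 y2" by (rule charac_exhaust)
    show "psi_P mirror m = (?t1 \<circ> (?t2 \<circ> ?t3)) m"
      unfolding m psi_P_def char_act_mirror charac_odd_iff o_apply
      by (cases x1; cases x2; cases y1; cases y2; simp add: tr ne)
  qed
  moreover have "sign (?t1 \<circ> (?t2 \<circ> ?t3)) = -1"
    by (simp add: sign_compose permutation_compose permutation_swap_id sign_swap_id ne)
  ultimately show ?thesis by (simp add: chi_P_def)
qed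

text \<open>At a fixed point the transformation law reads \<open>f = - f\<close>, since \<open>det (c\<tau> + d)\<^sup>3\<^sup>0 = 1\<close>.\<close>

lemma azy5_zero_on_mirror:
  assumes "azy5_signs s" and \<tau>: "sym_mat t1 (1 / 2) t3 \<in> siegel_H2"
  shows "azy5 s (sym_mat t1 (1 / 2) t3) = 0"
proof -
  have "azy5 s (siegel_act mirror (sym_mat t1 (1 / 2) t3)) =
      of_int (chi_P mirror) * det (cfactor mirror (sym_mat t1 (1 / 2) t3)) ^ 30 * azy5 s (sym_mat t1 (1 / 2) t3)"
    using assms mirror_in_Gamma2 unfolding azy5_signs_def modular_form_def by blast
  then show ?thesis by (simp add: siegel_act_mirror det_cfactor_mirror chi_P_mirror)
qed

text \<open>On the divisor \<open>\<tau>\<^sub>2 = 1/2\<close> the other three theta constants are algebraically independent as homogeneous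
coordinates. Along the curve \<open>\<tau>\<^sub>1 = \<i>s\<close>, \<open>\<tau>\<^sub>3 = \<i>Ns\<close> they behave like \<open>1\<close>, \<open>E\<close> and \<open>E\<^sup>N\<close> up to non-zero
constants, with \<open>E = exp (-\<pi>s/2)\<close>, and \<open>N\<close> exceeds the degree.\<close>

lemma homogeneous_zero_if_zero_on_mirror:
  assumes f: "homogeneous d f"
    and zero: "\<And>t1 t3. sym_mat t1 (1 / 2) t3 \<in> siegel_H2 \<Longrightarrow> f (Theta (sym_mat t1 (1 / 2) t3)) = 0"
    and Y: "Y $ vector [1, 1] = 0"
  shows "f Y = 0"
proof -
  \<comment> \<open>\<open>N\<close> has to exceed the degree, and 1 so that the smallest exponents lie on the axes.\<close>
  define N where "N = d + 2"
  have N: "N > 1" "N > 0" by (simp_all add: N_def)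
  define E where "E = (\<lambda>s::real. complex_of_real (exp (- pi / 2 * s)))"
  define X where "X = (\<lambda>s::real. Theta (sym_mat (\<i> * of_real s) (1 / 2) (\<i> * of_real (real N * s))))"
  have sq: "of_bool (odd x) \<le> x\<^sup>2" for x :: int
    by (cases "x = 0") (auto simp: int_one_le_iff_zero_less)
  have X11: "X s $ vector [1, 1] = 0" for s
    by (simp add: X_def Theta_def second_order_theta_11_half)
  have L0: "\<exists>L. L \<noteq> 0 \<and> ((\<lambda>s. X s $ vector [0, 0] / of_real (exp (- pi / 2 * s * of_int 0))) \<longlongrightarrow> L) at_top"
    unfolding X_def Theta_def vec_lambda_beta
    by (rule tendsto_second_order_theta_cusp[OF N(2), of _ _ "(0, 0)"])
       (auto simp: parity_lattice_def parity_class_iff add_nonneg_eq_0_iff)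
  have L1: "\<exists>L. L \<noteq> 0 \<and> ((\<lambda>s. X s $ vector [1, 0] / of_real (exp (- pi / 2 * s * of_int 1))) \<longlongrightarrow> L) at_top"
    unfolding X_def Theta_def vec_lambda_beta
  proof (rule tendsto_second_order_theta_cusp[OF N(2), of _ _ "(1, 0)"])
    fix p assume "p \<in> parity_lattice (vector [1, 0])"
    then have o: "odd (fst p)" by (auto simp: parity_lattice_def parity_class_iff of_int_bit split: if_splits)
    have fst1: "1 \<le> (fst p)\<^sup>2" using sq[of "fst p"] o by simp
    have "0 \<le> int N * (snd p)\<^sup>2" by simp
    with fst1 show "1 \<le> (fst p)\<^sup>2 + int N * (snd p)\<^sup>2" by linarith
    assume "(fst p)\<^sup>2 + int N * (snd p)\<^sup>2 = 1"
    with fst1 have "int N * (snd p)\<^sup>2 \<le> 0" by linarith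
    then show "fst p * snd p = 0" using N by (simp add: mult_le_0_iff)
  qed (auto simp: parity_lattice_def parity_class_iff)
  have L2: "\<exists>L. L \<noteq> 0 \<and> ((\<lambda>s. X s $ vector [0, 1] / of_real (exp (- pi / 2 * s * of_int (int N)))) \<longlongrightarrow> L) at_top"
    unfolding X_def Theta_def vec_lambda_beta
  proof (rule tendsto_second_order_theta_cusp[OF N(2), of _ _ "(0, 1)"])
    fix p assume "p \<in> parity_lattice (vector [0, 1])"
    then have o: "odd (snd p)" by (auto simp: parity_lattice_def parity_class_iff of_int_bit split: if_splits)
    have "int N * 1 \<le> int N * (snd p)\<^sup>2" using sq[of "snd p"] o by (intro mult_left_mono) auto
    moreover have "0 \<le> (fst p)\<^sup>2" by simp
    ultimately show "int N \<le> (fst p)\<^sup>2 + int N * (snd p)\<^sup>2" by linarith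
    assume "(fst p)\<^sup>2 + int N * (snd p)\<^sup>2 = int N"
    with \<open>int N * 1 \<le> int N * (snd p)\<^sup>2\<close> have "(fst p)\<^sup>2 \<le> 0" by linarith
    then show "fst p * snd p = 0" by simp
  qed (auto simp: parity_lattice_def parity_class_iff)
  obtain La where La: "La \<noteq> 0" "((\<lambda>s. X s $ vector [0, 0]) \<longlongrightarrow> La) at_top" using L0 by auto
  obtain Lb where Lb: "Lb \<noteq> 0" "((\<lambda>s. X s $ vector [1, 0] / E s) \<longlongrightarrow> Lb) at_top" using L1 by (auto simp: E_def)
  have EN: "of_real (exp (- pi / 2 * s * of_int (int N))) = E s ^ N" for s
    unfolding E_def of_real_power[symmetric] exp_of_nat_mult[symmetric] by (simp add: mult_ac)
  obtain Lc where Lc: "Lc \<noteq> 0" "((\<lambda>s. X s $ vector [0, 1] / E s ^ N) \<longlongrightarrow> Lc) at_top"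
    using L2 unfolding EN by blast
  have E0: "(E \<longlongrightarrow> 0) at_top"
  proof -
    have "((\<lambda>s::real. exp (- pi / 2 * s)) \<longlongrightarrow> 0) at_top" by real_asymp
    then show ?thesis unfolding E_def by (rule tendsto_of_real[where 'a = complex, of _ 0, simplified])
  qed
  have rest: "i = vector [1, 1]" if "i \<noteq> vector [0, 0]" "i \<noteq> vector [1, 0]" "i \<noteq> vector [0, 1]" for i :: "bit^2"
    using that by (cases "i $ 1"; cases "i $ 2"; simp add: bit2_eq_iff)
  show ?thesis
  proof (rule homogeneous_zero_on_space[of "vector [0, 0]" "vector [1, 0]" "vector [0, 1]" E X La Lb N Lc d f Y])
    show "\<forall>\<^sub>F s in at_top. f (X s) = 0"
      using eventually_gt_at_top[of 0]
    proof eventually_elim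
      case (elim s)
      then have "sym_mat (\<i> * of_real s) (1 / 2) (\<i> * of_real (real N * s)) \<in> siegel_H2"
        using N by (simp add: sym_mat_in_H2_iff)
      then show ?case unfolding X_def by (rule zero)
    qed
    show "X s $ i = 0" if "i \<noteq> vector [0, 0]" "i \<noteq> vector [1, 0]" "i \<noteq> vector [0, 1]" for s i
      using rest[OF that] X11 by simp
    show "Y $ i = 0" if "i \<noteq> vector [0, 0]" "i \<noteq> vector [1, 0]" "i \<noteq> vector [0, 1]" for i
      using rest[OF that] Y by simp
  qed (use f La Lb Lc E0 in \<open>simp_all add: E_def N_def bit2_eq_iff\<close>)
qed


section \<open>The sixty mirrors\<close>

lemma scalar_product_row: "scalar_product (A $ i) X = (A *v X) $ i"
  by (simp add: scalar_product_def matrix_vector_mult_def)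

lemma invertible_surj:
  fixes A :: "complex^'n^'n"
  assumes "invertible A"
  obtains X where "A *v X = Y"
proof -
  obtain B where "A ** B = mat 1" using assms unfolding invertible_def by blast
  then have "A *v (B *v Y) = Y" by (simp add: matrix_vector_mul_assoc)
  then show ?thesis using that by blast
qed

lemma chi_P_cases: "chi_P M = 1 \<or> chi_P M = -1"
  by (simp add: chi_P_def sign_def)

lemma theta_rep_act_inverse:
  assumes M: "M \<in> carrier Gamma2" "theta_rep M \<rho>" and t: "\<tau> \<in> siegel_H2"
  shows "siegel_act M (siegel_act (symplectic_inverse M) \<tau>) = \<tau>" "siegel_act (symplectic_inverse M) \<tau> \<in> siegel_H2"
proof -
  obtain \<rho>' where r: "theta_rep (symplectic_inverse M) \<rho>'"
    using theta_rep_exists[OF symplectic_inverse(3)[OF M(1)]] by blast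
  show H: "siegel_act (symplectic_inverse M) \<tau> \<in> siegel_H2" using r t unfolding theta_rep_def by blast
  have "siegel_act (M ** symplectic_inverse M) \<tau> = siegel_act M (siegel_act (symplectic_inverse M) \<tau>)"
    by (rule siegel_act_mult) (use r M(2) t H in \<open>auto simp: theta_rep_def\<close>)
  then show "siegel_act M (siegel_act (symplectic_inverse M) \<tau>) = \<tau>"
    by (simp add: symplectic_inverse(2)[OF M(1)] siegel_act_one)
qed

text \<open>The zero divisor of \<open>(azy)\<^sub>5\<close> is invariant under the modular group. So \<open>(azy)\<^sub>5\<close> vanishes on the image of the
divisor \<open>\<tau>\<^sub>2 = 1/2\<close> under \<open>M\<^sup>-\<^sup>1\<close>, and there \<open>Theta\<close> is proportional to \<open>\<rho>\<^sup>-\<^sup>1\<close> applied to its value on the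
divisor.\<close>

lemma azy5_poly_zero_on_mirror_11:
  assumes s: "azy5_signs s" and M: "M \<in> carrier Gamma2" "theta_rep M \<rho>"
    and X: "(\<rho> *v X) $ vector [1, 1] = 0"
  shows "azy5_poly s X = 0"
proof -
  obtain R where R: "\<rho> ** R = mat 1" "R ** \<rho> = mat 1" using M(2) unfolding theta_rep_def invertible_def by blast
  have "azy5_poly s (R *v Y) = 0" if "Y $ vector [1, 1] = 0" for Y
  proof (rule homogeneous_zero_if_zero_on_mirror[of 60 "\<lambda>Y. azy5_poly s (R *v Y)", OF _ _ that])
    show "homogeneous 60 (\<lambda>Y. azy5_poly s (R *v Y))"
      by (rule homogeneous_compose_linear[OF homogeneous_azy5_poly])
    fix t1 t3 assume H: "sym_mat t1 (1 / 2) t3 \<in> siegel_H2"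
    let ?t = "sym_mat t1 (1 / 2) t3" and ?M' = "symplectic_inverse M"
    let ?u = "siegel_act ?M' ?t"
    note inv = theta_rep_act_inverse[OF M H]
    have "azy5 s ?u = of_int (chi_P ?M') * det (cfactor ?M' ?t) ^ 30 * azy5 s ?t"
      using s symplectic_inverse(3)[OF M(1)] H unfolding azy5_signs_def modular_form_def by blast
    then have 0: "azy5_poly s (Theta ?u) = 0"
      using azy5_zero_on_mirror[OF s H] azy5_eq_poly[OF inv(2)] by simp
    obtain k where "Theta (siegel_act M ?u) = k *s (\<rho> *v Theta ?u)"
      using M(2) inv(2) unfolding theta_rep_def by blast
    then have "R *v Theta ?t = k *s Theta ?u"
      by (simp add: inv(1) matrix_vector_scale matrix_vector_mul_assoc R)
    then show "azy5_poly s (R *v Theta ?t) = 0"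
      using 0 homogeneous_scale[OF homogeneous_azy5_poly, of s k] by simp
  qed
  from this[OF X] show ?thesis by (simp add: matrix_vector_mul_assoc R)
qed

lemma generators_in_Gamma2:
  "trans11 k \<in> carrier Gamma2" "partial_inversion \<in> carrier Gamma2" "swap_coords \<in> carrier Gamma2"
  unfolding in_Gamma2_iff forall_2_2 by (simp_all add: generator_defs col_pairing_def)

text \<open>Conjugating the translation \<open>\<tau>\<^sub>1 \<mapsto> \<tau>\<^sub>1 + 2\<close>, which changes the sign of half of the coordinates, by the
partial inversion gives a shift of the first index. With the exchange of the two variables such shifts
move any coordinate to the last one.\<close>

lemma coordinate_to_11:
  "\<exists>M\<in>carrier Gamma2. \<exists>\<rho> c. theta_rep M \<rho> \<and> (\<forall>X. (\<rho> *v X) $ vector [1, 1] = c * X $ \<sigma>)"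
proof -
  obtain D where D: "theta_rep (trans11 2) D" "\<And>X \<sigma>. (D *v X) $ \<sigma> = bit_sign (\<sigma> $ 1) * X $ \<sigma>"
  proof -
    obtain D where D: "theta_rep (trans11 2) D"
      "\<And>X \<sigma>. (D *v X) $ \<sigma> = (if \<sigma> $ 1 = 1 then exp (of_real pi * \<i> / 2 * of_int 2) else 1) * X $ \<sigma>"
      using theta_rep_trans11[of 2] by blast
    have "(if x = 1 then exp (of_real pi * \<i> / 2 * of_int 2) else 1) = bit_sign x" for x
      by (simp add: bit_sign_def)
    then show ?thesis using D that by (simp only:)
  qed
  obtain S where S: "theta_rep partial_inversion S" "\<And>X \<sigma>. (S *v X) $ \<sigma> = X $ vector [0, \<sigma> $ 2] + bit_sign (\<sigma> $ 1) * X $ vector [1, \<sigma> $ 2]"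
    using theta_rep_partial_inversion by blast
  obtain W where W: "theta_rep swap_coords W" "\<And>X \<sigma>. (W *v X) $ \<sigma> = X $ vector [\<sigma> $ 2, \<sigma> $ 1]"
    using theta_rep_swap by blast
  \<comment> \<open>The Fourier transform in the first index conjugates the sign change to the shift.\<close>
  define M where "M = partial_inversion ** (trans11 2 ** partial_inversion)"
  define R where "R = S ** (D ** S)"
  have M: "M \<in> carrier Gamma2" "theta_rep M R"
    unfolding M_def R_def by (intro Gamma2_mult_closed generators_in_Gamma2 theta_rep_mult D S)+
  have R: "(R *v X) $ vector [1, y] = 2 * X $ vector [0, y]" "(R *v X) $ vector [0, y] = 2 * X $ vector [1, y]" for X y
    unfolding R_def by (simp_all add: matrix_vector_mul_assoc[symmetric] S D)
  have id: "theta_rep (mat 1) (mat 1)" "mat 1 \<in> carrier Gamma2"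
    using theta_rep_one by (simp_all add: Gamma2_def transpose_mat)
  have 1: "theta_rep (M ** swap_coords) (R ** W)" "M ** swap_coords \<in> carrier Gamma2"
    by (intro theta_rep_mult M W Gamma2_mult_closed generators_in_Gamma2)+
  have 2: "theta_rep (M ** swap_coords ** M) (R ** W ** R)" "M ** swap_coords ** M \<in> carrier Gamma2"
    by (intro theta_rep_mult M 1 Gamma2_mult_closed)+
  consider "\<sigma> = vector [0, 0]" | "\<sigma> = vector [0, 1]" | "\<sigma> = vector [1, 0]" | "\<sigma> = vector [1, 1]"
    by (cases "\<sigma> $ 1"; cases "\<sigma> $ 2"; simp add: bit2_eq_iff)
  then show ?thesis
  proof cases
    case 1
    have "(R ** W ** R *v X) $ vector [1, 1] = 4 * X $ \<sigma>" for X
      by (simp add: 1 matrix_vector_mul_assoc[symmetric] R W)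
    then show ?thesis using 2 by blast
  next
    case 2
    then show ?thesis using M R by blast
  next
    case 3
    have "(R ** W *v X) $ vector [1, 1] = 2 * X $ \<sigma>" for X
      by (simp add: 3 matrix_vector_mul_assoc[symmetric] R W)
    then show ?thesis using 1 by blast
  next
    case 4
    have "(mat 1 *v X) $ vector [1, 1] = 1 * X $ \<sigma>" for X :: "complex^(bit^2)" by (simp add: 4)
    then show ?thesis using id by blast
  qed
qed

lemma azy5_poly_zero_on_mirror:
  assumes s: "azy5_signs s" and M: "M \<in> carrier Gamma2" "theta_rep M \<rho>"
    and X: "(\<rho> *v X) $ \<sigma> = 0"
  shows "azy5_poly s X = 0"
proof -
  obtain M' \<rho>' c where M': "M' \<in> carrier Gamma2" "theta_rep M' \<rho>'" "\<And>X. (\<rho>' *v X) $ vector [1, 1] = c * X $ \<sigma>"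
    using coordinate_to_11 by blast
  show ?thesis
  proof (rule azy5_poly_zero_on_mirror_11[OF s])
    show "M' ** M \<in> carrier Gamma2" "theta_rep (M' ** M) (\<rho>' ** \<rho>)"
      using M M' by (auto intro: Gamma2_mult_closed theta_rep_mult)
    show "(\<rho>' ** \<rho> *v X) $ vector [1, 1] = 0"
      using X by (simp add: matrix_vector_mul_assoc[symmetric] M'(3))
  qed
qed

text \<open>The assumption makes the two linear forms proportional, so they have the same kernel. A Heisenberg
operator that becomes a sign change \<open>u\<close> after transport by \<open>B\<close> preserves this kernel. After transport by
\<open>A\<close> it becomes the operator of \<open>u' = ab\<^sup>-\<^sup>1 u\<close>, and a non-trivial shift in \<open>u'\<close> would move the kernel. So
\<open>ab\<^sup>-\<^sup>1\<close> maps sign changes to sign changes, which says that its lower left block is even.\<close>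

lemma Gamma20_2_if_common_mirror:
  assumes a: "a \<in> carrier Gamma2" "theta_rep a A" and b: "b \<in> carrier Gamma2" "theta_rep b B"
    and sub: "\<And>Y. (B *v Y) $ \<sigma>' = 0 \<Longrightarrow> (A *v Y) $ \<sigma> = 0"
  shows "a ** symplectic_inverse b \<in> Gamma20_2"
proof -
  let ?M = "a ** symplectic_inverse b"
  have A: "invertible A" and B: "invertible B" using a b by (auto simp: theta_rep_def)
  have sub': "(A *v X) $ \<sigma> \<noteq> 0" if X: "(B *v X) $ \<sigma>' \<noteq> 0" for X
  proof -
    obtain Z where Z: "A *v Z = axis \<sigma> 1" using invertible_surj[OF A] .
    then have AZ: "(A *v Z) $ \<sigma> = 1" by (simp add: axis_def)
    then have BZ: "(B *v Z) $ \<sigma>' \<noteq> 0" using sub[of Z] by auto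
    define t where "t = (B *v X) $ \<sigma>' / (B *v Z) $ \<sigma>'"
    have "(B *v (X - t *s Z)) $ \<sigma>' = 0"
      using BZ by (simp add: matrix_vector_mult_diff_distrib matrix_vector_scale t_def)
    then have "(A *v (X - t *s Z)) $ \<sigma> = 0" by (rule sub)
    then have "(A *v X) $ \<sigma> = t" using AZ by (simp add: matrix_vector_mult_diff_distrib matrix_vector_scale)
    then show ?thesis using X BZ by (simp add: t_def)
  qed
  have even: "mod2_act ?M u $ Inr 1 = 0 \<and> mod2_act ?M u $ Inr 2 = 0" if u: "u $ Inr 1 = 0" "u $ Inr 2 = 0" for u
  proof (rule ccontr)
    assume ne: "\<not> ?thesis"
    let ?w = "mod2_act (symplectic_inverse b) u"
    let ?u' = "mod2_act ?M u"
    have bw: "mod2_act b ?w = u"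
    proof -
      have "mod2_act b ?w = mod2_act (b ** symplectic_inverse b) u"
        by (simp add: map_matrix_mult matrix_vector_mul_assoc)
      also have "\<dots> = u"
      proof -
        have "map_matrix of_int (mat 1 :: mat4) = (mat 1 :: bit^(2 + 2)^(2 + 2))"
          by (simp add: vec_eq_iff mat_def)
        then show ?thesis by (simp add: symplectic_inverse(2)[OF b(1)])
      qed
      finally show ?thesis .
    qed
    have aw: "mod2_act a ?w = ?u'" by (simp add: map_matrix_mult matrix_vector_mul_assoc)
    obtain cA where cA: "cA \<noteq> 0" "\<And>X. A *v heisenberg ?w X = cA *s heisenberg ?u' (A *v X)"
      using a(2) aw unfolding theta_rep_def by metis
    obtain cB where cB: "cB \<noteq> 0" "\<And>X. B *v heisenberg ?w X = cB *s heisenberg u (B *v X)"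
      using b(2) bw unfolding theta_rep_def by metis
    have bs: "phase x y \<noteq> 0" for x y by (simp add: phase_def bit_sign_def)
    define \<rho> where "\<rho> = shift ?u' \<sigma>"
    have "\<rho> \<noteq> \<sigma>" using ne by (auto simp: \<rho>_def shift_def bit2_eq_iff)
    obtain X where X: "A *v X = axis \<rho> 1" using invertible_surj[OF A] .
    have "(A *v heisenberg ?w X) $ \<sigma> = cA * (phase ?u' \<sigma> * (A *v X) $ \<rho>)"
      unfolding cA(2) by (simp only: heisenberg_nth vector_smult_component \<rho>_def)
    also have "(A *v X) $ \<rho> = 1" unfolding X by (simp add: axis_def)
    finally have "(A *v heisenberg ?w X) $ \<sigma> \<noteq> 0" using cA(1) bs by simp
    then have "(B *v heisenberg ?w X) $ \<sigma>' \<noteq> 0" using sub by blast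
    moreover have "(B *v heisenberg ?w X) $ \<sigma>' = cB * (phase u \<sigma>' * (B *v X) $ \<sigma>')"
    proof -
      have "shift u \<sigma>' = \<sigma>'" by (simp add: shift_def bit2_eq_iff u)
      then show ?thesis unfolding cB(2) by (simp only: heisenberg_nth vector_smult_component)
    qed
    ultimately have "(B *v X) $ \<sigma>' \<noteq> 0" by auto
    then have "(A *v X) $ \<sigma> \<noteq> 0" by (rule sub')
    then show False using \<open>\<rho> \<noteq> \<sigma>\<close> unfolding X by (simp add: axis_def)
  qed
  have "?M $ Inr i $ Inl j \<in> {z. even z}" for i j
  proof -
    have "mod2_act ?M (axis (Inl j) 1) $ Inr 1 = 0 \<and> mod2_act ?M (axis (Inl j) 1) $ Inr 2 = 0"
      by (rule even) (simp_all add: axis_def)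
    moreover have "mod2_act ?M (axis (Inl j) 1) $ Inr k = of_int (?M $ Inr k $ Inl j)" for k
      by (simp add: matrix_vector_mult_def axis_def if_distrib cong: if_cong)
    ultimately have "\<forall>i. of_int (?M $ Inr i $ Inl j) = (0 :: bit)" unfolding forall_2 by simp
    then show ?thesis by (simp add: of_int_bit)
  qed
  then show ?thesis
    using Gamma2_mult_closed[OF a(1) symplectic_inverse(3)[OF b(1)]] by (simp add: Gamma20_2_def block_c_def)
qed

lemma card_bit2: "card (UNIV :: (bit^2) set) = 4"
proof -
  have "card (UNIV :: (bit^2) set) = (\<Sum>\<sigma>\<in>(UNIV :: (bit^2) set). 1)" by simp
  then show ?thesis unfolding sum_bit2 by simp
qed

theorem corollary2:
  fixes g :: "nat \<Rightarrow> mat4"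
    and s :: "characteristic set \<Rightarrow> int"
    and \<phi> :: "complex^2^2 \<Rightarrow> complex"
  assumes reps: "\<forall>i\<in>{1..15}. g i \<in> carrier Gamma2"
      "bij_betw (\<lambda>i. Gamma20_2 #>\<^bsub>Gamma2\<^esub> g i) {1..15} (rcosets\<^bsub>Gamma2\<^esub> Gamma20_2)"
    and phi: "\<And>\<tau>. \<phi> \<tau> = (\<Prod>i=1..15. phi_gamma (g i) \<tau>)"
    and signs: "azy5_signs s"
  shows "\<exists>l :: complex. l \<noteq> 0 \<and> (\<forall>\<tau>\<in>siegel_H2. \<phi> \<tau> = l * azy5 s \<tau>)"
proof -
  have "\<forall>i\<in>{1..15}. \<exists>\<rho>. theta_rep (g i) \<rho>" using reps(1) theta_rep_exists by blast
  then obtain R where R: "\<And>i. i \<in> {1..15} \<Longrightarrow> theta_rep (g i) (R i)" by metis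
  have gi: "g i \<in> carrier Gamma2" if "i \<in> {1..15}" for i using reps(1) that by blast
  let ?K = "{1..15::nat} \<times> (UNIV :: (bit^2) set)"
  let ?v = "\<lambda>(i, \<sigma>). R i $ \<sigma>"
  have v: "scalar_product (?v k) X = (R (fst k) *v X) $ snd k" for k X
    by (cases k) (simp add: scalar_product_row)
  \<comment> \<open>Forms of different cosets by the Heisenberg argument, forms of one coset by invertibility.\<close>
  have indep: "\<exists>Y. scalar_product (?v k') Y = 0 \<and> scalar_product (?v k) Y \<noteq> 0"
    if "k \<in> ?K" "k' \<in> ?K" "k \<noteq> k'" for k k'
  proof (rule ccontr)
    assume no: "\<not> ?thesis"
    obtain i \<sigma> j \<sigma>' where k: "k = (i, \<sigma>)" "k' = (j, \<sigma>')" by (metis prod.exhaust)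
    then have ij: "i \<in> {1..15}" "j \<in> {1..15}" using that by auto
    have sub: "(R i *v Y) $ \<sigma> = 0" if "(R j *v Y) $ \<sigma>' = 0" for Y
      using no that unfolding v k by auto
    have "g i ** symplectic_inverse (g j) \<in> Gamma20_2"
      by (rule Gamma20_2_if_common_mirror[OF gi[OF ij(1)] R[OF ij(1)] gi[OF ij(2)] R[OF ij(2)] sub])
    then have "Gamma20_2 #>\<^bsub>Gamma2\<^esub> g i = Gamma20_2 #>\<^bsub>Gamma2\<^esub> g j"
      by (rule rcos_eqI[OF gi[OF ij(1)] gi[OF ij(2)]])
    then have "i = j" using bij_betw_imp_inj_on[OF reps(2)] ij by (auto dest: inj_onD)
    then have "\<sigma> \<noteq> \<sigma>'" using that k by auto
    have "invertible (R i)" using R[OF ij(1)] by (simp add: theta_rep_def)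
    then obtain Y where "R i *v Y = axis \<sigma> 1" using invertible_surj by blast
    then show False using sub[of Y] \<open>\<sigma> \<noteq> \<sigma>'\<close> \<open>i = j\<close> by (simp add: axis_def)
  qed
  have nz: "?v k \<noteq> 0" if "k \<in> ?K" for k
  proof -
    obtain i \<sigma> where k: "k = (i, \<sigma>)" by (cases k)
    have "invertible (R i)" using R[of i] that k by (simp add: theta_rep_def)
    then obtain Y where "R i *v Y = axis \<sigma> 1" using invertible_surj by blast
    then have "scalar_product (?v k) Y = 1" unfolding v by (simp add: k axis_def)
    then show ?thesis by (auto simp: scalar_product_def)
  qed
  have "\<exists>h. homogeneous 0 h \<and> (\<forall>X. azy5_poly s X = (\<Prod>k\<in>?K. scalar_product (?v k) X) * h X)"
  proof (rule product_of_linear_forms_divides)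
    have "card ?K = 60" unfolding card_cartesian_product card_bit2 by simp
    then show "homogeneous (card ?K + 0) (azy5_poly s)" using homogeneous_azy5_poly by simp
    show "azy5_poly s X = 0" if "k \<in> ?K" "scalar_product (?v k) X = 0" for k X
    proof -
      have i: "fst k \<in> {1..15}" using that(1) by auto
      show ?thesis
        by (rule azy5_poly_zero_on_mirror[OF signs gi[OF i] R[OF i]]) (use that(2) in \<open>simp only: v\<close>)
    qed
  qed (use indep nz in \<open>auto simp del: split_paired_All\<close>)
  then obtain h where h: "homogeneous 0 h" "\<And>X. azy5_poly s X = (\<Prod>k\<in>?K. scalar_product (?v k) X) * h X"
    by blast
  from h(1) obtain c where "\<And>X. h X = c" by auto
  then have c: "azy5_poly s X = (\<Prod>k\<in>?K. scalar_product (?v k) X) * c" for X using h(2) by simp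
  have P: "azy5 s \<tau> = c * (\<Prod>i=1..15. \<Prod>\<sigma>\<in>UNIV. (R i *v Theta \<tau>) $ \<sigma>)" if "\<tau> \<in> siegel_H2" for \<tau>
    unfolding azy5_eq_poly[OF that] c prod.cartesian_product
    by (simp add: v case_prod_unfold scalar_product_row mult.commute)
  have c0: "c \<noteq> 0" using signs P by (auto simp: azy5_signs_def)
  have "\<forall>i\<in>{1..15}. \<exists>z. z \<noteq> 0 \<and> (\<forall>\<tau>\<in>siegel_H2. phi_gamma (g i) \<tau> = z * (\<Prod>\<sigma>\<in>UNIV. (R i *v Theta \<tau>) $ \<sigma>))"
  proof
    fix i :: nat assume i: "i \<in> {1..15}"
    obtain z where z: "z \<noteq> 0" "\<And>\<tau>. \<tau> \<in> siegel_H2 \<Longrightarrow> det (cfactor (g i) \<tau>) \<noteq> 0 \<and>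
        (\<exists>\<kappa>. \<kappa> ^ 4 = z * det (cfactor (g i) \<tau>) ^ 2 \<and> Theta (siegel_act (g i) \<tau>) = \<kappa> *s (R i *v Theta \<tau>))"
      using R[OF i] unfolding theta_rep_def by blast
    let ?chi = "inverse (of_int (chi_P (g i))) :: complex"
    have "phi_gamma (g i) \<tau> = (?chi * z) * (\<Prod>\<sigma>\<in>UNIV. (R i *v Theta \<tau>) $ \<sigma>)" if t: "\<tau> \<in> siegel_H2" for \<tau>
    proof -
      have d: "det (cfactor (g i) \<tau>) \<noteq> 0" using z(2)[OF t] by blast
      obtain \<kappa> where k: "\<kappa> ^ 4 = z * det (cfactor (g i) \<tau>) ^ 2" "Theta (siegel_act (g i) \<tau>) = \<kappa> *s (R i *v Theta \<tau>)"
        using z(2)[OF t] by blast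
      have "F_M0 (siegel_act (g i) \<tau>) = (\<Prod>\<sigma>\<in>UNIV. Theta (siegel_act (g i) \<tau>) $ \<sigma>)"
        by (simp add: F_M0_def Theta_def)
      also have "\<dots> = \<kappa> ^ 4 * (\<Prod>\<sigma>\<in>UNIV. (R i *v Theta \<tau>) $ \<sigma>)"
        unfolding k(2) by (simp only: vector_smult_component prod.distrib prod_constant card_bit2)
      finally show ?thesis using d by (simp add: phi_gamma_def k(1) power_int_minus field_simps)
    qed
    moreover have "?chi * z \<noteq> 0" using z(1) chi_P_cases[of "g i"] by auto
    ultimately show "\<exists>z. z \<noteq> 0 \<and> (\<forall>\<tau>\<in>siegel_H2. phi_gamma (g i) \<tau> = z * (\<Prod>\<sigma>\<in>UNIV. (R i *v Theta \<tau>) $ \<sigma>))"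
      by blast
  qed
  then obtain z where z: "\<And>i. i \<in> {1..15} \<Longrightarrow> z i \<noteq> 0"
    "\<And>i \<tau>. i \<in> {1..15} \<Longrightarrow> \<tau> \<in> siegel_H2 \<Longrightarrow> phi_gamma (g i) \<tau> = z i * (\<Prod>\<sigma>\<in>UNIV. (R i *v Theta \<tau>) $ \<sigma>)"
    by metis
  have "\<phi> \<tau> = (\<Prod>i=1..15. z i) / c * azy5 s \<tau>" if t: "\<tau> \<in> siegel_H2" for \<tau>
  proof -
    have "\<phi> \<tau> = (\<Prod>i=1..15. z i * (\<Prod>\<sigma>\<in>UNIV. (R i *v Theta \<tau>) $ \<sigma>))"
      unfolding phi by (rule prod.cong) (use z(2) t in auto)
    then show ?thesis unfolding P[OF t] using c0 by (simp add: prod.distrib)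
  qed
  moreover have "(\<Prod>i=1..15. z i) / c \<noteq> 0" using z(1) c0 by simp
  ultimately show ?thesis by blast
qed

end
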